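(* Let $n\ge 1$, let $K$ be a separable unimodular locally compact group of type I, and let $G=\mathbb{R}^n\times K$. For any $f\in L^2(\mathbb{R}^n\times K)$ and any real numbers $a,b\ge 1$, $$\frac{n\,\|f\|_2^{\left(\frac1a+\frac1b\right)}}{4\pi}\le\left(\int_{\mathbb{R}^n}\int_K\|x\|^{2a}\,|f(x,k)|^2\,dk\,dx\right)^{\frac1{2a}}\left(\int_{\mathbb{R}^n}\int_{\widehat K}\|y\|^{2b}\,\|\widehat f(y,\sigma)\|_{\mathrm{HS}}^2\,dy\,d\sigma\right)^{\frac1{2b}}.$$
   Context: The Haar measure on $G=\mathbb{R}^n\times K$ is $dx\,dk$, where $dx$ is Lebesgue measure on $\mathbb{R}^n$ and $dk$ is a (left) Haar measure on $K$; $\|f\|_2$ is the $L^2$-norm with respect to this measure. $\|\cdot\|$ is the Euclidean norm and $\langle\cdot,\cdot\rangle$ the usual inner product on $\mathbb{R}^n$. $\widehat K$ is the unitary dual of $K$, and $d\sigma$ is the Plancherel measure on $\widehat K$ corresponding to $dk$, so that $\int_K|g(k)|^2\,dk=\int_{\widehat K}\|\widehat g(\sigma)\|_{\mathrm{HS}}^2\,d\sigma$ with $\widehat g(\sigma)=\int_K g(k)\sigma(k^{-1})\,dk$ for $g\in L^1\cap L^2(K)$. $\|\cdot\|_{\mathrm{HS}}$ is the Hilbert–Schmidt norm. The dual of $G$ is $\mathbb{R}^n\times\widehat K$, and the Fourier transform of $f$ is $$\widehat f(y,\sigma)=\int_{\mathbb{R}^n}\int_K f(x,k)\,e^{-2\pi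 i\langle x,y\rangle}\,\sigma(k^{-1})\,dk\,dx,\qquad (y,\sigma)\in\mathbb{R}^n\times\widehat K,$$ defined by this integral for $f\in L^1\cap L^2(G)$ and extended to $f\in L^2(G)$ by density, via the Plancherel theorem. Integrals on the right-hand side of the inequality may equal $+\infty$, in which case (for $f\ne0$) the right-hand side is $+\infty$. *)

theory Defs
  imports "HOL-Analysis.Analysis" "HOL-Library.Extended_Nat"
begin

text \<open>
  The group K is a type of class \<^class>\<open>topological_group_add\<close>. That class does not assume
  commutativity: the group law is written k + l and the inverse - k.
\<close>

section \<open>Separable Hilbert spaces and bounded operators\<close>

text \<open>
  Every separable complex Hilbert space is realised as a closed subspace H of l^2(N). An operator
  with domain H is a function on sequences of which only the values on H matter.
\<close>

type_synonym hvec = "nat \<Rightarrow> complex"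
type_synonym hop = "hvec \<Rightarrow> hvec"

definition ell2 :: "hvec set" where
  "ell2 = {v. summable (\<lambda>i. (cmod (v i))\<^sup>2)}"

definition vinner :: "hvec \<Rightarrow> hvec \<Rightarrow> complex" where
  "vinner u v = (\<Sum>i. u i * cnj (v i))"

definition vnorm :: "hvec \<Rightarrow> real" where
  "vnorm v = sqrt (\<Sum>i. (cmod (v i))\<^sup>2)"

definition basis_vec :: "nat \<Rightarrow> hvec" where
  "basis_vec j = (\<lambda>i. if i = j then 1 else 0)"

definition closed_subspace :: "hvec set \<Rightarrow> bool" where
  "closed_subspace H \<longleftrightarrow> H \<subseteq> ell2 \<and> (\<lambda>i. 0) \<in> H \<and>
     (\<forall>u\<in>H. \<forall>v\<in>H. (\<lambda>i. u i + v i) \<in> H) \<and>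
     (\<forall>c. \<forall>u\<in>H. (\<lambda>i. c * u i) \<in> H) \<and>
     (\<forall>s. \<forall>v\<in>ell2. (\<forall>m::nat. s m \<in> H) \<longrightarrow>
        (\<lambda>m. vnorm (\<lambda>i. s m i - v i)) \<longlonglongrightarrow> 0 \<longrightarrow> v \<in> H)"

text \<open>The standard Hilbert space of dimension d, where d may be infinite.\<close>

definition std_space :: "enat \<Rightarrow> hvec set" where
  "std_space d = {v \<in> ell2. \<forall>i. d \<le> enat i \<longrightarrow> v i = 0}"

definition linear_op :: "hvec set \<Rightarrow> hvec set \<Rightarrow> hop \<Rightarrow> bool" where
  "linear_op H H' T \<longleftrightarrow> (\<forall>u\<in>H. T u \<in> H') \<and>
     (\<forall>u\<in>H. \<forall>v\<in>H. T (\<lambda>i. u i + v i) = (\<lambda>i. T u i + T v i)) \<and>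
     (\<forall>c. \<forall>u\<in>H. T (\<lambda>i. c * u i) = (\<lambda>i. c * T u i))"

definition bounded_op :: "hvec set \<Rightarrow> hvec set \<Rightarrow> hop \<Rightarrow> bool" where
  "bounded_op H H' T \<longleftrightarrow> linear_op H H' T \<and> (\<exists>B. \<forall>u\<in>H. vnorm (T u) \<le> B * vnorm u)"

definition unitary_op :: "hvec set \<Rightarrow> hvec set \<Rightarrow> hop \<Rightarrow> bool" where
  "unitary_op H H' U \<longleftrightarrow> linear_op H H' U \<and> U ` H = H' \<and> (\<forall>u\<in>H. vnorm (U u) = vnorm u)"

text \<open>
  Squared Hilbert--Schmidt norm, as the sum of |T e|^2 over an orthonormal basis. It is only used
  for H = \<^term>\<open>std_space d\<close>, of which the standard unit vectors lying in H are a basis.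
\<close>

definition hs_norm_sq :: "hvec set \<Rightarrow> hop \<Rightarrow> ennreal" where
  "hs_norm_sq H T = (\<Sum>j. if basis_vec j \<in> H then ennreal ((vnorm (T (basis_vec j)))\<^sup>2) else 0)"

section \<open>Unitary representations\<close>

definition unitary_rep :: "hvec set \<Rightarrow> ('k::topological_group_add \<Rightarrow> hop) \<Rightarrow> bool" where
  "unitary_rep H \<pi> \<longleftrightarrow> closed_subspace H \<and> (\<forall>k. unitary_op H H (\<pi> k)) \<and>
     (\<forall>k l. \<forall>u\<in>H. \<pi> (k + l) u = \<pi> k (\<pi> l u)) \<and>
     (\<forall>u\<in>H. \<forall>k. ((\<lambda>l. vnorm (\<lambda>i. \<pi> l u i - \<pi> k u i)) \<longlongrightarrow> 0) (at k))"

definition invariant_under :: "('k \<Rightarrow> hop) \<Rightarrow> hvec set \<Rightarrow> bool" where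
  "invariant_under \<pi> W \<longleftrightarrow> (\<forall>k. \<forall>u\<in>W. \<pi> k u \<in> W)"

definition irreducible_rep :: "hvec set \<Rightarrow> ('k::topological_group_add \<Rightarrow> hop) \<Rightarrow> bool" where
  "irreducible_rep H \<pi> \<longleftrightarrow> unitary_rep H \<pi> \<and> H \<noteq> {\<lambda>i. 0} \<and>
     (\<forall>W. closed_subspace W \<longrightarrow> W \<subseteq> H \<longrightarrow> invariant_under \<pi> W \<longrightarrow> W = {\<lambda>i. 0} \<or> W = H)"

definition unitarily_equivalent ::
  "hvec set \<Rightarrow> ('k \<Rightarrow> hop) \<Rightarrow> hvec set \<Rightarrow> ('k \<Rightarrow> hop) \<Rightarrow> bool" where
  "unitarily_equivalent H \<pi> H' \<pi>' \<longleftrightarrow>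
     (\<exists>U. unitary_op H H' U \<and> (\<forall>k. \<forall>u\<in>H. U (\<pi> k u) = \<pi>' k (U u)))"

definition commutant :: "hvec set \<Rightarrow> ('k \<Rightarrow> hop) \<Rightarrow> hop set" where
  "commutant H \<pi> = {T. bounded_op H H T \<and> (\<forall>k. \<forall>u\<in>H. T (\<pi> k u) = \<pi> k (T u))}"

text \<open>Primary (factor) representations: the centre of the commutant consists of scalars.\<close>

definition primary_rep :: "hvec set \<Rightarrow> ('k::topological_group_add \<Rightarrow> hop) \<Rightarrow> bool" where
  "primary_rep H \<pi> \<longleftrightarrow> unitary_rep H \<pi> \<and> H \<noteq> {\<lambda>i. 0} \<and>
     (\<forall>T\<in>commutant H \<pi>. (\<forall>S\<in>commutant H \<pi>. \<forall>u\<in>H. T (S u) = S (T u)) \<longrightarrow>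
        (\<exists>c. \<forall>u\<in>H. T u = (\<lambda>i. c * u i)))"

text \<open>
  (H, \<open>\<pi>\<close>) is a Hilbert space direct sum of copies of (H', \<open>\<rho>\<close>): H is the smallest closed subspace
  containing a family of pairwise orthogonal invariant subspaces, each equivalent to \<open>\<rho>\<close>.
\<close>

definition multiple_of_rep ::
  "hvec set \<Rightarrow> ('k \<Rightarrow> hop) \<Rightarrow> hvec set \<Rightarrow> ('k \<Rightarrow> hop) \<Rightarrow> bool" where
  "multiple_of_rep H \<pi> H' \<rho> \<longleftrightarrow>
     (\<exists>\<W>. (\<forall>W\<in>\<W>. closed_subspace W \<and> W \<subseteq> H \<and> invariant_under \<pi> W \<and>
               unitarily_equivalent H' \<rho> W \<pi>) \<and>
          (\<forall>V\<in>\<W>. \<forall>W\<in>\<W>. V \<noteq> W \<longrightarrow> (\<forall>u\<in>V. \<forall>v\<in>W. vinner u v = 0)) \<and>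
          (\<forall>V. closed_subspace V \<longrightarrow> \<Union>\<W> \<subseteq> V \<longrightarrow> H \<subseteq> V))"

text \<open>
  Type I: every primary representation is a multiple of an irreducible one. Representations are
  on separable Hilbert spaces, as is usual for second countable groups.
\<close>

definition type_I_group :: "'k::topological_group_add itself \<Rightarrow> bool" where
  "type_I_group _ \<longleftrightarrow> (\<forall>H (\<pi> :: 'k \<Rightarrow> hop). primary_rep H \<pi> \<longrightarrow>
     (\<exists>H' \<rho>. irreducible_rep H' \<rho> \<and> multiple_of_rep H \<pi> H' \<rho>))"

section \<open>Haar measure\<close>

definition radon_measure :: "'k::topological_space measure \<Rightarrow> bool" where
  "radon_measure M \<longleftrightarrow> sets M = sets borel \<and>
     (\<forall>C. compact C \<longrightarrow> emeasure M C < \<infinity>) \<and>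
     (\<forall>A\<in>sets borel. emeasure M A = (INF U\<in>{U. open U \<and> A \<subseteq> U}. emeasure M U)) \<and>
     (\<forall>U. open U \<longrightarrow> emeasure M U = (SUP C\<in>{C. compact C \<and> C \<subseteq> U}. emeasure M C))"

definition left_haar_measure :: "'k::topological_group_add measure \<Rightarrow> bool" where
  "left_haar_measure M \<longleftrightarrow> radon_measure M \<and> emeasure M UNIV \<noteq> 0 \<and>
     (\<forall>k. \<forall>A\<in>sets borel. emeasure M ((\<lambda>x. k + x) ` A) = emeasure M A)"

definition unimodular_group :: "'k::topological_group_add itself \<Rightarrow> bool" where
  "unimodular_group _ \<longleftrightarrow> (\<forall>M :: 'k measure. left_haar_measure M \<longrightarrow>
     (\<forall>k. \<forall>A\<in>sets borel. emeasure M ((\<lambda>x. x + k) ` A) = emeasure M A))"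

section \<open>The unitary dual and its Mackey Borel structure\<close>

text \<open>
  All irreducible representations on the standard spaces, with the smallest sigma-algebra making
  the dimension and all matrix coefficients measurable. The dual is the set of unitary equivalence
  classes, with the quotient sigma-algebra; the preimage in \<open>irreps\<close> of a set A of classes is its
  union.
\<close>

type_synonym 'k urep = "hvec set \<times> ('k \<Rightarrow> hop)"

definition irreps :: "'k::topological_group_add urep set" where
  "irreps = {(H, \<pi>). irreducible_rep H \<pi> \<and> (\<exists>d. H = std_space d)}"

definition irreps_space :: "'k::topological_group_add urep measure" where
  "irreps_space = sigma irreps
     ({{(H, \<pi>) \<in> irreps. H = std_space d} | d. True} \<union>
      {{(H, \<pi>) \<in> irreps. H = std_space d \<and> vinner (\<pi> k u) v \<in> B} | d k u v B.
         u \<in> std_space d \<and> v \<in> std_space d \<and> B \<in> sets borel})"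

definition unitary_dual :: "'k::topological_group_add urep set set" where
  "unitary_dual = irreps // {((H, \<pi>), (H', \<pi>')).
     (H, \<pi>) \<in> irreps \<and> (H', \<pi>') \<in> irreps \<and> unitarily_equivalent H \<pi> H' \<pi>'}"

definition dual_space :: "'k::topological_group_add urep set measure" where
  "dual_space = sigma unitary_dual {A. A \<subseteq> unitary_dual \<and> \<Union>A \<in> sets irreps_space}"

text \<open>
  A measurable choice of a concrete representation \<open>rep \<sigma>\<close> in each class \<open>\<sigma>\<close>; the operator-valued
  Fourier transform takes its values in the operators on the space of \<open>rep \<sigma>\<close>. Such a choice
  exists for second countable groups of type I, and Hilbert--Schmidt norms do not depend on it.
\<close>

definition measurable_section ::
  "('k::topological_group_add urep set \<Rightarrow> 'k urep) \<Rightarrow> bool" where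
  "measurable_section rep \<longleftrightarrow> rep \<in> measurable dual_space irreps_space \<and>
     (\<forall>\<sigma>\<in>unitary_dual. rep \<sigma> \<in> \<sigma>)"

section \<open>Fourier transform and Plancherel measure\<close>

definition in_L2 :: "'a measure \<Rightarrow> ('a \<Rightarrow> complex) \<Rightarrow> bool" where
  "in_L2 M f \<longleftrightarrow> f \<in> borel_measurable M \<and> integrable M (\<lambda>x. (cmod (f x))\<^sup>2)"

definition L2_norm :: "'a measure \<Rightarrow> ('a \<Rightarrow> complex) \<Rightarrow> real" where
  "L2_norm M f = sqrt (\<integral>x. (cmod (f x))\<^sup>2 \<partial>M)"

text \<open>
  The operator-valued integrals are written coordinatewise: coordinate i of the image of v
  is the integral of coordinate i of the integrand applied to v, so that the
  operator is the weak integral.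
\<close>

definition fourier_K ::
  "'k::topological_group_add measure \<Rightarrow> ('k \<Rightarrow> complex) \<Rightarrow> ('k \<Rightarrow> hop) \<Rightarrow> hop" where
  "fourier_K \<mu> g \<pi> = (\<lambda>v i. \<integral>k. g k * \<pi> (- k) v i \<partial>\<mu>)"

definition fourier_G ::
  "'k::topological_group_add measure \<Rightarrow> ((real^'n::finite) \<times> 'k \<Rightarrow> complex) \<Rightarrow>
   real^'n \<Rightarrow> ('k \<Rightarrow> hop) \<Rightarrow> hop" where
  "fourier_G \<mu> f y \<pi> = (\<lambda>v i. \<integral>x. (\<integral>k. f (x, k) *
      exp (- 2 * complex_of_real pi * \<i> * complex_of_real (x \<bullet> y)) * \<pi> (- k) v i \<partial>\<mu>) \<partial>lborel)"

text \<open>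
  The Plancherel measure on the dual associated with the Haar measure \<open>\<mu>\<close>; for second countable
  unimodular groups of type I it is the unique measure with this property.
\<close>

definition plancherel_measure ::
  "'k::topological_group_add measure \<Rightarrow> ('k urep set \<Rightarrow> 'k urep) \<Rightarrow> 'k urep set measure \<Rightarrow> bool"
  where
  "plancherel_measure \<mu> rep \<nu> \<longleftrightarrow> sets \<nu> = sets dual_space \<and>
     (\<forall>g. integrable \<mu> g \<longrightarrow> in_L2 \<mu> g \<longrightarrow>
        (\<integral>\<^sup>+k. ennreal ((cmod (g k))\<^sup>2) \<partial>\<mu>) =
        (\<integral>\<^sup>+\<sigma>. hs_norm_sq (fst (rep \<sigma>)) (fourier_K \<mu> g (snd (rep \<sigma>))) \<partial>\<nu>))"

text \<open>Measurable fields of bounded operators over \<open>R^n \<times> dual K\<close>.\<close>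

definition measurable_op_field ::
  "('k::topological_group_add urep set \<Rightarrow> 'k urep) \<Rightarrow> 'k urep set measure \<Rightarrow>
   (real^'n::finite \<Rightarrow> 'k urep set \<Rightarrow> hop) \<Rightarrow> bool" where
  "measurable_op_field rep \<nu> F \<longleftrightarrow>
     (\<forall>y. \<forall>\<sigma>\<in>unitary_dual. bounded_op (fst (rep \<sigma>)) (fst (rep \<sigma>)) (F y \<sigma>)) \<and>
     (\<forall>i j. (\<lambda>(y, \<sigma>). if basis_vec j \<in> fst (rep \<sigma>) then F y \<sigma> (basis_vec j) i else 0)
        \<in> borel_measurable (lborel \<Otimes>\<^sub>M \<nu>))"

text \<open>
  F is (a representative of) the Fourier transform of f in \<open>L^2(R^n \<times> K)\<close>: the limit, in the
  Hilbert space of square integrable fields of Hilbert--Schmidt operators, of the transforms of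
  functions in \<open>L^1 \<inter> L^2\<close> converging to f. By the Plancherel theorem F exists, is unique up to
  null sets and does not depend on the approximating sequence.
\<close>

definition is_L2_fourier ::
  "'k::topological_group_add measure \<Rightarrow> ('k urep set \<Rightarrow> 'k urep) \<Rightarrow> 'k urep set measure \<Rightarrow>
   ((real^'n::finite) \<times> 'k \<Rightarrow> complex) \<Rightarrow> (real^'n \<Rightarrow> 'k urep set \<Rightarrow> hop) \<Rightarrow> bool" where
  "is_L2_fourier \<mu> rep \<nu> f F \<longleftrightarrow> measurable_op_field rep \<nu> F \<and>
     (\<exists>fs :: nat \<Rightarrow> (real^'n) \<times> 'k \<Rightarrow> complex.
        (\<forall>m. integrable (lborel \<Otimes>\<^sub>M \<mu>) (fs m) \<and> in_L2 (lborel \<Otimes>\<^sub>M \<mu>) (fs m)) \<and>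
        (\<lambda>m. L2_norm (lborel \<Otimes>\<^sub>M \<mu>) (\<lambda>z. fs m z - f z)) \<longlonglongrightarrow> 0 \<and>
        (\<lambda>m. \<integral>\<^sup>+y. (\<integral>\<^sup>+\<sigma>. hs_norm_sq (fst (rep \<sigma>))
               (\<lambda>v i. fourier_G \<mu> (fs m) y (snd (rep \<sigma>)) v i - F y \<sigma> v i) \<partial>\<nu>) \<partial>lborel)
          \<longlonglongrightarrow> 0)"

text \<open>Powers of extended nonnegative reals with exponent p > 0.\<close>

definition ennpowr :: "ennreal \<Rightarrow> real \<Rightarrow> ennreal" where
  "ennpowr t p = (if t = \<infinity> then \<infinity> else ennreal (enn2real t powr p))"

end

(*
  A sharp uncertainty inequality needs only how the Fourier transform acts on translations. For
  t > 0 and a basis vector b of R^n, the translate f_t(x, k) = f(x + t b, k) satisfies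
    t |f|^2 = \int (x . b) (|f|^2 - |f_t|^2),
  and AM-GM bounds the right-hand side by |f_t - f|^2 and \int (x . b)^2 (|f|^2 + |f_t|^2). By
  Plancherel |f_t - f|^2 is at most (2 pi t)^2 \int (y . b)^2 |F|^2, so letting t tend to 0 and summing
  over b gives the case a = b = 1; general exponents follow from Hoelder's inequality against
  |f|^2 and |F|^2.

  Plancherel for L^1 \cap L^2 on R^n x K comes from the hypothesis on K by Fubini and from the
  theorem on R^n, proved by Gaussian regularisation and continuity of the autocorrelation.
  Inequalities |u + v|^2 <= (1 + e) |u|^2 + (1 + 1/e) |v|^2 carry it to the L^2 limit.
*)
theory Submission
  imports Defs "HOL-Probability.Characteristic_Functions"
begin

section \<open>The Plancherel theorem on Euclidean space\<close>

text \<open>Translations stand in for derivatives because \<open>f\<close> is merely square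
  integrable: a translate is always in L^2, so neither weak derivatives nor operator domains occur,
  and finite second moments are the only regularity involved.

  The constant: with X and Y the second moments of \<open>f\<close> and \<open>F\<close>, AM-GM
  leaves n |f|^2 <= 2 pi^2 \<beta> Y + (2 / \<beta>) X for every \<beta> > 0, and the minimum of the
  right-hand side is 4 pi sqrt (X Y). One \<beta> serves all coordinates, so that the coordinate
  bounds add up to full moments before it is optimised.

  The obstacle is that the transform is operator valued and, off L^1, only a limit. Operators are
  therefore replaced by infinite matrices of entries in the standard basis, Hilbert-Schmidt norms by
  double sums, and only inequalities between weighted square norms are carried to the limit. One
  degenerate case needs care: an infinite moment makes the right-hand side infinite only when the
  other moment is nonzero, which on the dual side requires |f|^2 to be controlled by |F|^2.\<close>

definition echar :: "real \<Rightarrow> complex" where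
  "echar t = exp (- 2 * complex_of_real pi * \<i> * complex_of_real t)"

lemma echar_cis: "echar t = cis (- 2 * pi * t)"
  by (simp add: echar_def cis_conv_exp mult_ac)

lemma echar_0 [simp]: "echar 0 = 1"
  by (simp add: echar_def)

lemma echar_add: "echar (s + t) = echar s * echar t"
  by (simp add: echar_cis cis_mult algebra_simps)

lemma norm_echar [simp]: "cmod (echar t) = 1"
  by (simp add: echar_cis)

lemma continuous_on_echar [continuous_intros]:
  "continuous_on A f \<Longrightarrow> continuous_on A (\<lambda>x. echar (f x))"
  unfolding echar_def by (intro continuous_intros)

lemma borel_measurable_echar [measurable]: "echar \<in> borel_measurable borel"
  by (intro borel_measurable_continuous_onI continuous_intros)

section \<open>Fourier transform of the Gaussian\<close>

lemma integrable_std_normal_iexp: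
  "integrable lborel (\<lambda>x::real. complex_of_real (exp (- (x\<^sup>2 / 2))) * iexp (t * x))"
  and integral_std_normal_iexp:
  "(\<integral>x. complex_of_real (exp (- (x\<^sup>2 / 2))) * iexp (t * x) \<partial>lborel) =
    complex_of_real (sqrt (2 * pi) * exp (- (t\<^sup>2 / 2)))"
proof -
  have eq: "complex_of_real (exp (- (x\<^sup>2 / 2))) * iexp (t * x) =
      complex_of_real (sqrt (2 * pi)) * (std_normal_density x *\<^sub>R iexp (t * x))" for x
    by (simp add: std_normal_density_def scaleR_conv_of_real)
  have "integrable std_normal_distribution (\<lambda>x. iexp (t * x))"
    by (intro finite_measure.integrable_const_bound[where B = 1])
       (auto intro!: prob_space.finite_measure prob_space_normal_density)
  then have i: "integrable lborel (\<lambda>x. std_normal_density x *\<^sub>R iexp (t * x))"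
    by (subst (asm) integrable_density) auto
  then show "integrable lborel (\<lambda>x::real. complex_of_real (exp (- (x\<^sup>2 / 2))) * iexp (t * x))"
    unfolding eq by (rule integrable_mult_right)
  have "(\<integral>x. std_normal_density x *\<^sub>R iexp (t * x) \<partial>lborel) = char std_normal_distribution t"
    unfolding char_def by (subst integral_density) auto
  also have "\<dots> = complex_of_real (exp (- (t\<^sup>2) / 2))"
    by (simp add: char_std_normal_distribution)
  finally show "(\<integral>x. complex_of_real (exp (- (x\<^sup>2 / 2))) * iexp (t * x) \<partial>lborel) =
    complex_of_real (sqrt (2 * pi) * exp (- (t\<^sup>2 / 2)))"
    unfolding eq integral_mult_right_zero by simp
qed

text \<open>Gaussian and exponential both factor over the coordinates, so \<open>lborel_eq\<close>,
  which presents Lebesgue measure as the image of a product measure, reduces the claim to dimension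
  one.\<close>

lemma integrable_gauss_iexp:
  fixes u :: "'a::euclidean_space"
  shows "integrable lborel (\<lambda>y. complex_of_real (exp (- ((norm y)\<^sup>2 / 2))) * iexp (u \<bullet> y))" (is ?I)
  and integral_gauss_iexp:
  "(\<integral>y. complex_of_real (exp (- ((norm y)\<^sup>2 / 2))) * iexp (u \<bullet> y) \<partial>lborel) =
    complex_of_real (sqrt (2 * pi) ^ DIM('a) * exp (- ((norm u)\<^sup>2 / 2)))" (is ?E)
proof -
  interpret product_sigma_finite "\<lambda>_::'a. lborel :: real measure" ..
  let ?h = "\<lambda>b x. complex_of_real (exp (- (x\<^sup>2 / 2))) * iexp ((u \<bullet> b) * x)"
  let ?T = "\<lambda>p. (\<Sum>b\<in>(Basis::'a set). p b *\<^sub>R b)"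
  have n: "(norm y)\<^sup>2 = (\<Sum>b\<in>Basis. (y \<bullet> b)\<^sup>2)" for y :: 'a
    unfolding power2_norm_eq_inner by (subst euclidean_inner) (simp add: power2_eq_square)
  have eq: "complex_of_real (exp (- ((norm y)\<^sup>2 / 2))) * iexp (u \<bullet> y) = (\<Prod>b\<in>Basis. ?h b (y \<bullet> b))" for y
    unfolding prod.distrib n
    by (simp add: exp_sum[symmetric] sum_divide_distrib sum_negf euclidean_inner[of u y]
        sum_distrib_left flip: of_real_prod)
  have T: "?T p \<bullet> b = p b" if "b \<in> Basis" for p b
    using that by simp
  have int: "integrable (\<Pi>\<^sub>M b\<in>Basis. lborel) (\<lambda>p. \<Prod>b\<in>Basis. ?h b (p b))"
    by (intro product_integrable_prod finite_Basis integrable_std_normal_iexp)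
  have m [measurable]: "(\<lambda>y. \<Prod>b\<in>Basis. ?h b (y \<bullet> b)) \<in> borel_measurable borel"
    by simp
  have "integrable (distr (\<Pi>\<^sub>M b\<in>Basis. lborel) borel ?T) (\<lambda>y. \<Prod>b\<in>Basis. ?h b (y \<bullet> b))"
    by (subst integrable_distr_eq) (use int in \<open>simp_all add: T cong: prod.cong\<close>)
  then show ?I unfolding eq lborel_eq[where 'a = 'a] .
  have "(\<integral>y. (\<Prod>b\<in>Basis. ?h b (y \<bullet> b)) \<partial>lborel) =
      (\<integral>p. (\<Prod>b\<in>Basis. ?h b (p b)) \<partial>(\<Pi>\<^sub>M b\<in>Basis. lborel))"
    unfolding lborel_eq[where 'a = 'a]
    by (subst integral_distr) (simp_all cong: prod.cong)
  also have "\<dots> = (\<Prod>b\<in>Basis. complex_of_real (sqrt (2 * pi) * exp (- ((u \<bullet> b)\<^sup>2 / 2))))"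
    by (subst product_integral_prod[OF finite_Basis integrable_std_normal_iexp])
       (simp only: integral_std_normal_iexp)
  also have "\<dots> = complex_of_real (sqrt (2 * pi) ^ DIM('a) * exp (- ((norm u)\<^sup>2 / 2)))"
    unfolding of_real_prod[symmetric] prod.distrib n
    by (simp add: exp_sum[symmetric] sum_divide_distrib sum_negf)
  finally show ?E unfolding eq .
qed

section \<open>Dilations and translations of Lebesgue measure\<close>

lemma integrable_lborel_scale:
  fixes f :: "'a::euclidean_space \<Rightarrow> 'b::{banach, second_countable_topology}"
  assumes "c > 0" and "integrable lborel f"
  shows "integrable lborel (\<lambda>x. f (c *\<^sub>R x))"
proof -
  have [measurable]: "f \<in> borel_measurable borel" using assms by auto
  have "integrable (density (distr lborel borel (\<lambda>x. c *\<^sub>R x)) (\<lambda>_. ennreal (\<bar>c\<bar> ^ DIM('a)))) f"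
    using lborel_affine[of c "0::'a"] assms by simp
  then have "integrable lborel (\<lambda>x. c ^ DIM('a) *\<^sub>R f (c *\<^sub>R x))"
    using assms by (simp add: integrable_density integrable_distr_eq)
  from integrable_scaleR_right[OF this, of "1 / c ^ DIM('a)"] show ?thesis
    using assms by simp
qed

lemma integral_lborel_scale:
  fixes f :: "'a::euclidean_space \<Rightarrow> 'b::{banach, second_countable_topology}"
  assumes "c > 0" and [measurable]: "f \<in> borel_measurable borel"
  shows "(\<integral>x. f x \<partial>lborel) = c ^ DIM('a) *\<^sub>R (\<integral>x. f (c *\<^sub>R x) \<partial>lborel)"
proof -
  have "(\<integral>x. f x \<partial>lborel) = (\<integral>x. f x \<partial>density (distr lborel borel (\<lambda>x. c *\<^sub>R x)) (\<lambda>_. ennreal (\<bar>c\<bar> ^ DIM('a))))"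
    using lborel_affine[of c "0::'a"] assms by simp
  also have "\<dots> = c ^ DIM('a) *\<^sub>R (\<integral>x. f (c *\<^sub>R x) \<partial>lborel)"
    using assms by (simp add: integral_density integral_distr)
  finally show ?thesis .
qed

lemma integral_lborel_shift:
  fixes f :: "'a::euclidean_space \<Rightarrow> 'b::{banach, second_countable_topology}"
  assumes [measurable]: "f \<in> borel_measurable borel"
  shows "(\<integral>x. f (x + u) \<partial>lborel) = (\<integral>x. f x \<partial>lborel)"
  using integral_distr[of "\<lambda>x. u + x" lborel borel f] by (simp add: lborel_distr_plus add.commute[of _ u])

lemma nn_integral_lborel_shift:
  fixes f :: "'a::euclidean_space \<Rightarrow> ennreal"
  assumes [measurable]: "f \<in> borel_measurable borel"
  shows "(\<integral>\<^sup>+x. f (x + u) \<partial>lborel) = (\<integral>\<^sup>+x. f x \<partial>lborel)"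
  using nn_integral_distr[of "\<lambda>x. u + x" lborel borel f] by (simp add: lborel_distr_plus add.commute[of _ u])

lemma integrable_lborel_shift:
  fixes f :: "'a::euclidean_space \<Rightarrow> 'b::{banach, second_countable_topology}"
  assumes "integrable lborel f"
  shows "integrable lborel (\<lambda>x. f (x + u))"
proof -
  have [measurable]: "f \<in> borel_measurable borel" using assms by auto
  show ?thesis
    using assms integrable_distr_eq[of "\<lambda>x. u + x" lborel borel f] by (simp add: lborel_distr_plus add.commute[of _ u])
qed

text \<open>To be used for \<open>s\<close> tending to 0: the Gaussian on the left flattens to 1
  while its transform concentrates at \<open>u = 0\<close>. The substitution
  \<open>s *\<^sub>R y\<close> moves the scale into the frequency.\<close>

lemma integrable_gauss_echar:
  fixes u :: "'a::euclidean_space"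
  assumes "s > 0"
  shows "integrable lborel (\<lambda>y. complex_of_real (exp (- ((norm (s *\<^sub>R y))\<^sup>2 / 2))) * echar (u \<bullet> y))" (is ?I)
  and integral_gauss_echar:
  "s ^ DIM('a) * (\<integral>y. complex_of_real (exp (- ((norm (s *\<^sub>R y))\<^sup>2 / 2))) * echar (u \<bullet> y) \<partial>lborel) =
    complex_of_real (sqrt (2 * pi) ^ DIM('a) * exp (- ((norm ((2 * pi / s) *\<^sub>R u))\<^sup>2 / 2)))" (is ?E)
proof -
  let ?f = "\<lambda>y. complex_of_real (exp (- ((norm y)\<^sup>2 / 2))) * iexp ((- (2 * pi / s) *\<^sub>R u) \<bullet> y)"
  have eq: "echar (u \<bullet> y) = iexp ((- (2 * pi / s) *\<^sub>R u) \<bullet> (s *\<^sub>R y))" for y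
    using assms by (simp add: echar_def mult_ac)
  show ?I
    unfolding eq by (rule integrable_lborel_scale[OF assms, of ?f]) (rule integrable_gauss_iexp)
  show ?E
    using integral_lborel_scale[OF assms, of ?f] integral_gauss_iexp[of "- (2 * pi / s) *\<^sub>R u"]
    unfolding eq by (simp add: scaleR_conv_of_real power_divide power_mult_distrib)
qed

section \<open>Continuity of translation in L^1\<close>

text \<open>Closure under L^1 limits. Translation is an isometry of L^1, so replacing
  \<open>g\<close> by \<open>h\<close> costs the same small error before and after the shift, whence
  the thirds of \<open>e\<close>.\<close>

lemma tendsto_L1_shift_approx:
  fixes g :: "'a::euclidean_space \<Rightarrow> 'b::{banach, second_countable_topology}"
  assumes g: "integrable lborel g"
    and approx: "\<And>e. e > 0 \<Longrightarrow> \<exists>h. integrable lborel h \<and> (\<integral>x. norm (g x - h x) \<partial>lborel) < e \<and>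
      (\<lambda>n. \<integral>x. norm (h (x + u n) - h x) \<partial>lborel) \<longlonglongrightarrow> 0"
  shows "(\<lambda>n. \<integral>x. norm (g (x + u n) - g x) \<partial>lborel) \<longlonglongrightarrow> 0"
proof (rule LIMSEQ_I)
  fix e :: real assume "e > 0"
  then obtain h where h: "integrable lborel h" and gh: "(\<integral>x. norm (g x - h x) \<partial>lborel) < e / 3"
    and lim: "(\<lambda>n. \<integral>x. norm (h (x + u n) - h x) \<partial>lborel) \<longlonglongrightarrow> 0"
    using approx[of "e / 3"] by auto
  from LIMSEQ_D[OF lim, of "e / 3"] \<open>e > 0\<close> obtain N where
    N: "\<And>n. n \<ge> N \<Longrightarrow> norm (\<integral>x. norm (h (x + u n) - h x) \<partial>lborel) < e / 3"
    by auto
  note sh = integrable_lborel_shift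
  have [measurable]: "g \<in> borel_measurable borel" "h \<in> borel_measurable borel" using g h by auto
  have "norm ((\<integral>x. norm (g (x + u n) - g x) \<partial>lborel) - 0) < e" if "n \<ge> N" for n
  proof -
    have i: "integrable lborel (\<lambda>x. norm (g (x + u n) - h (x + u n)))"
      and i2: "integrable lborel (\<lambda>x. norm (h (x + u n) - h x))"
      and i3: "integrable lborel (\<lambda>x. norm (g x - h x))"
      by (intro integrable_norm Bochner_Integration.integrable_diff sh g h)+
    have "(\<integral>x. norm (g (x + u n) - g x) \<partial>lborel) \<le>
       (\<integral>x. norm (g (x + u n) - h (x + u n)) + (norm (h (x + u n) - h x) + norm (g x - h x)) \<partial>lborel)"
    proof (rule integral_mono)
      show "norm (g (x + u n) - g x)
         \<le> norm (g (x + u n) - h (x + u n)) + (norm (h (x + u n) - h x) + norm (g x - h x))" for x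
        by (smt (verit) norm_diff_triangle_ineq norm_minus_commute norm_triangle_ineq4 diff_add_cancel norm_triangle_sub)
    qed (intro integrable_norm Bochner_Integration.integrable_add Bochner_Integration.integrable_diff sh g h)+
    also have "\<dots> = (\<integral>x. norm (g (x + u n) - h (x + u n)) \<partial>lborel) +
        ((\<integral>x. norm (h (x + u n) - h x) \<partial>lborel) + (\<integral>x. norm (g x - h x) \<partial>lborel))"
      using i2 i3 i by simp
    also have "(\<integral>x. norm (g (x + u n) - h (x + u n)) \<partial>lborel) = (\<integral>x. norm (g x - h x) \<partial>lborel)"
      by (rule integral_lborel_shift) measurable
    finally have "(\<integral>x. norm (g (x + u n) - g x) \<partial>lborel) < e"
      using gh N[OF that] by simp
    moreover have "(\<integral>x. norm (g (x + u n) - g x) \<partial>lborel) \<ge> 0" by simp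
    ultimately show ?thesis by simp
  qed
  then show "\<exists>N. \<forall>n\<ge>N. norm ((\<integral>x. norm (g (x + u n) - g x) \<partial>lborel) - 0) < e" by blast
qed

text \<open>Openness makes the shifted indicator eventually 1 at each point of \<open>U\<close>, so
  the overlaps of \<open>U\<close> with its translates converge to the full measure, and the
  symmetric difference has twice the measure of \<open>U\<close> minus twice the overlap. Points
  outside \<open>U\<close> need no argument, since the product of indicators is 0 there.\<close>

lemma tendsto_L1_shift_open:
  fixes U :: "'a::euclidean_space set" and c :: "'b::{banach, second_countable_topology}"
  assumes u: "u \<longlonglongrightarrow> 0" and U: "open U" "emeasure lborel U < \<infinity>"
  shows "(\<lambda>n. \<integral>x. norm (indicator U (x + u n) *\<^sub>R c - indicator U x *\<^sub>R c) \<partial>lborel) \<longlonglongrightarrow> 0"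
proof -
  have [measurable]: "U \<in> sets borel" using U by simp
  let ?i = "indicator U :: 'a \<Rightarrow> real"
  have int: "integrable lborel ?i" using U by simp
  have int2: "integrable lborel (\<lambda>x. ?i x * ?i (x + v))" for v
    by (rule Bochner_Integration.integrable_bound[OF int]) (auto simp: indicator_def)
  have "(\<lambda>n. \<integral>x. ?i x * ?i (x + u n) \<partial>lborel) \<longlonglongrightarrow> (\<integral>x. ?i x \<partial>lborel)"
  proof (rule integral_dominated_convergence[where w = ?i])
    show "AE x in lborel. (\<lambda>n. ?i x * ?i (x + u n)) \<longlonglongrightarrow> ?i x"
    proof (rule AE_I2)
      fix x :: 'a
      show "(\<lambda>n. ?i x * ?i (x + u n)) \<longlonglongrightarrow> ?i x"
      proof (cases "x \<in> U")
        case True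
        have "(\<lambda>n. x + u n) \<longlonglongrightarrow> x + 0" by (intro tendsto_intros u)
        then have "\<forall>\<^sub>F n in sequentially. x + u n \<in> U"
          using True U by (auto simp: topological_tendstoD)
        then have "\<forall>\<^sub>F n in sequentially. ?i x * ?i (x + u n) = ?i x"
          by eventually_elim (use True in auto)
        then show ?thesis by (rule tendsto_eventually)
      qed auto
    qed
  qed (use int in \<open>auto simp: indicator_def\<close>)
  then have "(\<lambda>n. norm c * (2 * (\<integral>x. ?i x \<partial>lborel) - 2 * (\<integral>x. ?i x * ?i (x + u n) \<partial>lborel))) \<longlonglongrightarrow>
      norm c * (2 * (\<integral>x. ?i x \<partial>lborel) - 2 * (\<integral>x. ?i x \<partial>lborel))"
    by (intro tendsto_intros)
  also have "(\<lambda>n. norm c * (2 * (\<integral>x. ?i x \<partial>lborel) - 2 * (\<integral>x. ?i x * ?i (x + u n) \<partial>lborel))) =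
     (\<lambda>n. \<integral>x. norm (?i (x + u n) *\<^sub>R c - ?i x *\<^sub>R c) \<partial>lborel)"
  proof
    fix n
    have "(\<integral>x. norm (?i (x + u n) *\<^sub>R c - ?i x *\<^sub>R c) \<partial>lborel) =
       (\<integral>x. norm c * (?i (x + u n) + ?i x - 2 * (?i x * ?i (x + u n))) \<partial>lborel)"
      by (intro Bochner_Integration.integral_cong) (auto simp: indicator_def)
    also have "\<dots> = norm c * ((\<integral>x. ?i (x + u n) \<partial>lborel) + (\<integral>x. ?i x \<partial>lborel)
        - 2 * (\<integral>x. ?i x * ?i (x + u n) \<partial>lborel))"
      using int int2 integrable_lborel_shift[OF int, of "u n"] by simp
    also have "(\<integral>x. ?i (x + u n) \<partial>lborel) = (\<integral>x. ?i x \<partial>lborel)"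
      by (rule integral_lborel_shift) simp
    finally show "norm c * (2 * (\<integral>x. ?i x \<partial>lborel) - 2 * (\<integral>x. ?i x * ?i (x + u n) \<partial>lborel)) =
      (\<integral>x. norm (?i (x + u n) *\<^sub>R c - ?i x *\<^sub>R c) \<partial>lborel)" by simp
  qed
  finally show ?thesis by simp
qed

text \<open>Outer regularity trades a measurable set for an open one, where the convergence is
  known; additivity and closure under L^1 limits give the rest.\<close>

lemma tendsto_L1_shift:
  fixes g :: "'a::euclidean_space \<Rightarrow> 'b::{banach, second_countable_topology}"
  assumes u: "u \<longlonglongrightarrow> 0" and g: "integrable lborel g"
  shows "(\<lambda>n. \<integral>x. norm (g (x + u n) - g x) \<partial>lborel) \<longlonglongrightarrow> 0"
  using g
proof (induction rule: integrable_induct)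
  case (base A c)
  then have [measurable]: "A \<in> sets borel" by simp
  show ?case
  proof (rule tendsto_L1_shift_approx)
    show "integrable lborel (\<lambda>x. indicator A x *\<^sub>R c)"
      using base by (intro integrable_scaleR_left) simp
    fix e :: real assume "e > 0"
    \<comment> \<open>The summand 1 covers \<open>c = 0\<close> and makes
      \<open>d * norm c < e\<close> strict.\<close>
    define d where "d = e / (norm c + 1)"
    have "d > 0" using \<open>e > 0\<close> by (simp add: d_def add_nonneg_pos)
    obtain U where U: "open U" "A \<subseteq> U" "emeasure lborel (U - A) < ennreal d"
      using outer_regular_lborel[of A d] \<open>d > 0\<close> by auto
    have [measurable]: "U \<in> sets borel" using U by simp
    have "U = A \<union> (U - A)" using U by auto
    then have "emeasure lborel U \<le> emeasure lborel A + emeasure lborel (U - A)"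
      by (metis \<open>A \<in> sets borel\<close> \<open>U \<in> sets borel\<close> emeasure_subadditive sets.Diff sets_lborel)
    also have "\<dots> < \<infinity>" using base U by (simp add: less_top[symmetric]) (metis ennreal_less_top less_trans order_less_irrefl top.not_eq_extremum)
    finally have fin: "emeasure lborel U < \<infinity>" .
    have "integrable lborel (\<lambda>x. indicator U x *\<^sub>R c)"
      using fin by (intro integrable_scaleR_left) simp
    moreover have "(\<integral>x. norm (indicator A x *\<^sub>R c - indicator U x *\<^sub>R c) \<partial>lborel) < e"
    proof -
      have "(\<integral>x. norm (indicator A x *\<^sub>R c - indicator U x *\<^sub>R c) \<partial>lborel) =
         (\<integral>x. indicator (U - A) x * norm c \<partial>lborel)"
        using U by (intro Bochner_Integration.integral_cong) (auto simp: indicator_def)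
      also have "\<dots> = measure lborel (U - A) * norm c" by simp
      also have "\<dots> \<le> d * norm c"
        using U \<open>d > 0\<close> by (intro mult_right_mono) (auto simp: measure_def enn2real_leI less_imp_le)
      also have "\<dots> < d * (norm c + 1)" using \<open>d > 0\<close> by simp
      also have "\<dots> = e" unfolding d_def by (simp add: add_nonneg_eq_0_iff)
      finally show ?thesis .
    qed
    ultimately show "\<exists>h. integrable lborel h \<and> (\<integral>x. norm (indicator A x *\<^sub>R c - h x) \<partial>lborel) < e \<and>
      (\<lambda>n. \<integral>x. norm (h (x + u n) - h x) \<partial>lborel) \<longlonglongrightarrow> 0"
      using tendsto_L1_shift_open[OF u U(1) fin, of c] by blast
  qed
next
  case (add f g)
  note sh = integrable_lborel_shift
  have "(\<lambda>n. (\<integral>x. norm (f (x + u n) - f x) \<partial>lborel) + (\<integral>x. norm (g (x + u n) - g x) \<partial>lborel)) \<longlonglongrightarrow> 0 + 0"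
    by (intro tendsto_intros add.IH)
  then have lim: "(\<lambda>n. (\<integral>x. norm (f (x + u n) - f x) \<partial>lborel) + (\<integral>x. norm (g (x + u n) - g x) \<partial>lborel)) \<longlonglongrightarrow> 0"
    by simp
  have i: "integrable lborel (\<lambda>x. norm (f (x + v) - f x))" "integrable lborel (\<lambda>x. norm (g (x + v) - g x))" for v
    by (intro integrable_norm Bochner_Integration.integrable_diff sh add.hyps)+
  have "(\<integral>x. norm ((f (x + v) + g (x + v)) - (f x + g x)) \<partial>lborel) \<le>
     (\<integral>x. norm (f (x + v) - f x) + norm (g (x + v) - g x) \<partial>lborel)" for v
    by (intro integral_mono Bochner_Integration.integrable_add i integrable_norm Bochner_Integration.integrable_diff sh add.hyps norm_diff_triangle_ineq)
  then have le: "(\<integral>x. norm ((f (x + v) + g (x + v)) - (f x + g x)) \<partial>lborel) \<le>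
     (\<integral>x. norm (f (x + v) - f x) \<partial>lborel) + (\<integral>x. norm (g (x + v) - g x) \<partial>lborel)" for v
    using i by simp
  show ?case
    by (rule tendsto_sandwich[OF _ _ tendsto_const lim]) (auto simp: le)
next
  case (lim f s)
  show ?case
  proof (rule tendsto_L1_shift_approx)
    have [measurable]: "f \<in> borel_measurable borel" using lim by auto
    have [measurable]: "s i \<in> borel_measurable borel" for i using lim(1)[of i] by auto
    fix e :: real assume "e > 0"
    have "(\<lambda>i. \<integral>x. norm (f x - s i x) \<partial>lborel) \<longlonglongrightarrow> (\<integral>x. 0 \<partial>(lborel :: 'a measure))"
    \<comment> \<open>The induction rule bounds the approximants by \<open>2 * norm (f x)\<close>;
      together with \<open>f\<close> itself this gives the factor 3.\<close>
    proof (rule integral_dominated_convergence[where w = "\<lambda>x. 3 * norm (f x)"])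
      show "AE x in lborel. (\<lambda>i. norm (f x - s i x)) \<longlonglongrightarrow> 0"
      proof (rule AE_I2)
        fix x
        have "(\<lambda>i. f x - s i x) \<longlonglongrightarrow> f x - f x" by (intro tendsto_intros lim(2)) simp
        then show "(\<lambda>i. norm (f x - s i x)) \<longlonglongrightarrow> 0" by (intro tendsto_norm_zero) simp
      qed
      show "AE x in lborel. norm (norm (f x - s i x)) \<le> 3 * norm (f x)" for i
        using lim(3)[of _ i] by (auto intro!: order.trans[OF norm_triangle_ineq4])
    qed (use lim in auto)
    then have "(\<lambda>i. \<integral>x. norm (f x - s i x) \<partial>lborel) \<longlonglongrightarrow> 0" by simp
    from LIMSEQ_D[OF this \<open>e > 0\<close>] obtain i where "(\<integral>x. norm (f x - s i x) \<partial>lborel) < e"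
      by auto
    then show "\<exists>h. integrable lborel h \<and> (\<integral>x. norm (f x - h x) \<partial>lborel) < e \<and>
      (\<lambda>n. \<integral>x. norm (h (x + u n) - h x) \<partial>lborel) \<longlonglongrightarrow> 0"
      using lim(1) lim.IH by blast
  qed (use lim in auto)
qed

section \<open>Autocorrelation and Plancherel for integrable, square integrable functions\<close>

definition fourier_R :: "('a::euclidean_space \<Rightarrow> complex) \<Rightarrow> 'a \<Rightarrow> complex" where
  "fourier_R g y = (\<integral>x. g x * echar (x \<bullet> y) \<partial>lborel)"

text \<open>The convolution of \<open>g\<close> with its reflected conjugate. Its value at 0 is the
  squared norm of \<open>g\<close> and its transform is the squared modulus of the transform, so
  Plancherel becomes Fourier inversion at the single point 0.\<close>

definition autocorr :: "('a::euclidean_space \<Rightarrow> complex) \<Rightarrow> 'a \<Rightarrow> complex" where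
  "autocorr g u = (\<integral>x. g (x + u) * cnj (g x) \<partial>lborel)"

lemma borel_measurable_cnj' [measurable]: "cnj \<in> borel_measurable borel"
  by (intro borel_measurable_continuous_onI continuous_intros)

lemma echar_mult_cnj [simp]: "echar t * cnj (echar t) = 1"
  by (simp add: echar_cis cis_cnj cis_mult)

lemma integrable_mult_echar [simp]:
  assumes "integrable M g" "h \<in> borel_measurable M"
  shows "integrable M (\<lambda>x. g x * echar (h x))"
  using assms by (intro Bochner_Integration.integrable_bound[OF assms(1)]) (auto simp: norm_mult)

lemma norm_fourier_R_le:
  "cmod (fourier_R g y) \<le> (\<integral>x. cmod (g x) \<partial>lborel)"
  unfolding fourier_R_def by (rule order.trans[OF integral_norm_bound]) (simp add: norm_mult)

lemma borel_measurable_fourier_R [measurable]: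
  assumes [measurable]: "g \<in> borel_measurable borel"
  shows "fourier_R g \<in> borel_measurable borel"
  unfolding fourier_R_def by measurable

context
  fixes g :: "'a::euclidean_space \<Rightarrow> complex"
  assumes g: "integrable lborel g"
begin

lemma meas_g [measurable]: "g \<in> borel_measurable borel"
  using g by auto

lemma integrable_autocorr_kernel:
  "integrable (lborel \<Otimes>\<^sub>M lborel) (\<lambda>(x, u). g (x + u) * cnj (g x))"
proof (rule lborel_pair.Fubini_integrable)
  have sh: "integrable lborel (\<lambda>u. g (x + u))" for x
    using integrable_lborel_shift[OF g, of x] by (simp add: add.commute)
  show "AE x in lborel. integrable lborel (\<lambda>u. case (x, u) of (x, u) \<Rightarrow> g (x + u) * cnj (g x))"
    by (simp add: sh)
  have "(\<integral>u. norm (g (x + u) * cnj (g x)) \<partial>lborel) = (\<integral>u. norm (g u) \<partial>lborel) * norm (g x)" for x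
    using integral_lborel_shift[of "\<lambda>u. norm (g u)" x] by (simp add: norm_mult add.commute)
  then show "integrable lborel (\<lambda>x. \<integral>u. norm (case (x, u) of (x, u) \<Rightarrow> g (x + u) * cnj (g x)) \<partial>lborel)"
    using g by simp
qed measurable

lemma integrable_autocorr: "integrable lborel (autocorr g)"
  using lborel_pair.integrable_snd[OF integrable_autocorr_kernel]
  by (simp add: autocorr_def[abs_def])

text \<open>Once \<open>u + x\<close> is taken as the new variable, the character splits into one
  factor for each copy of \<open>g\<close>, and the double integral becomes a product.\<close>

lemma fourier_R_autocorr: "fourier_R (autocorr g) y = fourier_R g y * cnj (fourier_R g y)"
proof -
  let ?F = "\<lambda>x u. g (x + u) * cnj (g x) * echar (u \<bullet> y)"
  have int: "integrable (lborel \<Otimes>\<^sub>M lborel) (case_prod ?F)"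
    using integrable_mult_echar[OF integrable_autocorr_kernel, of "\<lambda>(x, u). u \<bullet> y"]
    by (simp add: case_prod_beta')
  have "fourier_R (autocorr g) y = (\<integral>u. (\<integral>x. ?F x u \<partial>lborel) \<partial>lborel)"
    by (simp add: fourier_R_def autocorr_def)
  also have "\<dots> = (\<integral>x. (\<integral>u. ?F x u \<partial>lborel) \<partial>lborel)"
    by (rule lborel_pair.Fubini_integral[OF int])
  also have "\<dots> = (\<integral>x. fourier_R g y * cnj (g x * echar (x \<bullet> y)) \<partial>lborel)"
  proof (rule Bochner_Integration.integral_cong[OF refl])
    fix x
    have Feq: "?F x u = g (u + x) * echar ((u + x) \<bullet> y) * cnj (g x * echar (x \<bullet> y))" for u
    proof -
      have "g (u + x) * echar ((u + x) \<bullet> y) * cnj (g x * echar (x \<bullet> y)) =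
        g (x + u) * cnj (g x) * echar (u \<bullet> y) * (echar (x \<bullet> y) * cnj (echar (x \<bullet> y)))"
        by (simp only: inner_add_left echar_add complex_cnj_mult mult_ac add.commute[of u x])
      then show ?thesis by (simp del: complex_cnj_mult)
    qed
    have "(\<integral>u. ?F x u \<partial>lborel) = (\<integral>u. g (u + x) * echar ((u + x) \<bullet> y) \<partial>lborel) * cnj (g x * echar (x \<bullet> y))"
      by (simp only: Feq integral_mult_left_zero)
    also have "(\<integral>u. g (u + x) * echar ((u + x) \<bullet> y) \<partial>lborel) = fourier_R g y"
      unfolding fourier_R_def by (rule integral_lborel_shift) measurable
    finally show "(\<integral>u. ?F x u \<partial>lborel) = fourier_R g y * cnj (g x * echar (x \<bullet> y))" .
  qed
  also have "\<dots> = fourier_R g y * cnj (fourier_R g y)"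
    unfolding integral_mult_right_zero Bochner_Integration.integral_cnj fourier_R_def ..
  finally show ?thesis .
qed

text \<open>Integrability of the squared transform is not yet known, so it is tested against a
  Gaussian, which makes Fubini applicable. On the right, all dependence on \<open>s\<close> sits in
  the argument of \<open>autocorr\<close>, against a fixed Gaussian, ready for \<open>s\<close>
  tending to 0.\<close>

lemma integral_fourier_R_sq_gauss:
  assumes "s > 0"
  shows "(\<integral>y. exp (- ((norm (s *\<^sub>R y))\<^sup>2 / 2)) * (cmod (fourier_R g y))\<^sup>2 \<partial>lborel) =
    complex_of_real ((sqrt (2 * pi) / (2 * pi)) ^ DIM('a)) *
      (\<integral>v. exp (- ((norm v)\<^sup>2 / 2)) * autocorr g ((s / (2 * pi)) *\<^sub>R v) \<partial>lborel)"
proof -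
  let ?w = "\<lambda>y::'a. complex_of_real (exp (- ((norm (s *\<^sub>R y))\<^sup>2 / 2)))"
  let ?C = "autocorr g"
  let ?F = "\<lambda>u y. ?C u * (?w y * echar (u \<bullet> y))"
  have C: "integrable lborel ?C" by (rule integrable_autocorr)
  have w: "integrable lborel ?w"
    using integrable_gauss_echar[OF assms, of "0::'a"] by simp
  have [measurable]: "?C \<in> borel_measurable borel" using C by auto
  have int: "integrable (lborel \<Otimes>\<^sub>M lborel) (case_prod ?F)"
  proof (rule lborel_pair.Fubini_integrable)
    show "AE u in lborel. integrable lborel (\<lambda>y. case (u, y) of (u, y) \<Rightarrow> ?F u y)"
      unfolding split by (intro AE_I2 integrable_mult_right integrable_gauss_echar assms)
    have "(\<integral>y. norm (?F u y) \<partial>lborel) = norm (?C u) * (\<integral>y. norm (?w y) \<partial>lborel)" for u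
      by (simp add: norm_mult)
    then show "integrable lborel (\<lambda>u. \<integral>y. norm (case (u, y) of (u, y) \<Rightarrow> ?F u y) \<partial>lborel)"
      using C by simp
  qed measurable
  have "complex_of_real (\<integral>y. exp (- ((norm (s *\<^sub>R y))\<^sup>2 / 2)) * (cmod (fourier_R g y))\<^sup>2 \<partial>lborel) =
    (\<integral>y. ?w y * fourier_R ?C y \<partial>lborel)"
    by (simp add: fourier_R_autocorr del: integral_complex_of_real flip: integral_complex_of_real complex_norm_square)
  also have "\<dots> = (\<integral>y. (\<integral>u. ?F u y \<partial>lborel) \<partial>lborel)"
    unfolding fourier_R_def
    by (intro Bochner_Integration.integral_cong refl, subst integral_mult_right_zero[symmetric])
       (simp only: mult_ac)
  also have "\<dots> = (\<integral>u. (\<integral>y. ?F u y \<partial>lborel) \<partial>lborel)"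
    by (rule lborel_pair.Fubini_integral[OF int])
  also have "\<dots> = (\<integral>u. ?C u * (\<integral>y. ?w y * echar (u \<bullet> y) \<partial>lborel) \<partial>lborel)"
    by simp
  \<comment> \<open>The dilation by \<open>s / (2 * pi)\<close> undoes the frequency scale
    \<open>2 * pi / s\<close> of \<open>integral_gauss_echar\<close>.\<close>
  also have "\<dots> = (s / (2 * pi)) ^ DIM('a) *\<^sub>R (\<integral>v. ?C ((s / (2 * pi)) *\<^sub>R v) *
      (\<integral>y. ?w y * echar (((s / (2 * pi)) *\<^sub>R v) \<bullet> y) \<partial>lborel) \<partial>lborel)"
    by (rule integral_lborel_scale) (use assms in auto)
  also have "\<dots> = (s / (2 * pi)) ^ DIM('a) *\<^sub>R (\<integral>v. ?C ((s / (2 * pi)) *\<^sub>R v) *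
      (complex_of_real (sqrt (2 * pi) ^ DIM('a) * exp (- ((norm v)\<^sup>2 / 2))) / s ^ DIM('a)) \<partial>lborel)"
  proof -
    have "(\<integral>y. ?w y * echar (((s / (2 * pi)) *\<^sub>R v) \<bullet> y) \<partial>lborel) =
      complex_of_real (sqrt (2 * pi) ^ DIM('a) * exp (- ((norm v)\<^sup>2 / 2))) / s ^ DIM('a)" for v :: 'a
      using integral_gauss_echar[OF assms, of "(s / (2 * pi)) *\<^sub>R v"] assms
      by (simp add: field_simps)
    then show ?thesis by (simp only:)
  qed
  also have "\<dots> = (s / (2 * pi)) ^ DIM('a) *\<^sub>R (\<integral>v. complex_of_real (sqrt (2 * pi) ^ DIM('a) / s ^ DIM('a)) *
      (complex_of_real (exp (- ((norm v)\<^sup>2 / 2))) * ?C ((s / (2 * pi)) *\<^sub>R v)) \<partial>lborel)"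
    by (simp add: mult_ac)
  also have "\<dots> = complex_of_real ((s / (2 * pi)) ^ DIM('a) * (sqrt (2 * pi) ^ DIM('a) / s ^ DIM('a))) *
      (\<integral>v. complex_of_real (exp (- ((norm v)\<^sup>2 / 2))) * ?C ((s / (2 * pi)) *\<^sub>R v) \<partial>lborel)"
    by (simp only: integral_mult_right_zero scaleR_conv_of_real of_real_mult mult.assoc)
  also have "(s / (2 * pi)) ^ DIM('a) * (sqrt (2 * pi) ^ DIM('a) / s ^ DIM('a)) = (sqrt (2 * pi) / (2 * pi)) ^ DIM('a)"
    using assms by (simp add: power_divide)
  finally show ?thesis by simp
qed

context
  assumes g2: "integrable lborel (\<lambda>x. (cmod (g x))\<^sup>2)"
begin

lemma integrable_autocorr_integrand: "integrable lborel (\<lambda>x. g (x + u) * cnj (g x))" (is ?I)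
  and norm_autocorr_le: "cmod (autocorr g u) \<le> (\<integral>x. (cmod (g x))\<^sup>2 \<partial>lborel)" (is ?B)
proof -
  have le: "cmod (g (x + u) * cnj (g x)) \<le> ((cmod (g (x + u)))\<^sup>2 + (cmod (g x))\<^sup>2) / 2" for x
    using sum_squares_bound[of "cmod (g (x + u))" "cmod (g x)"] by (simp add: norm_mult)
  have i: "integrable lborel (\<lambda>x. ((cmod (g (x + u)))\<^sup>2 + (cmod (g x))\<^sup>2) / 2)"
    using g2 integrable_lborel_shift[OF g2, of u] by simp
  show I: ?I
    by (rule Bochner_Integration.integrable_bound[OF i]) (use le in \<open>auto simp: order.trans[OF le]\<close>)
  have "cmod (autocorr g u) \<le> (\<integral>x. cmod (g (x + u) * cnj (g x)) \<partial>lborel)"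
    unfolding autocorr_def by (rule integral_norm_bound)
  also have "\<dots> \<le> (\<integral>x. ((cmod (g (x + u)))\<^sup>2 + (cmod (g x))\<^sup>2) / 2 \<partial>lborel)"
    by (intro integral_mono integrable_norm I i le)
  also have "\<dots> = (\<integral>x. (cmod (g x))\<^sup>2 \<partial>lborel)"
    using g2 integrable_lborel_shift[OF g2, of u] integral_lborel_shift[of "\<lambda>x. (cmod (g x))\<^sup>2" u]
    by simp
  finally show ?B .
qed

lemma autocorr_0: "autocorr g 0 = complex_of_real (\<integral>x. (cmod (g x))\<^sup>2 \<partial>lborel)"
  unfolding autocorr_def by (simp add: del: integral_complex_of_real flip: integral_complex_of_real complex_norm_square)

text \<open>\<open>g\<close> need not be bounded, so L^1 continuity of translation cannot be paired
  with it directly. It is cut at height \<open>K\<close>: the part below pays \<open>K\<close> times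
  the L^1 modulus of continuity, the part above pays its small square mass, the integral of
  \<open>r K\<close>, through AM-GM with parameter \<open>\<delta>\<close>.\<close>

lemma tendsto_autocorr:
  assumes u: "u \<longlonglongrightarrow> 0"
  shows "(\<lambda>n. autocorr g (u n)) \<longlonglongrightarrow> autocorr g 0"
proof (rule LIMSEQ_I)
  fix e :: real assume "e > 0"
  define S where "S = (\<integral>x. (cmod (g x))\<^sup>2 \<partial>lborel)"
  have "S \<ge> 0" by (simp add: S_def)
  \<comment> \<open>Makes \<open>\<delta> * (S + S)\<close> at most \<open>e / 4\<close>; the
    summand 1 covers \<open>S = 0\<close>.\<close>
  define \<delta> where "\<delta> = e / (8 * (S + 1))"
  have "\<delta> > 0" using \<open>e > 0\<close> \<open>S \<ge> 0\<close> by (simp add: \<delta>_def)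
  define r where "r = (\<lambda>(K::nat) x. if cmod (g x) \<le> real K then 0 else (cmod (g x))\<^sup>2)"
  have [measurable]: "r K \<in> borel_measurable borel" for K unfolding r_def by measurable
  have ri: "integrable lborel (r K)" for K
    by (rule Bochner_Integration.integrable_bound[OF g2]) (auto simp: r_def)
  have "(\<lambda>K. \<integral>x. r K x \<partial>lborel) \<longlonglongrightarrow> (\<integral>x. 0 \<partial>(lborel :: 'a measure))"
  proof (rule integral_dominated_convergence[OF _ _ g2])
    show "AE x in lborel. (\<lambda>K. r K x) \<longlonglongrightarrow> 0"
    proof (rule AE_I2)
      fix x
      obtain K0 where "cmod (g x) \<le> real K0" using real_arch_simple by blast
      then have "\<forall>\<^sub>F K in sequentially. r K x = 0"
        unfolding eventually_sequentially r_def by (intro exI[of _ K0]) auto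
      then show "(\<lambda>K. r K x) \<longlonglongrightarrow> 0" by (rule tendsto_eventually)
    qed
  qed (auto simp: r_def)
  then have "(\<lambda>K. \<integral>x. r K x \<partial>lborel) \<longlonglongrightarrow> 0" by simp
  \<comment> \<open>The height \<open>K\<close> is fixed after \<open>\<delta>\<close>, because the
    tail is going to be divided by \<open>2 * \<delta>\<close>; this leaves
    \<open>e / 4\<close>.\<close>
  from LIMSEQ_D[OF this, of "\<delta> * e / 2"] \<open>\<delta> > 0\<close> \<open>e > 0\<close> obtain K
    where K: "norm (\<integral>x. r K x \<partial>lborel) < \<delta> * e / 2"
    by auto
  have "e / (4 * (real K + 1)) > 0" using \<open>e > 0\<close> by simp
  from LIMSEQ_D[OF tendsto_L1_shift[OF u g] this] obtain N where
    N: "\<And>n. n \<ge> N \<Longrightarrow> norm (\<integral>x. norm (g (x + u n) - g x) \<partial>lborel) < e / (4 * (real K + 1))" by auto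
  have "norm (autocorr g (u n) - autocorr g 0) < e" if "n \<ge> N" for n
  proof -
    let ?v = "u n"
    let ?b = "\<lambda>x. real K * cmod (g (x + ?v) - g x) + (\<delta> * ((cmod (g (x + ?v)))\<^sup>2 + (cmod (g x))\<^sup>2) + r K x / (2 * \<delta>))"
    have i1: "integrable lborel (\<lambda>x. cmod (g (x + ?v) - g x))"
      by (intro integrable_norm Bochner_Integration.integrable_diff integrable_lborel_shift g)
    have i2: "integrable lborel (\<lambda>x. (cmod (g (x + ?v)))\<^sup>2)"
      by (rule integrable_lborel_shift[OF g2])
    have le: "cmod (g (x + ?v) * cnj (g x) - g (x + 0) * cnj (g x)) \<le> ?b x" for x
    proof -
      let ?d = "cmod (g (x + ?v) - g x)" let ?a = "cmod (g (x + ?v))" let ?c = "cmod (g x)"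
      have "cmod (g (x + ?v) * cnj (g x) - g (x + 0) * cnj (g x)) = ?d * ?c"
        by (simp add: norm_mult flip: left_diff_distrib)
      also have "\<dots> \<le> ?d * (real K + sqrt (r K x))"
        by (intro mult_left_mono) (auto simp: r_def)
      finally have "cmod (g (x + ?v) * cnj (g x) - g (x + 0) * cnj (g x)) \<le> real K * ?d + ?d * sqrt (r K x)"
        by (simp add: algebra_simps)
      moreover have "?d * sqrt (r K x) \<le> (\<delta> / 2) * ?d\<^sup>2 + r K x / (2 * \<delta>)"
      proof -
        have "0 \<le> (\<delta> * ?d - sqrt (r K x))\<^sup>2 / (2 * \<delta>)" using \<open>\<delta> > 0\<close> by simp
        also have "\<dots> = (\<delta> / 2) * ?d\<^sup>2 + r K x / (2 * \<delta>) - ?d * sqrt (r K x)"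
          using \<open>\<delta> > 0\<close> by (simp add: power2_diff field_simps) (auto simp: r_def power2_eq_square)
        finally show ?thesis by simp
      qed
      moreover have "?d\<^sup>2 \<le> 2 * (?a\<^sup>2 + ?c\<^sup>2)"
      proof -
        have "?d\<^sup>2 \<le> (?a + ?c)\<^sup>2" by (intro power_mono norm_triangle_ineq4) simp
        also have "\<dots> \<le> 2 * (?a\<^sup>2 + ?c\<^sup>2)" using sum_squares_bound[of ?a ?c] by (simp add: power2_sum)
        finally show ?thesis .
      qed
      then have "(\<delta> / 2) * ?d\<^sup>2 \<le> (\<delta> / 2) * (2 * (?a\<^sup>2 + ?c\<^sup>2))"
        using \<open>\<delta> > 0\<close> by (intro mult_left_mono) auto
      then have "(\<delta> / 2) * ?d\<^sup>2 \<le> \<delta> * (?a\<^sup>2 + ?c\<^sup>2)" by (simp add: algebra_simps)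
      ultimately show ?thesis by linarith
    qed
    have "autocorr g ?v - autocorr g 0 = (\<integral>x. g (x + ?v) * cnj (g x) - g (x + 0) * cnj (g x) \<partial>lborel)"
      unfolding autocorr_def
      by (rule Bochner_Integration.integral_diff[symmetric]) (rule integrable_autocorr_integrand)+
    then have "norm (autocorr g ?v - autocorr g 0) \<le> (\<integral>x. ?b x \<partial>lborel)"
      by (simp only:, intro order.trans[OF integral_norm_bound] integral_mono le integrable_norm
          Bochner_Integration.integrable_diff integrable_autocorr_integrand)
         (use i1 i2 g2 ri in simp)
    also have "\<dots> = real K * (\<integral>x. cmod (g (x + ?v) - g x) \<partial>lborel) + (\<delta> * (S + S) + (\<integral>x. r K x \<partial>lborel) / (2 * \<delta>))"
      using i1 i2 g2 ri integral_lborel_shift[of "\<lambda>x. (cmod (g x))\<^sup>2" ?v] by (simp add: S_def)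
    also have "\<dots> < e"
    proof -
      have "real K * (\<integral>x. cmod (g (x + ?v) - g x) \<partial>lborel) \<le> real K * (e / (4 * (real K + 1)))"
        using N[OF that] by (intro mult_left_mono) auto
      also have "\<dots> \<le> e / 4" using \<open>e > 0\<close> by (simp add: field_simps)
      finally have 1: "real K * (\<integral>x. cmod (g (x + ?v) - g x) \<partial>lborel) \<le> e / 4" .
      have 2: "\<delta> * (S + S) \<le> e / 4"
        using \<open>S \<ge> 0\<close> \<open>e > 0\<close> by (simp add: \<delta>_def field_simps)
      have "(\<integral>x. r K x \<partial>lborel) / (2 * \<delta>) \<le> (\<delta> * e / 2) / (2 * \<delta>)"
        using K \<open>\<delta> > 0\<close> by (intro divide_right_mono) auto
      also have "\<dots> = e / 4" using \<open>\<delta> > 0\<close> by simp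
      finally show ?thesis using 1 2 \<open>e > 0\<close> by linarith
    qed
    finally show ?thesis .
  qed
  then show "\<exists>N. \<forall>n\<ge>N. norm (autocorr g (u n) - autocorr g 0) < e" by blast
qed

text \<open>Both sides are compared with the limit of the Gaussian-weighted integrals
  \<open>L m\<close>, which is \<open>S\<close> by continuity of \<open>autocorr g\<close> at 0.
  Fatou's lemma bounds the integral of the squared transform from above without presupposing its
  finiteness; for the converse it suffices that the weights are at most 1.\<close>

theorem plancherel_R:
  "(\<integral>\<^sup>+y. ennreal ((cmod (fourier_R g y))\<^sup>2) \<partial>lborel) = (\<integral>\<^sup>+x. ennreal ((cmod (g x))\<^sup>2) \<partial>lborel)"
proof -
  define S where "S = (\<integral>x. (cmod (g x))\<^sup>2 \<partial>lborel)"
  have S: "(\<integral>\<^sup>+x. ennreal ((cmod (g x))\<^sup>2) \<partial>lborel) = ennreal S"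
    unfolding S_def using g2 by (intro nn_integral_eq_integral) auto
  define s where "s = (\<lambda>m. 1 / (real m + 1))"
  have s0: "s m > 0" for m by (simp add: s_def)
  have s: "s \<longlonglongrightarrow> 0" unfolding s_def using LIMSEQ_inverse_real_of_nat by (simp add: inverse_eq_divide add.commute)
  let ?G = "\<lambda>v::'a. exp (- ((norm v)\<^sup>2 / 2))"
  let ?c = "complex_of_real ((sqrt (2 * pi) / (2 * pi)) ^ DIM('a))"
  have Gi: "integrable lborel (\<lambda>v. complex_of_real (?G v))"
    using integrable_gauss_iexp[of "0::'a"] by simp
  have GE: "(\<integral>v. complex_of_real (?G v) \<partial>lborel) = complex_of_real (sqrt (2 * pi) ^ DIM('a))"
    using integral_gauss_iexp[of "0::'a"] by simp
  have [measurable]: "autocorr g \<in> borel_measurable borel" using integrable_autocorr by auto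
  define L where "L m = (\<integral>y. exp (- ((norm (s m *\<^sub>R y))\<^sup>2 / 2)) * (cmod (fourier_R g y))\<^sup>2 \<partial>lborel)" for m
  have "(\<lambda>m. \<integral>v. ?G v * autocorr g ((s m / (2 * pi)) *\<^sub>R v) \<partial>lborel) \<longlonglongrightarrow>
      (\<integral>v. ?G v * autocorr g 0 \<partial>lborel)"
  proof (rule integral_dominated_convergence[where w = "\<lambda>v. norm (complex_of_real (?G v) * complex_of_real S)"])
    show "integrable lborel (\<lambda>v. norm (complex_of_real (?G v) * complex_of_real S))"
      using Gi by (intro integrable_norm integrable_mult_left) auto
    show "AE v in lborel. norm (?G v * autocorr g ((s m / (2 * pi)) *\<^sub>R v)) \<le> norm (complex_of_real (?G v) * complex_of_real S)" for m
      using norm_autocorr_le by (auto simp: norm_mult S_def intro!: mult_left_mono)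
    show "AE v in lborel. (\<lambda>m. ?G v * autocorr g ((s m / (2 * pi)) *\<^sub>R v)) \<longlonglongrightarrow> ?G v * autocorr g 0"
    proof (rule AE_I2)
      fix v :: 'a
      have "(\<lambda>m. (s m / (2 * pi)) *\<^sub>R v) \<longlonglongrightarrow> (0 / (2 * pi)) *\<^sub>R v"
        by (intro tendsto_intros s) auto
      then show "(\<lambda>m. ?G v * autocorr g ((s m / (2 * pi)) *\<^sub>R v)) \<longlonglongrightarrow> ?G v * autocorr g 0"
        by (intro tendsto_intros tendsto_autocorr) simp
    qed
  qed measurable
  then have "(\<lambda>m. ?c * (\<integral>v. ?G v * autocorr g ((s m / (2 * pi)) *\<^sub>R v) \<partial>lborel)) \<longlonglongrightarrow>
      ?c * (\<integral>v. ?G v * autocorr g 0 \<partial>lborel)"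
    by (intro tendsto_intros)
  also have "(\<lambda>m. ?c * (\<integral>v. ?G v * autocorr g ((s m / (2 * pi)) *\<^sub>R v) \<partial>lborel)) = (\<lambda>m. complex_of_real (L m))"
    unfolding L_def using integral_fourier_R_sq_gauss[OF s0] by simp
  \<comment> \<open>In each dimension one factor \<open>sqrt (2 * pi)\<close> comes from the
    transform of the Gaussian and one from its mass; together they cancel
    \<open>2 * pi\<close>.\<close>
  also have "?c * (\<integral>v. ?G v * autocorr g 0 \<partial>lborel) =
      complex_of_real ((sqrt (2 * pi) * sqrt (2 * pi) / (2 * pi)) ^ DIM('a)) * autocorr g 0"
  proof -
    have "(sqrt (2 * pi) / (2 * pi)) ^ DIM('a) * sqrt (2 * pi) ^ DIM('a) =
        (sqrt (2 * pi) * sqrt (2 * pi) / (2 * pi)) ^ DIM('a)"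
      by (simp only: power_mult_distrib[symmetric] times_divide_eq_left)
    then show ?thesis
      unfolding integral_mult_left_zero GE mult.assoc[symmetric] of_real_mult[symmetric] by (simp only:)
  qed
  also have "sqrt (2 * pi) * sqrt (2 * pi) / (2 * pi) = 1" by simp
  finally have L: "L \<longlonglongrightarrow> S"
    unfolding autocorr_0 S_def[symmetric] by (simp add: tendsto_of_real_iff)
  have Lnn: "(\<integral>\<^sup>+y. ennreal (exp (- ((norm (s m *\<^sub>R y))\<^sup>2 / 2)) * (cmod (fourier_R g y))\<^sup>2) \<partial>lborel) = ennreal (L m)" for m
    unfolding L_def
  proof (rule nn_integral_eq_integral)
    have i: "integrable lborel (\<lambda>y::'a. complex_of_real (exp (- ((norm (s m *\<^sub>R y))\<^sup>2 / 2))) *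
        complex_of_real ((\<integral>x. cmod (g x) \<partial>lborel)\<^sup>2))"
      using integrable_gauss_echar[OF s0[of m], of "0::'a"] by (intro integrable_mult_left) simp
    show "integrable lborel (\<lambda>y. exp (- ((norm (s m *\<^sub>R y))\<^sup>2 / 2)) * (cmod (fourier_R g y))\<^sup>2)"
    proof (rule Bochner_Integration.integrable_bound[OF i])
      show "AE y in lborel. norm (exp (- ((norm (s m *\<^sub>R y))\<^sup>2 / 2)) * (cmod (fourier_R g y))\<^sup>2) \<le>
         norm (complex_of_real (exp (- ((norm (s m *\<^sub>R y))\<^sup>2 / 2))) * complex_of_real ((\<integral>x. cmod (g x) \<partial>lborel)\<^sup>2))"
        using norm_fourier_R_le[of g]
        by (auto simp: norm_mult norm_power intro!: mult_left_mono power_mono)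
    qed measurable
  qed auto
  show ?thesis
  proof (rule antisym)
    have "(\<integral>\<^sup>+y. ennreal ((cmod (fourier_R g y))\<^sup>2) \<partial>lborel) =
       (\<integral>\<^sup>+y. liminf (\<lambda>m. ennreal (exp (- ((norm (s m *\<^sub>R y))\<^sup>2 / 2)) * (cmod (fourier_R g y))\<^sup>2)) \<partial>lborel)"
    proof (rule nn_integral_cong)
      fix y :: 'a
      have "(\<lambda>m. exp (- ((norm (s m *\<^sub>R y))\<^sup>2 / 2)) * (cmod (fourier_R g y))\<^sup>2) \<longlonglongrightarrow>
         exp (- ((norm (0 *\<^sub>R y))\<^sup>2 / 2)) * (cmod (fourier_R g y))\<^sup>2"
        by (intro tendsto_intros s) auto
      then have "(\<lambda>m. ennreal (exp (- ((norm (s m *\<^sub>R y))\<^sup>2 / 2)) * (cmod (fourier_R g y))\<^sup>2)) \<longlonglongrightarrow>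
         ennreal ((cmod (fourier_R g y))\<^sup>2)" by (auto intro: tendsto_ennrealI)
      then show "ennreal ((cmod (fourier_R g y))\<^sup>2) =
        liminf (\<lambda>m. ennreal (exp (- ((norm (s m *\<^sub>R y))\<^sup>2 / 2)) * (cmod (fourier_R g y))\<^sup>2))"
        by (intro lim_imp_Liminf[symmetric]) auto
    qed
    also have "\<dots> \<le> liminf (\<lambda>m. \<integral>\<^sup>+y. ennreal (exp (- ((norm (s m *\<^sub>R y))\<^sup>2 / 2)) * (cmod (fourier_R g y))\<^sup>2) \<partial>lborel)"
      by (rule nn_integral_liminf) measurable
    also have "\<dots> = ennreal S"
      unfolding Lnn using L by (intro lim_imp_Liminf tendsto_ennrealI) auto
    finally show "(\<integral>\<^sup>+y. ennreal ((cmod (fourier_R g y))\<^sup>2) \<partial>lborel) \<le> (\<integral>\<^sup>+x. ennreal ((cmod (g x))\<^sup>2) \<partial>lborel)"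
      unfolding S .
    have "ennreal (L m) \<le> (\<integral>\<^sup>+y. ennreal ((cmod (fourier_R g y))\<^sup>2) \<partial>lborel)" for m
      unfolding Lnn[symmetric] by (intro nn_integral_mono ennreal_leI mult_left_le_one_le) auto
    then show "(\<integral>\<^sup>+x. ennreal ((cmod (g x))\<^sup>2) \<partial>lborel) \<le> (\<integral>\<^sup>+y. ennreal ((cmod (fourier_R g y))\<^sup>2) \<partial>lborel)"
      unfolding S by (intro LIMSEQ_le_const2[OF tendsto_ennrealI[OF L]]) auto
  qed
qed

end
end

section \<open>Square summable sequences and Hilbert--Schmidt norms\<close>

lemma ell2D: "v \<in> ell2 \<Longrightarrow> summable (\<lambda>i. (cmod (v i))\<^sup>2)"
  by (simp add: ell2_def)

lemma vnorm_power2: "v \<in> ell2 \<Longrightarrow> (vnorm v)\<^sup>2 = (\<Sum>i. (cmod (v i))\<^sup>2)"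
  unfolding vnorm_def by (simp add: ell2D suminf_nonneg)

lemma ennreal_vnorm_power2:
  "v \<in> ell2 \<Longrightarrow> ennreal ((vnorm v)\<^sup>2) = (\<Sum>i. ennreal ((cmod (v i))\<^sup>2))"
  by (simp add: vnorm_power2 suminf_ennreal2 ell2D)

lemma cmod_le_vnorm:
  assumes "v \<in> ell2"
  shows "cmod (v i) \<le> vnorm v"
proof -
  have "(cmod (v i))\<^sup>2 = (\<Sum>j\<in>{i}. (cmod (v j))\<^sup>2)" by simp
  also have "\<dots> \<le> (\<Sum>j. (cmod (v j))\<^sup>2)" by (rule sum_le_suminf) (use assms in \<open>auto simp: ell2_def\<close>)
  finally show ?thesis
    unfolding vnorm_def by (simp add: real_le_rsqrt)
qed

lemma ell2_diff:
  assumes "u \<in> ell2" "v \<in> ell2"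
  shows "(\<lambda>i. u i - v i) \<in> ell2"
  unfolding ell2_def mem_Collect_eq
proof (rule summable_comparison_test')
  show "summable (\<lambda>i. 2 * (cmod (u i))\<^sup>2 + 2 * (cmod (v i))\<^sup>2)"
    using assms by (intro summable_add summable_mult) (auto simp: ell2_def)
  fix i
  have "(cmod (u i - v i))\<^sup>2 \<le> (cmod (u i) + cmod (v i))\<^sup>2"
    by (intro power_mono norm_triangle_ineq4) simp
  also have "\<dots> \<le> 2 * (cmod (u i))\<^sup>2 + 2 * (cmod (v i))\<^sup>2"
    using sum_squares_bound[of "cmod (u i)" "cmod (v i)"] by (simp add: power2_sum)
  finally show "norm ((cmod (u i - v i))\<^sup>2) \<le> 2 * (cmod (u i))\<^sup>2 + 2 * (cmod (v i))\<^sup>2" by simp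
qed

lemma basis_vec_ell2: "basis_vec j \<in> ell2"
  unfolding ell2_def mem_Collect_eq
  by (rule summable_finite[of "{j}"]) (auto simp: basis_vec_def)

lemma vnorm_basis_vec [simp]: "vnorm (basis_vec j) = 1"
proof -
  have "(\<Sum>i. (cmod (basis_vec j i))\<^sup>2) = (\<Sum>i\<in>{j}. (cmod (basis_vec j i))\<^sup>2)"
    by (rule suminf_finite) (auto simp: basis_vec_def)
  then show ?thesis by (simp add: vnorm_def basis_vec_def)
qed

lemma vinner_basis_vec: "vinner u (basis_vec i) = u i"
proof -
  have "(\<Sum>j. u j * cnj (basis_vec i j)) = (\<Sum>j\<in>{i}. u j * cnj (basis_vec i j))"
    by (rule suminf_finite) (auto simp: basis_vec_def)
  then show ?thesis by (simp add: vinner_def basis_vec_def)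
qed

lemma basis_vec_in_std_space: "basis_vec j \<in> std_space d \<longleftrightarrow> enat j < d"
  unfolding std_space_def mem_Collect_eq basis_vec_def
  using basis_vec_ell2[of j, unfolded basis_vec_def]
  by (auto simp: not_le)

text \<open>The outer index is the basis vector to which the operator is applied, the inner one the
  coordinate of its image. With values in \<open>ennreal\<close> no summability has to be carried
  along when matrices are added or scaled.\<close>

definition hs_sum :: "(nat \<Rightarrow> nat \<Rightarrow> complex) \<Rightarrow> ennreal" where
  "hs_sum A = (\<Sum>j. \<Sum>i. ennreal ((cmod (A j i))\<^sup>2))"

text \<open>Membership of the images in \<open>ell2\<close> matters: \<open>vnorm\<close> is built
  on a real \<open>suminf\<close>, whose value is unspecified for divergent series, whereas
  \<open>hs_sum\<close> would be infinite.\<close>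

lemma hs_norm_sq_eq_hs_sum:
  assumes "\<And>j. basis_vec j \<in> H \<Longrightarrow> T (basis_vec j) \<in> ell2"
  shows "hs_norm_sq H T = hs_sum (\<lambda>j i. if basis_vec j \<in> H then T (basis_vec j) i else 0)"
  unfolding hs_norm_sq_def hs_sum_def
  by (intro suminf_cong) (use assms in \<open>simp add: ennreal_vnorm_power2\<close>)

lemma hs_sum_cong_norm: "(\<And>j i. cmod (A j i) = cmod (B j i)) \<Longrightarrow> hs_sum A = hs_sum B"
  by (simp add: hs_sum_def)

lemma hs_sum_scale: "hs_sum (\<lambda>j i. c * A j i) = ennreal ((cmod c)\<^sup>2) * hs_sum A"
  by (simp add: hs_sum_def norm_mult power_mult_distrib ennreal_mult)

text \<open>A substitute for Minkowski's inequality that holds pointwise, hence survives sums,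
  integrals and weights, while the constant on the first term can be brought as close to 1 as
  desired.\<close>

lemma norm_add_power2_le:
  fixes a b :: "'a::real_normed_vector"
  assumes "e > 0"
  shows "(norm (a + b))\<^sup>2 \<le> (1 + e) * (norm a)\<^sup>2 + (1 + 1 / e) * (norm b)\<^sup>2"
proof -
  have "(norm (a + b))\<^sup>2 \<le> (norm a + norm b)\<^sup>2"
    by (intro power_mono norm_triangle_ineq) simp
  also have "\<dots> = (norm a)\<^sup>2 + (norm b)\<^sup>2 + 2 * norm a * norm b" by (simp add: power2_sum)
  also have "2 * norm a * norm b \<le> e * (norm a)\<^sup>2 + (norm b)\<^sup>2 / e"
  proof -
    have "0 \<le> (e * norm a - norm b)\<^sup>2 / e" using assms by simp
    also have "\<dots> = e * (norm a)\<^sup>2 + (norm b)\<^sup>2 / e - 2 * norm a * norm b"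
      using assms by (simp add: power2_diff field_simps power2_eq_square)
    finally show ?thesis by simp
  qed
  finally show ?thesis by (simp add: algebra_simps)
qed

lemma ennreal_norm_add_power2_le:
  fixes a b :: "'a::real_normed_vector"
  assumes "e > 0"
  shows "ennreal ((norm (a + b))\<^sup>2) \<le>
    ennreal (1 + e) * ennreal ((norm a)\<^sup>2) + ennreal (1 + 1 / e) * ennreal ((norm b)\<^sup>2)"
  using norm_add_power2_le[OF assms, of a b] assms
  by (simp flip: ennreal_mult ennreal_plus add: ennreal_leI)

lemma hs_sum_add_le:
  assumes "e > 0"
  shows "hs_sum (\<lambda>j i. A j i + B j i) \<le> ennreal (1 + e) * hs_sum A + ennreal (1 + 1 / e) * hs_sum B"
proof -
  have "hs_sum (\<lambda>j i. A j i + B j i) \<le>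
    (\<Sum>j. \<Sum>i. ennreal (1 + e) * ennreal ((norm (A j i))\<^sup>2) + ennreal (1 + 1 / e) * ennreal ((norm (B j i))\<^sup>2))"
    unfolding hs_sum_def by (intro suminf_le ennreal_norm_add_power2_le assms) auto
  also have "\<dots> = ennreal (1 + e) * hs_sum A + ennreal (1 + 1 / e) * hs_sum B"
    unfolding hs_sum_def
    by (simp only: suminf_add[OF summableI summableI, symmetric] ennreal_suminf_cmult)
  finally show ?thesis .
qed

section \<open>Irreducible representations\<close>

lemma irrepsE:
  assumes "(H, \<pi>) \<in> irreps"
  obtains d where "H = std_space d" "irreducible_rep H \<pi>"
  using assms by (auto simp: irreps_def)

lemma irrep_closed_subspace: "(H, \<pi>) \<in> irreps \<Longrightarrow> closed_subspace H"
  by (auto simp: irreps_def irreducible_rep_def unitary_rep_def)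

lemma irrep_subset_ell2: "(H, \<pi>) \<in> irreps \<Longrightarrow> H \<subseteq> ell2"
  by (drule irrep_closed_subspace) (simp add: closed_subspace_def)

lemma irrep_unitary: "(H, \<pi>) \<in> irreps \<Longrightarrow> unitary_op H H (\<pi> k)"
  by (auto simp: irreps_def irreducible_rep_def unitary_rep_def)

lemma irrep_in: "(H, \<pi>) \<in> irreps \<Longrightarrow> u \<in> H \<Longrightarrow> \<pi> k u \<in> H"
  using irrep_unitary[of H \<pi> k] by (auto simp: unitary_op_def)

lemma irrep_vnorm: "(H, \<pi>) \<in> irreps \<Longrightarrow> u \<in> H \<Longrightarrow> vnorm (\<pi> k u) = vnorm u"
  using irrep_unitary[of H \<pi> k] by (auto simp: unitary_op_def)

text \<open>Multiplicativity makes \<open>\<pi> 0\<close> idempotent, and an idempotent map onto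
  \<open>H\<close> is the identity on \<open>H\<close>.\<close>

lemma irrep_zero:
  assumes "(H, \<pi>) \<in> irreps" "u \<in> H"
  shows "\<pi> 0 u = u"
proof -
  have "\<pi> 0 ` H = H" using irrep_unitary[OF assms(1)] by (auto simp: unitary_op_def)
  then obtain w where w: "w \<in> H" "u = \<pi> 0 w" using assms by blast
  moreover have "\<pi> (0 + 0) w = \<pi> 0 (\<pi> 0 w)"
    using assms w unfolding irreps_def irreducible_rep_def unitary_rep_def by blast
  ultimately show ?thesis by simp
qed

lemma irrep_continuous_coord:
  assumes "(H, \<pi>) \<in> irreps" "u \<in> H"
  shows "continuous_on UNIV (\<lambda>k. \<pi> k u i)"
  unfolding continuous_on_def
proof (rule ballI)
  fix k
  have lim: "((\<lambda>l. vnorm (\<lambda>i. \<pi> l u i - \<pi> k u i)) \<longlongrightarrow> 0) (at k)"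
    using assms unfolding irreps_def irreducible_rep_def unitary_rep_def by blast
  have "\<pi> l u \<in> ell2" for l using irrep_in[OF assms] irrep_subset_ell2[OF assms(1)] by blast
  then have "cmod (\<pi> l u i - \<pi> k u i) \<le> vnorm (\<lambda>i. \<pi> l u i - \<pi> k u i)" for l
    using cmod_le_vnorm[OF ell2_diff] by blast
  then show "((\<lambda>l. \<pi> l u i) \<longlongrightarrow> \<pi> k u i) (at k within UNIV)"
    using Lim_null_comparison[OF always_eventually lim, of "\<lambda>l. \<pi> l u i - \<pi> k u i"]
    by (simp add: LIM_zero_iff)
qed

lemma irrep_coord_le:
  assumes "(H, \<pi>) \<in> irreps" "basis_vec j \<in> H"
  shows "cmod (\<pi> k (basis_vec j) i) \<le> 1"
proof -
  have "\<pi> k (basis_vec j) \<in> ell2"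
    using irrep_in[OF assms] irrep_subset_ell2[OF assms(1)] by blast
  from cmod_le_vnorm[OF this, of i] show ?thesis by (simp add: irrep_vnorm[OF assms])
qed

text \<open>Irreducible representations act on nonzero spaces, so the dimension is at least 1. The
  diagonal entry at index 0 can therefore serve to detect any class of the dual.\<close>

lemma irrep_basis_vec_0:
  assumes "(H, \<pi>) \<in> irreps"
  shows "basis_vec 0 \<in> H"
proof -
  from assms obtain d where d: "H = std_space d" and i: "irreducible_rep H \<pi>" by (rule irrepsE)
  have "H \<noteq> {\<lambda>i. 0}" using i by (simp add: irreducible_rep_def)
  moreover have "std_space 0 = {\<lambda>i. 0}"
    by (auto simp: std_space_def ell2_def)
  ultimately have "d \<noteq> 0" using d by metis
  then have "enat 0 < d" unfolding zero_enat_def[symmetric] by simp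
  then show ?thesis unfolding d basis_vec_in_std_space .
qed

text \<open>Extension by 0 beyond the dimension lets representations of all dimensions share one
  index set.\<close>

definition rep_coeff :: "'k urep \<Rightarrow> nat \<Rightarrow> nat \<Rightarrow> 'k \<Rightarrow> complex" where
  "rep_coeff p j i k = (if basis_vec j \<in> fst p then snd p k (basis_vec j) i else 0)"

lemma space_irreps_space: "space irreps_space = irreps"
  unfolding irreps_space_def 
  by (rule space_measure_of)
     (rule Un_least; rule subsetI; elim CollectE exE conjE; hypsubst; rule PowI; rule subsetI; elim CollectE case_prodE conjE; hypsubst; assumption)

lemma sets_irreps_space_dim: "{p \<in> irreps. fst p = std_space d} \<in> sets irreps_space"
proof -
  have eq: "{p \<in> irreps. fst p = std_space d} = {(H, \<pi>) \<in> irreps. H = std_space d}"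
    unfolding case_prod_beta by simp
  show ?thesis unfolding eq irreps_space_def
    by (rule in_measure_of)
       ((rule Un_least; rule subsetI; elim CollectE exE conjE; hypsubst; rule PowI; rule subsetI; elim CollectE case_prodE conjE; hypsubst; assumption), rule UnI1, rule CollectI, rule exI[of _ d], rule conjI[OF refl TrueI])
qed

lemma sets_irreps_space_coeff:
  assumes "u \<in> std_space d" "v \<in> std_space d" "B \<in> sets borel"
  shows "{p \<in> irreps. fst p = std_space d \<and> vinner (snd p k u) v \<in> B} \<in> sets irreps_space"
proof -
  have eq: "{p \<in> irreps. fst p = std_space d \<and> vinner (snd p k u) v \<in> B} =
    {(H, \<pi>) \<in> irreps. H = std_space d \<and> vinner (\<pi> k u) v \<in> B}"
    unfolding case_prod_beta by simp
  show ?thesis unfolding eq irreps_space_def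
    by (rule in_measure_of)
       ((rule Un_least; rule subsetI; elim CollectE exE conjE; hypsubst; rule PowI; rule subsetI; elim CollectE case_prodE conjE; hypsubst; assumption), rule UnI2, rule CollectI, intro exI conjI, rule refl, use assms in simp_all)
qed

text \<open>The generators of the sigma-algebra see one dimension at a time. The preimage is cut
  along the countably many values of \<open>d\<close>; on each piece the coefficient is either a
  generating matrix coefficient or constantly 0.\<close>

lemma borel_measurable_rep_coeff [measurable]:
  "(\<lambda>p. rep_coeff p j i k) \<in> borel_measurable irreps_space"
proof (rule measurableI)
  fix B :: "complex set" assume B: "B \<in> sets borel"
  let ?A = "\<lambda>d. {p \<in> irreps. fst p = std_space d \<and> rep_coeff p j i k \<in> B}"
  have "?A d \<in> sets irreps_space" for d
  proof (cases "enat j < d \<and> enat i < d")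
    case True
    then have "?A d = {p \<in> irreps. fst p = std_space d \<and> vinner (snd p k (basis_vec j)) (basis_vec i) \<in> B}"
      by (auto simp: rep_coeff_def basis_vec_in_std_space vinner_basis_vec)
    then show ?thesis
      using True B by (simp only:, intro sets_irreps_space_coeff) (auto simp: basis_vec_in_std_space)
  next
    case False
    have "rep_coeff p j i k = 0" if "p \<in> irreps" "fst p = std_space d" for p
    proof (cases "enat j < d")
      case True
      then have "snd p k (basis_vec j) \<in> std_space d"
        using irrep_in[of "fst p" "snd p" "basis_vec j" k, unfolded prod.collapse] that
        by (simp add: basis_vec_in_std_space)
      then show ?thesis using False True by (auto simp: rep_coeff_def std_space_def not_less)
    qed (use that in \<open>auto simp: rep_coeff_def basis_vec_in_std_space\<close>)
    then have "?A d = (if 0 \<in> B then {p \<in> irreps. fst p = std_space d} else {})" by auto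
    then show ?thesis by (simp add: sets_irreps_space_dim)
  qed
  then have "(\<Union>d. ?A d) \<in> sets irreps_space" by (intro sets.countable_UN') auto
  moreover have "(\<Union>d. ?A d) = (\<lambda>p. rep_coeff p j i k) -` B \<inter> space irreps_space"
    unfolding space_irreps_space by (auto simp: irreps_def)
  ultimately show "(\<lambda>p. rep_coeff p j i k) -` B \<inter> space irreps_space \<in> sets irreps_space" by simp
qed auto

lemma space_dual_space: "space dual_space = unitary_dual"
  unfolding dual_space_def by (intro space_measure_of) auto

lemma unitary_dual_subset: "\<sigma> \<in> unitary_dual \<Longrightarrow> \<sigma> \<subseteq> irreps"
  unfolding unitary_dual_def quotient_def by auto

section \<open>Haar measure\<close>

text \<open>Local compactness puts each point into an open set inside a compact one, and Lindelof
  thins these sets to a countable cover. Compact sets have finite Haar measure, which then gives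
  sigma-finiteness.\<close>

lemma locally_compact_sigma_compact:
  assumes "locally_compact_space (euclidean :: 'k::{second_countable_topology, t2_space} topology)"
  obtains \<C> :: "'k::{second_countable_topology, t2_space} set set" where "countable \<C>" "\<And>C. C \<in> \<C> \<Longrightarrow> open C"
    "\<And>C. C \<in> \<C> \<Longrightarrow> \<exists>D. compact D \<and> C \<subseteq> D" "\<Union>\<C> = UNIV"
proof -
  let ?F = "{U :: 'k set. open U \<and> (\<exists>D. compact D \<and> U \<subseteq> D)}"
  obtain \<C> where \<C>: "\<C> \<subseteq> ?F" "countable \<C>" "\<Union>\<C> = \<Union>?F"
    using Lindelof[of ?F] by auto
  moreover have "\<Union>?F = UNIV"
    using assms unfolding locally_compact_space_def by (auto simp: compactin_euclidean_iff) blast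
  ultimately have "\<Union>\<C> = UNIV" by simp
  have mem: "open C \<and> (\<exists>D. compact D \<and> C \<subseteq> D)" if "C \<in> \<C>" for C
    using subsetD[OF \<C>(1) that] by simp
  show ?thesis
    by (rule that[OF \<C>(2) _ _ \<open>\<Union>\<C> = UNIV\<close>]) (simp_all add: mem)
qed

lemma left_haar_sigma_finite:
  fixes \<mu> :: "'k::{topological_group_add, second_countable_topology, t2_space} measure"
  assumes "locally_compact_space (euclidean :: 'k topology)" "left_haar_measure \<mu>"
  shows "sigma_finite_measure \<mu>"
proof -
  obtain \<C> :: "'k set set" where \<C>: "countable \<C>" "\<And>C. C \<in> \<C> \<Longrightarrow> open C"
    "\<And>C. C \<in> \<C> \<Longrightarrow> \<exists>D. compact D \<and> C \<subseteq> D" "\<Union>\<C> = UNIV"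
    using locally_compact_sigma_compact[OF assms(1)] by metis
  have r: "sets \<mu> = sets borel" "\<And>D. compact D \<Longrightarrow> emeasure \<mu> D < \<infinity>"
    using assms(2) by (auto simp: left_haar_measure_def radon_measure_def)
  show ?thesis
  proof (rule sigma_finite_measure.intro, intro exI[of _ \<C>] conjI ballI)
    show "\<C> \<subseteq> sets \<mu>" using \<C> r by auto
    show "\<Union>\<C> = space \<mu>" using \<C> sets_eq_imp_space_eq[OF r(1)] by simp
    fix C assume "C \<in> \<C>"
    then obtain D where D: "compact D" "C \<subseteq> D" using \<C>(3) by meson
    have "emeasure \<mu> C \<le> emeasure \<mu> D"
      by (rule emeasure_mono[OF D(2)]) (simp add: r(1) borel_compact D(1))
    also have "\<dots> < \<infinity>" by (rule r(2)[OF D(1)])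
    finally show "emeasure \<mu> C \<noteq> \<infinity>" by simp
  qed (fact \<C>)
qed

text \<open>If \<open>U\<close> were null, so would be its translates, countably many of which cover
  the group by Lindelof.\<close>

lemma left_haar_open_pos:
  fixes \<mu> :: "'k::{topological_group_add, second_countable_topology, t2_space} measure"
  assumes "left_haar_measure \<mu>" "open U" "0 \<in> U"
  shows "emeasure \<mu> U \<noteq> 0"
proof
  assume null: "emeasure \<mu> U = 0"
  have s: "sets \<mu> = sets borel" "emeasure \<mu> UNIV \<noteq> 0"
    "\<And>k A. A \<in> sets borel \<Longrightarrow> emeasure \<mu> ((\<lambda>x. k + x) ` A) = emeasure \<mu> A"
    using assms(1) by (auto simp: left_haar_measure_def radon_measure_def)
  let ?F = "range (\<lambda>k. (\<lambda>x. k + x) ` U)"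
  have im: "(\<lambda>x. k + x) ` U = (\<lambda>x. - k + x) -` U" for k
  proof safe
    fix x assume "- k + x \<in> U"
    then show "x \<in> (+) k ` U" by (intro image_eqI[of _ _ "- k + x"]) (auto simp flip: add.assoc)
  qed (auto simp flip: add.assoc)
  have op: "open ((\<lambda>x. k + x) ` U)" for k
    unfolding im using assms(2) by (intro open_vimage continuous_intros)
  have "open S" if "S \<in> ?F" for S using that op by fast
  then obtain \<C> where \<C>: "\<C> \<subseteq> ?F" "countable \<C>" "\<Union>\<C> = \<Union>?F"
    using Lindelof[of ?F] by metis
  have "\<Union>?F = UNIV"
  proof -
    have "k \<in> (\<lambda>x. k + x) ` U" for k using assms(3) by (intro image_eqI[of _ _ 0]) auto
    then show ?thesis by blast
  qed
  moreover have "\<Union>\<C> \<in> null_sets \<mu>"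
  proof -
    have "C \<in> null_sets \<mu>" if C_in: "C \<in> \<C>" for C
    proof -
      obtain k where k: "C = (\<lambda>x. k + x) ` U" using subsetD[OF \<C>(1) C_in] by fast
      have "U \<in> sets borel" using assms(2) by simp
      from s(3)[OF this, of k] null op[of k] show ?thesis
        unfolding k by (simp add: null_sets_def s(1))
    qed
    then show ?thesis using \<C>(2) null_sets_UN'[of \<C> "\<lambda>C. C" \<mu>] by simp
  qed
  ultimately show False using \<C>(3) s(2) by (simp add: null_sets_def)
qed

section \<open>The Plancherel theorem on the product group\<close>

text \<open>
  Separability of the first factor suffices: f (e (T m k)) x takes finitely many values of
  its first argument and converges to f k x, since e (T m k) lies in every one of the first m basic
  open sets that contain k.
\<close>

lemma caratheodory_borel_measurable:
  fixes f :: "'k::second_countable_topology \<Rightarrow> 'a \<Rightarrow> 'b::{metric_space, second_countable_topology}"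
  assumes meas: "\<And>k. f k \<in> borel_measurable M"
    and cont: "\<And>x. x \<in> space M \<Longrightarrow> continuous_on UNIV (\<lambda>k. f k x)"
  shows "(\<lambda>(k, x). f k x) \<in> borel_measurable (borel \<Otimes>\<^sub>M M)"
proof -
  obtain \<B> :: "'k set set" where \<B>: "countable \<B>" "topological_basis \<B>"
    using ex_countable_basis by blast
  have "\<B> \<noteq> {}"
  proof
    assume "\<B> = {}"
    with topological_basisE[OF \<B>(2), of UNIV undefined] show False by auto
  qed
  define B where "B = from_nat_into \<B>"
  have B: "range B = \<B>"
    unfolding B_def by (rule range_from_nat_into[OF \<open>\<B> \<noteq> {}\<close> \<B>(1)])
  have Bo [measurable]: "B i \<in> sets borel" for i :: nat
    using topological_basis_open[OF \<B>(2)] B by auto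
  define e where "e S = (SOME z. z \<in> (\<Inter>i\<in>S. B i))" for S
  define T where "T m k = {i\<in>{..m}. k \<in> B i}" for m :: nat and k
  show ?thesis
  proof (rule borel_measurable_LIMSEQ_metric)
    fix m
    have "(\<lambda>p. f (e (T m (fst p))) (snd p)) \<in> borel_measurable (borel \<Otimes>\<^sub>M M)"
    proof (rule measurable_compose_countable'[where I = "Pow {..m}" and
          f = "\<lambda>S p. f (e S) (snd p)" and g = "\<lambda>p. T m (fst p)"])
      show "(\<lambda>p. f (e S) (snd p)) \<in> borel_measurable (borel \<Otimes>\<^sub>M M)" for S
        using meas by measurable
      show "(\<lambda>p. T m (fst p)) \<in> (borel \<Otimes>\<^sub>M M) \<rightarrow>\<^sub>M count_space (Pow {..m})"
      proof (subst measurable_count_space_eq2, safe)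
        fix S assume "S \<subseteq> {..m}"
        then have "(\<lambda>p. T m (fst p)) -` {S} \<inter> space (borel \<Otimes>\<^sub>M M) =
          {p \<in> space (borel \<Otimes>\<^sub>M M). \<forall>i\<in>{..m}. fst p \<in> B i \<longleftrightarrow> i \<in> S}"
          by (auto simp: T_def)
        also have "\<dots> \<in> sets (borel \<Otimes>\<^sub>M M)" by measurable
        finally show "(\<lambda>p. T m (fst p)) -` {S} \<inter> space (borel \<Otimes>\<^sub>M M) \<in> sets (borel \<Otimes>\<^sub>M M)" .
      qed (auto simp: T_def)
    qed (simp add: countable_finite)
    then show "(\<lambda>(k, x). f (e (T m k)) x) \<in> borel_measurable (borel \<Otimes>\<^sub>M M)"
      by (simp add: case_prod_beta')
  next
    fix p assume "p \<in> space ((borel :: 'k measure) \<Otimes>\<^sub>M M)"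
    then obtain k x where p: "p = (k, x)" "x \<in> space M" by (auto simp: space_pair_measure)
    have "(\<lambda>m. e (T m k)) \<longlonglongrightarrow> k"
    proof (rule topological_tendstoI)
      fix U assume "open U" "k \<in> U"
      then obtain i where i: "k \<in> B i" "B i \<subseteq> U"
        using topological_basisE[OF \<B>(2)] B by (metis imageE)
      have "e (T m k) \<in> U" if "m \<ge> i" for m
      proof -
        have "k \<in> (\<Inter>j\<in>T m k. B j)" by (auto simp: T_def)
        then have "e (T m k) \<in> (\<Inter>j\<in>T m k. B j)" unfolding e_def by (rule someI)
        moreover have "i \<in> T m k" using i that by (auto simp: T_def)
        ultimately show ?thesis using i by blast
      qed
      then show "\<forall>\<^sub>F m in sequentially. e (T m k) \<in> U"
        by (auto simp: eventually_sequentially)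
    qed
    then have "(\<lambda>m. f (e (T m k)) x) \<longlonglongrightarrow> f k x"
      using continuous_on_tendsto_compose[OF cont[OF p(2)]] by simp
    then show "(\<lambda>m. case p of (k, x) \<Rightarrow> f (e (T m k)) x) \<longlonglongrightarrow> (case p of (k, x) \<Rightarrow> f k x)"
      by (simp add: p)
  qed
qed

lemma ennreal_le_suminf: "f i \<le> (\<Sum>i. f i :: ennreal)"
  using ennreal_suminf_lessD not_le by blast

lemma hs_sum_ge: "ennreal ((cmod (A j i))\<^sup>2) \<le> hs_sum A"
  unfolding hs_sum_def
  by (rule order.trans[OF ennreal_le_suminf[where f = "\<lambda>i. ennreal ((cmod (A j i))\<^sup>2)"]])
     (rule ennreal_le_suminf)

lemma borel_measurable_hs_sum [measurable (raw)]:
  assumes [measurable]: "\<And>j i. (\<lambda>x. A x j i) \<in> borel_measurable M"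
  shows "(\<lambda>x. hs_sum (A x)) \<in> borel_measurable M"
  unfolding hs_sum_def by measurable

lemma in_L2_iff_nn_integral:
  "in_L2 M f \<longleftrightarrow> f \<in> borel_measurable M \<and> (\<integral>\<^sup>+x. ennreal ((cmod (f x))\<^sup>2) \<partial>M) < \<infinity>"
  by (auto simp: in_L2_def integrable_iff_bounded)

locale plancherel_setup =
  fixes \<mu> :: "'k::{topological_group_add, second_countable_topology, t2_space} measure"
    and rep :: "'k urep set \<Rightarrow> 'k urep"
    and \<nu> :: "'k urep set measure"
  assumes loc_compact: "locally_compact_space (euclidean :: 'k topology)"
    and haar_mu: "left_haar_measure \<mu>"
    and rep_section: "measurable_section rep"
    and plancherel_nu: "plancherel_measure \<mu> rep \<nu>"
begin

lemma sets_mu [measurable_cong]: "sets \<mu> = sets borel"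
  using haar_mu by (simp add: left_haar_measure_def radon_measure_def)

lemma space_mu [simp]: "space \<mu> = UNIV"
  using sets_eq_imp_space_eq[OF sets_mu] by simp

lemma sets_nu [measurable_cong]: "sets \<nu> = sets dual_space"
  using plancherel_nu by (simp add: plancherel_measure_def)

lemma space_nu [simp]: "space \<nu> = unitary_dual"
  using sets_eq_imp_space_eq[OF sets_nu] by (simp add: space_dual_space)

lemma rep_measurable [measurable]: "rep \<in> dual_space \<rightarrow>\<^sub>M irreps_space"
  using rep_section by (simp add: measurable_section_def)

lemma rep_irreps: "\<sigma> \<in> unitary_dual \<Longrightarrow> (fst (rep \<sigma>), snd (rep \<sigma>)) \<in> irreps"
  using rep_section unitary_dual_subset by (fastforce simp: measurable_section_def)

sublocale mu: sigma_finite_measure \<mu>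
  by (rule left_haar_sigma_finite[OF loc_compact haar_mu])

section \<open>Matrix entries and the transform on K\<close>

text \<open>The inverse is built in, so that integrating against an entry yields the corresponding
  entry of the Fourier transform.\<close>

definition entry :: "'k urep set \<Rightarrow> nat \<Rightarrow> nat \<Rightarrow> 'k \<Rightarrow> complex" where
  "entry \<sigma> j i k = rep_coeff (rep \<sigma>) j i (- k)"

lemma continuous_entry:
  assumes "\<sigma> \<in> unitary_dual"
  shows "continuous_on UNIV (entry \<sigma> j i)"
proof (cases "basis_vec j \<in> fst (rep \<sigma>)")
  case True
  have "continuous_on UNIV (\<lambda>k. snd (rep \<sigma>) (- k) (basis_vec j) i)"
    by (rule continuous_on_compose2[OF irrep_continuous_coord[OF rep_irreps[OF assms] True]])
       (auto intro!: continuous_intros)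
  then show ?thesis using True by (simp add: entry_def rep_coeff_def)
next
  case False
  then have "entry \<sigma> j i = (\<lambda>k. 0)" by (simp add: entry_def rep_coeff_def fun_eq_iff)
  then show ?thesis by simp
qed

text \<open>The Mackey structure gives measurability in \<open>\<sigma>\<close> for each fixed group
  element, strong continuity gives continuity in the group element for each fixed class; together
  they give joint measurability.\<close>

lemma entry_measurable2:
  "(\<lambda>(k, \<sigma>). entry \<sigma> j i k) \<in> borel_measurable (borel \<Otimes>\<^sub>M dual_space)"
proof (rule caratheodory_borel_measurable)
  show "(\<lambda>\<sigma>. entry \<sigma> j i k) \<in> borel_measurable dual_space" for k
    unfolding entry_def by measurable
qed (simp add: space_dual_space continuous_entry)

lemma entry_measurable [measurable (raw)]:
  assumes "s \<in> M \<rightarrow>\<^sub>M dual_space" "g \<in> M \<rightarrow>\<^sub>M borel"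
  shows "(\<lambda>x. entry (s x) j i (g x)) \<in> borel_measurable M"
  using measurable_compose[OF measurable_Pair[OF assms(2,1)] entry_measurable2] by simp

lemma entry_measurable1:
  "\<sigma> \<in> unitary_dual \<Longrightarrow> entry \<sigma> j i \<in> borel_measurable borel"
  by (rule borel_measurable_continuous_onI[OF continuous_entry])

lemma entry_norm_le:
  assumes "\<sigma> \<in> unitary_dual"
  shows "cmod (entry \<sigma> j i k) \<le> 1"
  using irrep_coord_le[OF rep_irreps[OF assms]] by (simp add: entry_def rep_coeff_def)

lemma entry_sum_le:
  assumes "\<sigma> \<in> unitary_dual"
  shows "(\<Sum>i. ennreal ((cmod (entry \<sigma> j i k))\<^sup>2)) \<le> 1"
proof (cases "basis_vec j \<in> fst (rep \<sigma>)")
  case True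
  note ir = rep_irreps[OF assms]
  have "snd (rep \<sigma>) (- k) (basis_vec j) \<in> ell2"
    using irrep_in[OF ir True] irrep_subset_ell2[OF ir] by blast
  from ennreal_vnorm_power2[OF this] show ?thesis
    using True by (simp add: irrep_vnorm[OF ir True] entry_def rep_coeff_def)
qed (simp add: entry_def rep_coeff_def)

definition entryK :: "('k \<Rightarrow> complex) \<Rightarrow> 'k urep set \<Rightarrow> nat \<Rightarrow> nat \<Rightarrow> complex" where
  "entryK g \<sigma> j i = (\<integral>k. g k * entry \<sigma> j i k \<partial>\<mu>)"

lemma entryK_measurable [measurable (raw)]:
  assumes [measurable]: "g \<in> borel_measurable \<mu>"
  shows "(\<lambda>\<sigma>. entryK g \<sigma> j i) \<in> borel_measurable \<nu>"
  unfolding entryK_def by measurable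

text \<open>Bounding each entry by the L^1 norm of \<open>g\<close> would not be summable over
  \<open>i\<close>. Cauchy-Schwarz with respect to the measure |g| dk, which is why |g| is split
  into two square roots, keeps the squared entries under the integral, where they sum to at most 1
  because columns of unitary operators are unit vectors.\<close>

lemma entryK_sum_le:
  assumes g: "integrable \<mu> g" and \<sigma>: "\<sigma> \<in> unitary_dual"
  shows "(\<Sum>i. ennreal ((cmod (entryK g \<sigma> j i))\<^sup>2)) \<le> (\<integral>\<^sup>+k. ennreal (cmod (g k)) \<partial>\<mu>)\<^sup>2"
proof -
  have [measurable]: "g \<in> borel_measurable \<mu>" using g by auto
  note [measurable] = entry_measurable1[OF \<sigma>]
  let ?I = "\<integral>\<^sup>+k. ennreal (cmod (g k)) \<partial>\<mu>"
  have "ennreal ((cmod (entryK g \<sigma> j i))\<^sup>2) \<le> ?I * (\<integral>\<^sup>+k. ennreal (cmod (g k)) * ennreal ((cmod (entry \<sigma> j i k))\<^sup>2) \<partial>\<mu>)" for i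
  proof -
    have int: "integrable \<mu> (\<lambda>k. g k * entry \<sigma> j i k)"
      by (rule Bochner_Integration.integrable_bound[OF g])
         (auto simp: norm_mult intro!: mult_left_le entry_norm_le \<sigma>)
    have "ennreal (cmod (entryK g \<sigma> j i)) \<le> (\<integral>\<^sup>+k. ennreal (cmod (g k * entry \<sigma> j i k)) \<partial>\<mu>)"
      unfolding entryK_def by (rule integral_norm_bound_ennreal[OF int])
    also have "\<dots> = (\<integral>\<^sup>+k. ennreal (sqrt (cmod (g k))) * ennreal (sqrt (cmod (g k)) * cmod (entry \<sigma> j i k)) \<partial>\<mu>)"
      by (simp add: norm_mult flip: ennreal_mult mult.assoc)
    finally have "(ennreal (cmod (entryK g \<sigma> j i)))\<^sup>2 \<le> (\<integral>\<^sup>+k. ennreal (sqrt (cmod (g k))) * ennreal (sqrt (cmod (g k)) * cmod (entry \<sigma> j i k)) \<partial>\<mu>)\<^sup>2"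
      by (rule power_mono) simp
    also have "\<dots> \<le> (\<integral>\<^sup>+k. (ennreal (sqrt (cmod (g k))))\<^sup>2 \<partial>\<mu>) * (\<integral>\<^sup>+k. (ennreal (sqrt (cmod (g k)) * cmod (entry \<sigma> j i k)))\<^sup>2 \<partial>\<mu>)"
      by (rule Cauchy_Schwarz_nn_integral) measurable
    also have "\<dots> = ?I * (\<integral>\<^sup>+k. ennreal (cmod (g k)) * ennreal ((cmod (entry \<sigma> j i k))\<^sup>2) \<partial>\<mu>)"
      by (simp add: ennreal_power power_mult_distrib flip: ennreal_mult)
    finally show ?thesis by (simp add: ennreal_power)
  qed
  then have "(\<Sum>i. ennreal ((cmod (entryK g \<sigma> j i))\<^sup>2)) \<le>
      (\<Sum>i. ?I * (\<integral>\<^sup>+k. ennreal (cmod (g k)) * ennreal ((cmod (entry \<sigma> j i k))\<^sup>2) \<partial>\<mu>))"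
    by (intro suminf_le) auto
  also have "\<dots> = ?I * (\<integral>\<^sup>+k. (\<Sum>i. ennreal (cmod (g k)) * ennreal ((cmod (entry \<sigma> j i k))\<^sup>2)) \<partial>\<mu>)"
  proof -
    have "(\<lambda>k. ennreal (cmod (g k)) * ennreal ((cmod (entry \<sigma> j i k))\<^sup>2)) \<in> borel_measurable \<mu>" for i
      by measurable
    then show ?thesis by (subst nn_integral_suminf) simp_all
  qed
  also have "\<dots> = ?I * (\<integral>\<^sup>+k. ennreal (cmod (g k)) * (\<Sum>i. ennreal ((cmod (entry \<sigma> j i k))\<^sup>2)) \<partial>\<mu>)"
    by simp
  also have "\<dots> \<le> ?I * (\<integral>\<^sup>+k. ennreal (cmod (g k)) * 1 \<partial>\<mu>)"
    by (intro mult_left_mono nn_integral_mono entry_sum_le[OF \<sigma>]) auto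
  finally show ?thesis by (simp add: power2_eq_square)
qed

lemma entryK_ell2:
  assumes g: "integrable \<mu> g" and \<sigma>: "\<sigma> \<in> unitary_dual"
  shows "entryK g \<sigma> j \<in> ell2"
  unfolding ell2_def mem_Collect_eq
proof (rule summable_suminf_not_top)
  have "(\<integral>\<^sup>+k. ennreal (cmod (g k)) \<partial>\<mu>) < \<infinity>" using g by (simp add: integrable_iff_bounded)
  then have "(\<integral>\<^sup>+k. ennreal (cmod (g k)) \<partial>\<mu>)\<^sup>2 < \<infinity>"
    by (simp add: power2_eq_square ennreal_mult_less_top)
  with entryK_sum_le[OF assms, of j] show "(\<Sum>i. ennreal ((cmod (entryK g \<sigma> j i))\<^sup>2)) \<noteq> top"
    by (auto simp: top_unique)
qed simp

lemma entryK_eq_fourier_K: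
  "entryK g \<sigma> j i = (if basis_vec j \<in> fst (rep \<sigma>) then fourier_K \<mu> g (snd (rep \<sigma>)) (basis_vec j) i else 0)"
  by (simp add: entryK_def entry_def rep_coeff_def fourier_K_def)

lemma plancherel_K:
  assumes "integrable \<mu> g" "in_L2 \<mu> g"
  shows "(\<integral>\<^sup>+\<sigma>. hs_sum (entryK g \<sigma>) \<partial>\<nu>) = (\<integral>\<^sup>+k. ennreal ((cmod (g k))\<^sup>2) \<partial>\<mu>)"
proof -
  have "hs_sum (entryK g \<sigma>) = hs_norm_sq (fst (rep \<sigma>)) (fourier_K \<mu> g (snd (rep \<sigma>)))" if "\<sigma> \<in> unitary_dual" for \<sigma>
  proof (subst hs_norm_sq_eq_hs_sum)
    fix j assume "basis_vec j \<in> fst (rep \<sigma>)"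
    then have "fourier_K \<mu> g (snd (rep \<sigma>)) (basis_vec j) = entryK g \<sigma> j"
      by (simp add: fun_eq_iff entryK_eq_fourier_K)
    then show "fourier_K \<mu> g (snd (rep \<sigma>)) (basis_vec j) \<in> ell2"
      using entryK_ell2[OF assms(1) that] by simp
  qed (simp add: entryK_eq_fourier_K[abs_def])
  then have "(\<integral>\<^sup>+\<sigma>. hs_sum (entryK g \<sigma>) \<partial>\<nu>) =
      (\<integral>\<^sup>+\<sigma>. hs_norm_sq (fst (rep \<sigma>)) (fourier_K \<mu> g (snd (rep \<sigma>))) \<partial>\<nu>)"
    by (intro nn_integral_cong) simp
  then show ?thesis using plancherel_nu assms by (simp add: plancherel_measure_def)
qed

text \<open>
  Sigma-finiteness of the Plancherel measure is not part of its definition. The transform of the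
  indicator of a small neighbourhood B of 0 has a nonzero diagonal entry at \<open>\<sigma>\<close>, while
  its total squared Hilbert--Schmidt norm is the finite number \<open>\<mu> B\<close>.
\<close>

lemma sigma_finite_nu: "sigma_finite_measure \<nu>"
proof -
  obtain \<B> :: "'k set set" where \<B>: "countable \<B>" "topological_basis \<B>"
    using ex_countable_basis by blast
  have op: "open B" if "B \<in> \<B>" for B using topological_basis_open[OF \<B>(2) that] .
  define \<F> where "\<F> = {B \<in> \<B>. emeasure \<mu> B < \<infinity>}"
  \<comment> \<open>The sets on which the squared norm is at least 1 / (n + 1), in the shape of
    Markov's inequality.\<close>
  define A where "A = (\<lambda>(B, n). {\<sigma> \<in> unitary_dual. 1 \<le> ennreal (real (Suc n)) * hs_sum (entryK (indicator B) \<sigma>)})"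
  have ind: "integrable \<mu> (indicator B :: 'k \<Rightarrow> complex)" "in_L2 \<mu> (indicator B)"
    "(indicator B :: 'k \<Rightarrow> complex) \<in> borel_measurable \<mu>"
    "(\<integral>\<^sup>+k. ennreal ((cmod (indicator B k))\<^sup>2) \<partial>\<mu>) = emeasure \<mu> B" if "B \<in> \<F>" for B
  proof -
    have B [measurable]: "B \<in> sets \<mu>" "emeasure \<mu> B < \<infinity>" using that op by (auto simp: \<F>_def sets_mu)
    show "integrable \<mu> (indicator B :: 'k \<Rightarrow> complex)"
    proof -
      have "(indicator B :: 'k \<Rightarrow> complex) = (\<lambda>k. complex_of_real (indicat_real B k))"
        by (auto simp: fun_eq_iff indicator_def)
      then show ?thesis
        using integrable_of_real[OF integrable_real_indicator[OF B], where 'a = complex] by simp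
    qed
    show m: "(indicator B :: 'k \<Rightarrow> complex) \<in> borel_measurable \<mu>" by measurable
    have "(\<integral>\<^sup>+k. ennreal ((cmod (indicator B k))\<^sup>2) \<partial>\<mu>) = (\<integral>\<^sup>+k. indicator B k \<partial>\<mu>)"
      by (intro nn_integral_cong) (simp add: indicator_def)
    then show "(\<integral>\<^sup>+k. ennreal ((cmod (indicator B k))\<^sup>2) \<partial>\<mu>) = emeasure \<mu> B" by simp
    then show "in_L2 \<mu> (indicator B)" using m B by (simp add: in_L2_iff_nn_integral)
  qed
  show ?thesis
  proof (rule sigma_finite_measure.intro, intro exI[of _ "A ` (\<F> \<times> UNIV)"] conjI ballI)
    show "countable (A ` (\<F> \<times> UNIV))"
      using \<B>(1) by (auto simp: \<F>_def)
    have As: "A (B, n) \<in> sets \<nu>" if "B \<in> \<F>" for B n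
    proof -
      note [measurable] = ind(3)[OF that]
      have "{\<sigma> \<in> space \<nu>. 1 \<le> ennreal (real (Suc n)) * hs_sum (entryK (indicator B) \<sigma>)} \<in> sets \<nu>" by measurable
      then show ?thesis by (simp add: A_def)
    qed
    then show "A ` (\<F> \<times> UNIV) \<subseteq> sets \<nu>" by auto
    show "emeasure \<nu> S \<noteq> \<infinity>" if S_in: "S \<in> A ` (\<F> \<times> UNIV)" for S
    proof -
      obtain B n where S: "S = A (B, n)" and B: "B \<in> \<F>" using S_in by auto
      note [measurable] = ind(3)[OF B]
      have "emeasure \<nu> S \<le> ennreal (real (Suc n)) * (\<integral>\<^sup>+\<sigma>. hs_sum (entryK (indicator B) \<sigma>) * indicator (space \<nu>) \<sigma> \<partial>\<nu>)"
        unfolding S A_def prod.case space_nu[symmetric]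
        by (rule nn_integral_Markov_inequality) measurable
      also have "(\<integral>\<^sup>+\<sigma>. hs_sum (entryK (indicator B) \<sigma>) * indicator (space \<nu>) \<sigma> \<partial>\<nu>) = (\<integral>\<^sup>+\<sigma>. hs_sum (entryK (indicator B) \<sigma>) \<partial>\<nu>)"
        by (intro nn_integral_cong) (simp add: indicator_def)
      also have "\<dots> = emeasure \<mu> B"
        using plancherel_K[OF ind(1,2)[OF B]] ind(4)[OF B] by simp
      also have "ennreal (real (Suc n)) * emeasure \<mu> B < \<infinity>"
        using B by (simp add: \<F>_def ennreal_mult_less_top)
      finally show ?thesis by simp
    qed
    show "\<Union> (A ` (\<F> \<times> UNIV)) = space \<nu>"
    proof
      show "space \<nu> \<subseteq> \<Union> (A ` (\<F> \<times> UNIV))"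
      proof
        fix \<sigma> assume "\<sigma> \<in> space \<nu>"
        then have \<sigma>: "\<sigma> \<in> unitary_dual" by simp
        have "\<forall>x::'k. \<exists>U D. open U \<and> compact D \<and> x \<in> U \<and> U \<subseteq> D"
          using loc_compact by (simp add: locally_compact_space_def)
        from spec[OF this, of 0]
        obtain U D :: "'k set" where U: "open U" "0 \<in> U" "U \<subseteq> D" "compact D" by blast
        let ?c = "entry \<sigma> 0 0"
        have c0: "?c 0 = 1"
          using irrep_basis_vec_0[OF rep_irreps[OF \<sigma>]] irrep_zero[OF rep_irreps[OF \<sigma>], of "basis_vec 0"]
          by (simp add: entry_def rep_coeff_def basis_vec_def)
        have cont: "continuous_on UNIV (\<lambda>k. Re (?c k))"
          using continuous_entry[OF \<sigma>] by (intro continuous_intros)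
        \<comment> \<open>The entry is 1 at the identity. On a neighbourhood where its real part
          exceeds 1/2 no cancellation can make the integral over \<open>B\<close> vanish.\<close>
        have "open {k. Re (?c k) > 1 / 2}"
          by (rule open_Collect_less[OF continuous_on_const cont])
        then have "open (U \<inter> {k. Re (?c k) > 1 / 2})" using U by auto
        then obtain B where B: "B \<in> \<B>" "0 \<in> B" "B \<subseteq> U \<inter> {k. Re (?c k) > 1 / 2}"
          using topological_basisE[OF \<B>(2), of "U \<inter> {k. Re (?c k) > 1 / 2}" 0] U c0 by auto
        have "emeasure \<mu> B \<le> emeasure \<mu> D"
          by (rule emeasure_mono) (use B U in \<open>auto simp: sets_mu borel_compact\<close>)
        also have "\<dots> < \<infinity>" using haar_mu U by (simp add: left_haar_measure_def radon_measure_def)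
        finally have fin: "emeasure \<mu> B < \<infinity>" .
        with B have BF: "B \<in> \<F>" by (simp add: \<F>_def)
        have Bm: "B \<in> sets \<mu>" using op[OF B(1)] by (simp add: sets_mu)
        have "emeasure \<mu> B \<noteq> 0" using left_haar_open_pos[OF haar_mu op[OF B(1)] B(2)] .
        then have pos: "measure \<mu> B > 0"
          using fin by (simp add: measure_def enn2real_positive_iff zero_less_iff_neq_zero)
        note [measurable] = entry_measurable1[OF \<sigma>] ind(3)[OF BF]
        have int: "integrable \<mu> (\<lambda>k. indicator B k * ?c k)"
          by (rule Bochner_Integration.integrable_bound[OF ind(1)[OF BF]])
             (use \<sigma> in \<open>auto simp: norm_mult intro!: mult_left_le entry_norm_le\<close>)
        have ii: "integrable \<mu> (\<lambda>k. indicator B k :: real)" using fin Bm by simp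
        have "measure \<mu> B / 2 = (\<integral>k. indicator B k * (1 / 2) \<partial>\<mu>)" using Bm by simp
        also have "\<dots> \<le> (\<integral>k. Re (indicator B k * ?c k) \<partial>\<mu>)"
        proof (rule integral_mono)
          show "integrable \<mu> (\<lambda>k. indicator B k * (1 / 2) :: real)" using ii by simp
          show "indicator B k * (1 / 2) \<le> Re (indicator B k * ?c k)" for k
            using B(3) by (auto simp: indicator_def less_imp_le)
        qed (rule integrable_Re[OF int])
        also have "\<dots> = Re (entryK (indicator B) \<sigma> 0 0)"
          unfolding entryK_def by (rule integral_Re[OF int])
        finally have "Re (entryK (indicator B) \<sigma> 0 0) > 0" using pos by simp
        then have "entryK (indicator B) \<sigma> 0 0 \<noteq> 0" by auto
        then have ne: "hs_sum (entryK (indicator B) \<sigma>) \<noteq> 0"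
          using hs_sum_ge[of "entryK (indicator B) \<sigma>" 0 0] by auto
        have "\<exists>n. 1 \<le> ennreal (real (Suc n)) * hs_sum (entryK (indicator B) \<sigma>)"
        proof (cases "hs_sum (entryK (indicator B) \<sigma>)" rule: ennreal_cases)
          case (real r)
          then have "r > 0" using ne by (auto simp: less_le)
          then obtain n where "inverse (real (Suc n)) < r" using reals_Archimedean by blast
          then have "1 \<le> real (Suc n) * r"
            using \<open>r > 0\<close> by (simp add: field_simps)
          then show ?thesis using real \<open>r > 0\<close>
            by (intro exI[of _ n]) (simp flip: ennreal_mult ennreal_1 add: ennreal_leI del: of_nat_Suc)
        next
          case top
          then show ?thesis by (intro exI[of _ 0]) simp
        qed
        then obtain n where "\<sigma> \<in> A (B, n)" using \<sigma> by (auto simp: A_def)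
        then show "\<sigma> \<in> \<Union> (A ` (\<F> \<times> UNIV))" using BF by blast
      qed
    qed (auto simp: A_def)
  qed
qed


section \<open>The transform of integrable functions on R^n x K\<close>

lemma pair_mu: "pair_sigma_finite (lborel :: 'a::euclidean_space measure) \<mu>"
  by (intro pair_sigma_finite.intro sigma_finite_lborel mu.sigma_finite_measure_axioms)

text \<open>A single integral over the product measure can be iterated in either order: with the
  integral over R^n inside it is the transform on K of \<open>xfourier\<close>, with the integral
  over K inside it is an entry of \<open>fourier_G\<close>.\<close>

definition entryG :: "('a::euclidean_space \<times> 'k \<Rightarrow> complex) \<Rightarrow> 'a \<Rightarrow> 'k urep set \<Rightarrow> nat \<Rightarrow> nat \<Rightarrow> complex" where
  "entryG h y \<sigma> j i = (\<integral>z. h z * echar (fst z \<bullet> y) * entry \<sigma> j i (snd z) \<partial>(lborel \<Otimes>\<^sub>M \<mu>))"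

definition xfourier :: "('a::euclidean_space \<times> 'k \<Rightarrow> complex) \<Rightarrow> 'a \<Rightarrow> 'k \<Rightarrow> complex" where
  "xfourier h y k = fourier_R (\<lambda>x. h (x, k)) y"

lemma entryG_measurable:
  fixes h :: "'a::euclidean_space \<times> 'k \<Rightarrow> complex"
  assumes [measurable]: "h \<in> borel_measurable (lborel \<Otimes>\<^sub>M \<mu>)"
  shows "(\<lambda>(y, \<sigma>). entryG h y \<sigma> j i) \<in> borel_measurable (lborel \<Otimes>\<^sub>M \<nu>)"
proof -
  interpret P: pair_sigma_finite "lborel :: 'a measure" \<mu> by (rule pair_mu)
  interpret sigma_finite_measure "(lborel :: 'a measure) \<Otimes>\<^sub>M \<mu>"
    by (intro sigma_finite_pair_measure sigma_finite_lborel mu.sigma_finite_measure_axioms)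
  show ?thesis unfolding entryG_def case_prod_beta by measurable
qed

lemma entryG_measurable' [measurable (raw)]:
  fixes h :: "'a::euclidean_space \<times> 'k \<Rightarrow> complex"
  assumes "h \<in> borel_measurable (lborel \<Otimes>\<^sub>M \<mu>)" "f \<in> M \<rightarrow>\<^sub>M borel" "g \<in> M \<rightarrow>\<^sub>M \<nu>"
  shows "(\<lambda>x. entryG h (f x) (g x) j i) \<in> borel_measurable M"
proof -
  have "(\<lambda>x. (f x, g x)) \<in> M \<rightarrow>\<^sub>M lborel \<Otimes>\<^sub>M \<nu>" using assms(2,3) by measurable
  from measurable_compose[OF this entryG_measurable[OF assms(1)]] show ?thesis by simp
qed

lemma xfourier_measurable:
  fixes h :: "'a::euclidean_space \<times> 'k \<Rightarrow> complex"
  assumes [measurable]: "h \<in> borel_measurable (lborel \<Otimes>\<^sub>M \<mu>)"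
  shows "(\<lambda>(y, k). xfourier h y k) \<in> borel_measurable (lborel \<Otimes>\<^sub>M \<mu>)"
  unfolding xfourier_def fourier_R_def case_prod_beta by measurable

context
  fixes h :: "'a::euclidean_space \<times> 'k \<Rightarrow> complex"
  assumes h: "integrable (lborel \<Otimes>\<^sub>M \<mu>) h"
begin

lemma h_meas [measurable]: "h \<in> borel_measurable (lborel \<Otimes>\<^sub>M \<mu>)"
  using h by auto

lemma xfourier_integrable: "integrable \<mu> (xfourier h y)"
proof -
  interpret P: pair_sigma_finite "lborel :: 'a measure" \<mu> by (rule pair_mu)
  have "integrable (lborel \<Otimes>\<^sub>M \<mu>) (\<lambda>z. h z * echar (fst z \<bullet> y))"
    using h by (intro integrable_mult_echar) measurable
  then have "integrable (lborel \<Otimes>\<^sub>M \<mu>) (\<lambda>(x, k). h (x, k) * echar (x \<bullet> y))"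
    by (simp add: case_prod_beta')
  from P.integrable_snd[OF this] show ?thesis
    by (simp add: xfourier_def[abs_def] fourier_R_def)
qed

lemma entryG_integrand:
  assumes \<sigma>: "\<sigma> \<in> unitary_dual"
  shows "integrable (lborel \<Otimes>\<^sub>M \<mu>) (\<lambda>z. h z * echar (fst z \<bullet> y) * entry \<sigma> j i (snd z))"
proof (rule Bochner_Integration.integrable_bound[OF h])
  note [measurable] = entry_measurable1[OF \<sigma>]
  show "(\<lambda>z. h z * echar (fst z \<bullet> y) * entry \<sigma> j i (snd z)) \<in> borel_measurable (lborel \<Otimes>\<^sub>M \<mu>)"
    by measurable
qed (auto simp: norm_mult intro!: mult_left_le entry_norm_le \<sigma>)

lemma entryG_eq_entryK:
  assumes \<sigma>: "\<sigma> \<in> unitary_dual"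
  shows "entryG h y \<sigma> j i = entryK (xfourier h y) \<sigma> j i"
proof -
  interpret P: pair_sigma_finite "lborel :: 'a measure" \<mu> by (rule pair_mu)
  have "integrable (lborel \<Otimes>\<^sub>M \<mu>) (\<lambda>(x, k). h (x, k) * echar (x \<bullet> y) * entry \<sigma> j i k)"
    using entryG_integrand[OF \<sigma>, of y j i] by (simp add: case_prod_beta')
  from P.integral_snd[OF this] show ?thesis
    by (simp add: entryG_def entryK_def xfourier_def fourier_R_def case_prod_beta')
qed

lemma entryG_ell2:
  assumes "\<sigma> \<in> unitary_dual"
  shows "entryG h y \<sigma> j \<in> ell2"
proof -
  have "entryG h y \<sigma> j = entryK (xfourier h y) \<sigma> j" by (rule ext) (rule entryG_eq_entryK[OF assms])
  then show ?thesis using entryK_ell2[OF xfourier_integrable assms] by simp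
qed

text \<open>Plancherel on K is applied to the partial transform \<open>xfourier h y\<close> at fixed
  \<open>y\<close>. That function is integrable for every \<open>y\<close>, but square integrable
  only for almost every \<open>y\<close>; the latter follows from the finiteness of the double
  integral, which Plancherel on R^n evaluates for almost every \<open>k\<close>.\<close>

theorem plancherel_G:
  assumes h2: "in_L2 (lborel \<Otimes>\<^sub>M \<mu>) h"
  shows "(\<integral>\<^sup>+y. (\<integral>\<^sup>+\<sigma>. hs_sum (entryG h y \<sigma>) \<partial>\<nu>) \<partial>lborel) = (\<integral>\<^sup>+z. ennreal ((cmod (h z))\<^sup>2) \<partial>(lborel \<Otimes>\<^sub>M \<mu>))"
proof -
  interpret P: pair_sigma_finite "lborel :: 'a measure" \<mu> by (rule pair_mu)
  note [measurable] = xfourier_measurable[OF h_meas]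
  have xm: "(\<lambda>(y, k). ennreal ((cmod (xfourier h y k))\<^sup>2)) \<in> borel_measurable (lborel \<Otimes>\<^sub>M \<mu>)"
    by measurable
  have i1: "integrable (lborel \<Otimes>\<^sub>M \<mu>) (\<lambda>(x, k). h (x, k))" using h by simp
  have i2: "integrable (lborel \<Otimes>\<^sub>M \<mu>) (\<lambda>(x, k). (cmod (h (x, k)))\<^sup>2)"
    using h2 by (simp add: in_L2_def case_prod_beta')
  have "(\<integral>\<^sup>+y. (\<integral>\<^sup>+k. ennreal ((cmod (xfourier h y k))\<^sup>2) \<partial>\<mu>) \<partial>lborel) =
     (\<integral>\<^sup>+k. (\<integral>\<^sup>+y. ennreal ((cmod (xfourier h y k))\<^sup>2) \<partial>lborel) \<partial>\<mu>)"
    using P.Fubini'[OF xm] by simp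
  also have "\<dots> = (\<integral>\<^sup>+k. (\<integral>\<^sup>+x. ennreal ((cmod (h (x, k)))\<^sup>2) \<partial>lborel) \<partial>\<mu>)"
    using P.AE_integrable_snd[OF i1] P.AE_integrable_snd[OF i2]
    by (intro nn_integral_cong_AE, eventually_elim) (simp add: xfourier_def plancherel_R)
  also have "\<dots> = (\<integral>\<^sup>+z. ennreal ((cmod (h z))\<^sup>2) \<partial>(lborel \<Otimes>\<^sub>M \<mu>))"
    using P.nn_integral_snd[of "\<lambda>z. ennreal ((cmod (h z))\<^sup>2)"] by simp
  finally have eq: "(\<integral>\<^sup>+y. (\<integral>\<^sup>+k. ennreal ((cmod (xfourier h y k))\<^sup>2) \<partial>\<mu>) \<partial>lborel) =
     (\<integral>\<^sup>+z. ennreal ((cmod (h z))\<^sup>2) \<partial>(lborel \<Otimes>\<^sub>M \<mu>))" .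
  also have "\<dots> < \<infinity>" using h2 by (simp add: in_L2_iff_nn_integral)
  finally have fin: "(\<integral>\<^sup>+y. (\<integral>\<^sup>+k. ennreal ((cmod (xfourier h y k))\<^sup>2) \<partial>\<mu>) \<partial>lborel) \<noteq> \<infinity>" by simp
  have ym: "(\<lambda>y. \<integral>\<^sup>+k. ennreal ((cmod (xfourier h y k))\<^sup>2) \<partial>\<mu>) \<in> borel_measurable lborel"
    using xm by (intro mu.borel_measurable_nn_integral) simp
  have "AE y in lborel. (\<integral>\<^sup>+\<sigma>. hs_sum (entryG h y \<sigma>) \<partial>\<nu>) = (\<integral>\<^sup>+k. ennreal ((cmod (xfourier h y k))\<^sup>2) \<partial>\<mu>)"
    using nn_integral_PInf_AE[OF ym fin]
  proof eventually_elim
    case (elim y)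
    then have "in_L2 \<mu> (xfourier h y)"
      using xfourier_integrable[of y] by (auto simp: in_L2_iff_nn_integral less_top)
    from plancherel_K[OF xfourier_integrable this] show ?case
      by (subst nn_integral_cong[where v = "\<lambda>\<sigma>. hs_sum (entryK (xfourier h y) \<sigma>)"])
         (auto intro!: arg_cong[where f = hs_sum] simp: entryG_eq_entryK fun_eq_iff)
  qed
  then have "(\<integral>\<^sup>+y. (\<integral>\<^sup>+\<sigma>. hs_sum (entryG h y \<sigma>) \<partial>\<nu>) \<partial>lborel) =
      (\<integral>\<^sup>+y. (\<integral>\<^sup>+k. ennreal ((cmod (xfourier h y k))\<^sup>2) \<partial>\<mu>) \<partial>lborel)"
    by (rule nn_integral_cong_AE)
  then show ?thesis using eq by simp
qed

end

lemma fourier_G_eq_entryG: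
  fixes h :: "(real^'n::finite) \<times> 'k \<Rightarrow> complex"
  assumes h: "integrable (lborel \<Otimes>\<^sub>M \<mu>) h" and \<sigma>: "\<sigma> \<in> unitary_dual"
    and j: "basis_vec j \<in> fst (rep \<sigma>)"
  shows "fourier_G \<mu> h y (snd (rep \<sigma>)) (basis_vec j) i = entryG h y \<sigma> j i"
proof -
  interpret P: pair_sigma_finite "lborel :: (real^'n) measure" \<mu> by (rule pair_mu)
  have "integrable (lborel \<Otimes>\<^sub>M \<mu>) (\<lambda>(x, k). h (x, k) * echar (x \<bullet> y) * entry \<sigma> j i k)"
    using entryG_integrand[OF h \<sigma>, of y j i] by (simp add: case_prod_beta')
  from P.integral_fst[OF this] show ?thesis
    using j by (simp add: entryG_def fourier_G_def entry_def rep_coeff_def echar_def case_prod_beta')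
qed

section \<open>Matrix entries of a given operator field\<close>

definition op_entry :: "('a \<Rightarrow> 'k urep set \<Rightarrow> hop) \<Rightarrow> 'a \<Rightarrow> 'k urep set \<Rightarrow> nat \<Rightarrow> nat \<Rightarrow> complex" where
  "op_entry F y \<sigma> j i = (if basis_vec j \<in> fst (rep \<sigma>) then F y \<sigma> (basis_vec j) i else 0)"

context
  fixes F :: "real^'n::finite \<Rightarrow> 'k urep set \<Rightarrow> hop"
  assumes F: "measurable_op_field rep \<nu> F"
begin

lemma F_in_ell2:
  assumes "\<sigma> \<in> unitary_dual" "basis_vec j \<in> fst (rep \<sigma>)"
  shows "F y \<sigma> (basis_vec j) \<in> ell2"
proof -
  have "bounded_op (fst (rep \<sigma>)) (fst (rep \<sigma>)) (F y \<sigma>)"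
    using F assms(1) by (simp add: measurable_op_field_def)
  then have "F y \<sigma> (basis_vec j) \<in> fst (rep \<sigma>)"
    using assms(2) by (simp add: bounded_op_def linear_op_def)
  then show ?thesis using irrep_subset_ell2[OF rep_irreps[OF assms(1)]] by blast
qed

lemma op_entry_measurable: "(\<lambda>(y, \<sigma>). op_entry F y \<sigma> j i) \<in> borel_measurable (lborel \<Otimes>\<^sub>M \<nu>)"
  using F by (simp add: measurable_op_field_def op_entry_def)

lemma op_entry_measurable' [measurable (raw)]:
  assumes "f \<in> M \<rightarrow>\<^sub>M borel" "g \<in> M \<rightarrow>\<^sub>M \<nu>"
  shows "(\<lambda>x. op_entry F (f x) (g x) j i) \<in> borel_measurable M"
proof -
  have "(\<lambda>x. (f x, g x)) \<in> M \<rightarrow>\<^sub>M lborel \<Otimes>\<^sub>M \<nu>" using assms by measurable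
  from measurable_compose[OF this op_entry_measurable] show ?thesis by simp
qed

lemma hs_norm_sq_F:
  "\<sigma> \<in> unitary_dual \<Longrightarrow> hs_norm_sq (fst (rep \<sigma>)) (F y \<sigma>) = hs_sum (op_entry F y \<sigma>)"
  by (subst hs_norm_sq_eq_hs_sum) (simp_all add: F_in_ell2 op_entry_def[abs_def])

lemma hs_norm_sq_diff:
  assumes h: "integrable (lborel \<Otimes>\<^sub>M \<mu>) h" and \<sigma>: "\<sigma> \<in> unitary_dual"
  shows "hs_norm_sq (fst (rep \<sigma>)) (\<lambda>v i. fourier_G \<mu> h y (snd (rep \<sigma>)) v i - F y \<sigma> v i) =
    hs_sum (\<lambda>j i. entryG h y \<sigma> j i - op_entry F y \<sigma> j i)"
proof (subst hs_norm_sq_eq_hs_sum)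
  fix j assume j: "basis_vec j \<in> fst (rep \<sigma>)"
  show "(\<lambda>i. fourier_G \<mu> h y (snd (rep \<sigma>)) (basis_vec j) i - F y \<sigma> (basis_vec j) i) \<in> ell2"
    unfolding fourier_G_eq_entryG[OF h \<sigma> j]
    by (rule ell2_diff[OF entryG_ell2[OF h \<sigma>] F_in_ell2[OF \<sigma> j]])
next
  have "entryG h y \<sigma> j i = 0" if "basis_vec j \<notin> fst (rep \<sigma>)" for j i
    using that by (simp add: entryG_def entry_def rep_coeff_def)
  then show "hs_sum (\<lambda>j i. if basis_vec j \<in> fst (rep \<sigma>)
      then fourier_G \<mu> h y (snd (rep \<sigma>)) (basis_vec j) i - F y \<sigma> (basis_vec j) i else 0) =
    hs_sum (\<lambda>j i. entryG h y \<sigma> j i - op_entry F y \<sigma> j i)"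
    by (intro hs_sum_cong_norm) (simp add: op_entry_def fourier_G_eq_entryG[OF h \<sigma>])
qed

end

end

section \<open>Translations and passage to the limit\<close>

text \<open>This is the shape left by two uses of the weighted triangle inequality for squares, one
  for the error on the group and one for the error on the dual. At fixed \<open>e\<close> the limit
  in \<open>m\<close> removes both errors, however large \<open>K e\<close> may be; only then does
  \<open>e\<close> tend to 0.\<close>

lemma ennreal_le_of_perturbations:
  fixes X Y :: ennreal
  assumes le: "\<And>e m. e > 0 \<Longrightarrow> X \<le> ennreal (1 + e) * (ennreal (1 + e) * Y + ennreal (K e) * \<delta> m) + ennreal (K e) * \<eta> m"
    and lim: "\<delta> \<longlonglongrightarrow> 0" "\<eta> \<longlonglongrightarrow> 0"
  shows "X \<le> Y"
proof -
  have le2: "X \<le> ennreal (1 + e) * (ennreal (1 + e) * Y)" if "e > 0" for e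
  proof -
    have "(\<lambda>m. ennreal (1 + e) * (ennreal (1 + e) * Y + ennreal (K e) * \<delta> m) + ennreal (K e) * \<eta> m) \<longlonglongrightarrow>
       ennreal (1 + e) * (ennreal (1 + e) * Y + ennreal (K e) * 0) + ennreal (K e) * 0"
      by (intro tendsto_add ennreal_tendsto_cmult lim tendsto_const) auto
    then show ?thesis
      using le[OF that] by (intro LIMSEQ_le_const[of _ _ X]) auto
  qed
  show ?thesis
  proof (cases Y rule: ennreal_cases)
    case (real y)
    define e where "e = (\<lambda>n. inverse (real (Suc n)))"
    have e: "e \<longlonglongrightarrow> 0" unfolding e_def by (rule LIMSEQ_inverse_real_of_nat)
    have "(\<lambda>n. (1 + e n) * ((1 + e n) * y)) \<longlonglongrightarrow> (1 + 0) * ((1 + 0) * y)"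
      by (intro tendsto_intros e)
    then have "(\<lambda>n. ennreal ((1 + e n) * ((1 + e n) * y))) \<longlonglongrightarrow> ennreal y"
      by (auto intro: tendsto_ennrealI)
    moreover have "X \<le> ennreal ((1 + e n) * ((1 + e n) * y))" for n
      using le2[of "e n"] real by (simp add: e_def ennreal_mult)
    ultimately show ?thesis unfolding real by (intro LIMSEQ_le_const) auto
  qed auto
qed

section \<open>Translations on R^n x K\<close>

context plancherel_setup
begin

definition norm_sq :: "('a::euclidean_space \<times> 'k \<Rightarrow> complex) \<Rightarrow> ennreal" where
  "norm_sq g = (\<integral>\<^sup>+z. ennreal ((cmod (g z))\<^sup>2) \<partial>(lborel \<Otimes>\<^sub>M \<mu>))"

lemma nn_integral_shift_pair:
  fixes G :: "'a::euclidean_space \<times> 'k \<Rightarrow> ennreal"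
  assumes [measurable]: "G \<in> borel_measurable (lborel \<Otimes>\<^sub>M \<mu>)"
  shows "(\<integral>\<^sup>+z. G (fst z + u, snd z) \<partial>(lborel \<Otimes>\<^sub>M \<mu>)) = (\<integral>\<^sup>+z. G z \<partial>(lborel \<Otimes>\<^sub>M \<mu>))"
proof -
  interpret P: pair_sigma_finite "lborel :: 'a measure" \<mu> by (rule pair_mu)
  have "(\<integral>\<^sup>+z. G (fst z + u, snd z) \<partial>(lborel \<Otimes>\<^sub>M \<mu>)) = (\<integral>\<^sup>+k. (\<integral>\<^sup>+x. G (x + u, k) \<partial>lborel) \<partial>\<mu>)"
    by (subst P.nn_integral_snd[symmetric]) simp_all
  also have "\<dots> = (\<integral>\<^sup>+k. (\<integral>\<^sup>+x. G (x, k) \<partial>lborel) \<partial>\<mu>)"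
    by (intro nn_integral_cong nn_integral_lborel_shift) simp
  also have "\<dots> = (\<integral>\<^sup>+z. G z \<partial>(lborel \<Otimes>\<^sub>M \<mu>))"
    by (rule P.nn_integral_snd) simp
  finally show ?thesis .
qed

lemma distr_shift_pair:
  "distr ((lborel :: 'a::euclidean_space measure) \<Otimes>\<^sub>M \<mu>) (lborel \<Otimes>\<^sub>M \<mu>) (\<lambda>z. (fst z + u, snd z)) = lborel \<Otimes>\<^sub>M \<mu>"
proof (rule measure_eqI)
  fix A assume "A \<in> sets (distr ((lborel :: 'a measure) \<Otimes>\<^sub>M \<mu>) (lborel \<Otimes>\<^sub>M \<mu>) (\<lambda>z. (fst z + u, snd z)))"
  then have A [measurable]: "A \<in> sets ((lborel :: 'a measure) \<Otimes>\<^sub>M \<mu>)" by simp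
  let ?D = "distr ((lborel :: 'a measure) \<Otimes>\<^sub>M \<mu>) (lborel \<Otimes>\<^sub>M \<mu>) (\<lambda>z. (fst z + u, snd z))"
  have "emeasure ?D A = (\<integral>\<^sup>+z. indicator A z \<partial>?D)"
    by (subst nn_integral_indicator) (use A in simp_all)
  also have "\<dots> = (\<integral>\<^sup>+z. indicator A (fst z + u, snd z) \<partial>((lborel :: 'a measure) \<Otimes>\<^sub>M \<mu>))"
    by (subst nn_integral_distr) auto
  also have "\<dots> = emeasure (lborel \<Otimes>\<^sub>M \<mu>) A"
    by (subst nn_integral_shift_pair) (use A in simp_all)
  finally show "emeasure ?D A = emeasure (lborel \<Otimes>\<^sub>M \<mu>) A" .
qed simp

lemma integrable_shift_pair:
  fixes G :: "'a::euclidean_space \<times> 'k \<Rightarrow> 'b::{banach, second_countable_topology}"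
  assumes G: "integrable (lborel \<Otimes>\<^sub>M \<mu>) G"
  shows "integrable (lborel \<Otimes>\<^sub>M \<mu>) (\<lambda>z. G (fst z + u, snd z))"
proof -
  have "(\<lambda>z. (fst z + u, snd z)) \<in> (lborel :: 'a measure) \<Otimes>\<^sub>M \<mu> \<rightarrow>\<^sub>M lborel \<Otimes>\<^sub>M \<mu>" by measurable
  from integrable_distr[OF this, of G] G show ?thesis by (simp add: distr_shift_pair)
qed

lemma integral_shift_pair:
  fixes G :: "'a::euclidean_space \<times> 'k \<Rightarrow> 'b::{banach, second_countable_topology}"
  assumes [measurable]: "G \<in> borel_measurable (lborel \<Otimes>\<^sub>M \<mu>)"
  shows "(\<integral>z. G (fst z + u, snd z) \<partial>(lborel \<Otimes>\<^sub>M \<mu>)) = (\<integral>z. G z \<partial>(lborel \<Otimes>\<^sub>M \<mu>))"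
proof -
  have "(\<lambda>z. (fst z + u, snd z)) \<in> (lborel :: 'a measure) \<Otimes>\<^sub>M \<mu> \<rightarrow>\<^sub>M lborel \<Otimes>\<^sub>M \<mu>" by measurable
  from integral_distr[OF this, of G] show ?thesis by (simp add: distr_shift_pair)
qed

lemma norm_sq_add_le:
  fixes g h :: "'a::euclidean_space \<times> 'k \<Rightarrow> complex"
  assumes [measurable]: "g \<in> borel_measurable (lborel \<Otimes>\<^sub>M \<mu>)" "h \<in> borel_measurable (lborel \<Otimes>\<^sub>M \<mu>)"
    and "e > 0"
  shows "norm_sq (\<lambda>z. g z + h z) \<le> ennreal (1 + e) * norm_sq g + ennreal (1 + 1 / e) * norm_sq h"
proof -
  have "norm_sq (\<lambda>z. g z + h z) \<le> (\<integral>\<^sup>+z. ennreal (1 + e) * ennreal ((cmod (g z))\<^sup>2) +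
      ennreal (1 + 1 / e) * ennreal ((cmod (h z))\<^sup>2) \<partial>(lborel \<Otimes>\<^sub>M \<mu>))"
    unfolding norm_sq_def by (intro nn_integral_mono ennreal_norm_add_power2_le assms)
  also have "\<dots> = ennreal (1 + e) * norm_sq g + ennreal (1 + 1 / e) * norm_sq h"
    unfolding norm_sq_def by (simp add: nn_integral_add nn_integral_cmult)
  finally show ?thesis .
qed

text \<open>
  The translate minus c times the function: c = 1 gives the difference used for the
  uncertainty inequality, while u = 0, c = 0 gives the function itself, so that
  both are treated at once.
\<close>

definition shift_diff :: "'a::euclidean_space \<Rightarrow> complex \<Rightarrow> ('a \<times> 'k \<Rightarrow> complex) \<Rightarrow> 'a \<times> 'k \<Rightarrow> complex" where
  "shift_diff u c g z = g (fst z + u, snd z) - c * g z"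

lemma shift_diff_measurable [measurable (raw)]:
  assumes [measurable]: "g \<in> borel_measurable (lborel \<Otimes>\<^sub>M \<mu>)"
  shows "shift_diff u c g \<in> borel_measurable (lborel \<Otimes>\<^sub>M \<mu>)"
  unfolding shift_diff_def[abs_def] by measurable

lemma shift_diff_integrable:
  assumes "integrable (lborel \<Otimes>\<^sub>M \<mu>) g"
  shows "integrable (lborel \<Otimes>\<^sub>M \<mu>) (shift_diff u c g)"
  unfolding shift_diff_def[abs_def] using integrable_shift_pair[OF assms, of u] assms by simp

text \<open>The constant is 2 + 2 from the weighted triangle inequality at \<open>e = 1\<close>. It
  is only applied to error terms, where uniformity in \<open>u\<close> matters and sharpness does
  not.\<close>

lemma norm_sq_shift_diff_le:
  fixes g :: "'a::euclidean_space \<times> 'k \<Rightarrow> complex"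
  assumes [measurable]: "g \<in> borel_measurable (lborel \<Otimes>\<^sub>M \<mu>)" and c: "cmod c \<le> 1"
  shows "norm_sq (shift_diff u c g) \<le> 4 * norm_sq g"
proof -
  have "norm_sq (shift_diff u c g) = norm_sq (\<lambda>z. g (fst z + u, snd z) + - c * g z)"
    by (simp add: shift_diff_def[abs_def])
  also have "\<dots> \<le> ennreal (1 + 1) * norm_sq (\<lambda>z. g (fst z + u, snd z)) + ennreal (1 + 1 / 1) * norm_sq (\<lambda>z. - c * g z)"
    by (rule norm_sq_add_le) auto
  also have "norm_sq (\<lambda>z. g (fst z + u, snd z)) = norm_sq g"
    unfolding norm_sq_def by (rule nn_integral_shift_pair) measurable
  also have "norm_sq (\<lambda>z. - c * g z) \<le> norm_sq g"
    unfolding norm_sq_def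
    by (intro nn_integral_mono ennreal_leI power_mono) (auto simp: norm_mult intro!: mult_left_le_one_le c)
  finally show ?thesis
    by (simp add: mult_left_mono add_left_mono flip: distrib_right)
qed

lemma in_L2_shift_diff:
  assumes g: "in_L2 (lborel \<Otimes>\<^sub>M \<mu>) g" and c: "cmod c \<le> 1"
  shows "in_L2 (lborel \<Otimes>\<^sub>M \<mu>) (shift_diff u c g)"
proof -
  have m [measurable]: "g \<in> borel_measurable (lborel \<Otimes>\<^sub>M \<mu>)" and fin: "norm_sq g < \<infinity>"
    using g by (auto simp: in_L2_iff_nn_integral norm_sq_def)
  have "norm_sq (shift_diff u c g) \<le> 4 * norm_sq g" by (rule norm_sq_shift_diff_le[OF m c])
  also have "\<dots> < \<infinity>" using fin by (simp add: ennreal_mult_less_top)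
  finally show ?thesis using shift_diff_measurable[OF m] by (simp add: in_L2_iff_nn_integral norm_sq_def)
qed

text \<open>Translation in the Euclidean variable alone acts on the transform by a scalar, with no
  interference from the operator part, so every matrix entry gets the same factor.\<close>

lemma entryG_shift_diff:
  fixes g :: "'a::euclidean_space \<times> 'k \<Rightarrow> complex"
  assumes g: "integrable (lborel \<Otimes>\<^sub>M \<mu>) g" and \<sigma>: "\<sigma> \<in> unitary_dual"
  shows "entryG (shift_diff u c g) y \<sigma> j i = (echar (- (u \<bullet> y)) - c) * entryG g y \<sigma> j i"
proof -
  let ?G = "\<lambda>z. g z * echar (fst z \<bullet> y) * entry \<sigma> j i (snd z)"
  have i1: "integrable (lborel \<Otimes>\<^sub>M \<mu>) ?G" by (rule entryG_integrand[OF g \<sigma>])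
  have i2: "integrable (lborel \<Otimes>\<^sub>M \<mu>) (\<lambda>z. ?G (fst z + u, snd z))"
    by (rule integrable_shift_pair[OF i1])
  have "echar (fst z \<bullet> y) = echar (- (u \<bullet> y)) * echar ((fst z + u) \<bullet> y)" for z :: "'a \<times> 'k"
    by (simp add: inner_add_left flip: echar_add)
  then have "shift_diff u c g z * echar (fst z \<bullet> y) * entry \<sigma> j i (snd z) =
      echar (- (u \<bullet> y)) * ?G (fst z + u, snd z) - c * ?G z" for z
    by (simp add: shift_diff_def algebra_simps)
  then have "entryG (shift_diff u c g) y \<sigma> j i = (\<integral>z. echar (- (u \<bullet> y)) * ?G (fst z + u, snd z) - c * ?G z \<partial>(lborel \<Otimes>\<^sub>M \<mu>))"
    unfolding entryG_def by (simp only:)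
  also have "\<dots> = echar (- (u \<bullet> y)) * (\<integral>z. ?G (fst z + u, snd z) \<partial>(lborel \<Otimes>\<^sub>M \<mu>)) - c * entryG g y \<sigma> j i"
    unfolding entryG_def using i1 i2
    by (subst Bochner_Integration.integral_diff) (simp_all only: integrable_mult_right integral_mult_right_zero)
  also have "(\<integral>z. ?G (fst z + u, snd z) \<partial>(lborel \<Otimes>\<^sub>M \<mu>)) = entryG g y \<sigma> j i"
    unfolding entryG_def by (rule integral_shift_pair[OF borel_measurable_integrable[OF i1]])
  finally show ?thesis by (simp add: algebra_simps)
qed

section \<open>Multipliers and weighted norms on the dual\<close>

text \<open>The squared modulus of the scalar by which \<open>shift_diff u c\<close> acts on the
  transform side.\<close>

definition mult_weight :: "'a::euclidean_space \<Rightarrow> complex \<Rightarrow> 'a \<Rightarrow> ennreal" where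
  "mult_weight u c y = ennreal ((cmod (echar (- (u \<bullet> y)) - c))\<^sup>2)"

lemma mult_weight_measurable [measurable]: "mult_weight u c \<in> borel_measurable borel"
  unfolding mult_weight_def[abs_def] by measurable

lemma mult_weight_le:
  assumes "cmod c \<le> 1"
  shows "mult_weight u c y \<le> 4"
proof -
  have "cmod (echar (- (u \<bullet> y)) - c) \<le> 2"
    by (rule order.trans[OF norm_triangle_ineq4]) (use assms in simp)
  then have "(cmod (echar (- (u \<bullet> y)) - c))\<^sup>2 \<le> 2\<^sup>2" by (intro power_mono) auto
  then have "mult_weight u c y \<le> ennreal (2\<^sup>2)" unfolding mult_weight_def by (rule ennreal_leI)
  then show ?thesis by simp
qed

text \<open>One notion covers the Plancherel norm (weight 1), the norm of a translation difference
  (weight \<open>mult_weight\<close>) and the second moments (weights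
  \<open>(y \<bullet> b)\<^sup>2\<close> and \<open>(norm y)\<^sup>2\<close>).\<close>

definition wnorm_sq :: "('a::euclidean_space \<Rightarrow> ennreal) \<Rightarrow> ('a \<Rightarrow> 'k urep set \<Rightarrow> nat \<Rightarrow> nat \<Rightarrow> complex) \<Rightarrow> ennreal" where
  "wnorm_sq w A = (\<integral>\<^sup>+y. w y * (\<integral>\<^sup>+\<sigma>. hs_sum (A y \<sigma>) \<partial>\<nu>) \<partial>lborel)"

text \<open>This is where sigma-finiteness of \<open>\<nu>\<close> enters: it makes the inner
  integral measurable in \<open>y\<close>.\<close>

lemma inner_hs_sum_measurable:
  fixes A :: "'a::euclidean_space \<Rightarrow> 'k urep set \<Rightarrow> nat \<Rightarrow> nat \<Rightarrow> complex"
  assumes [measurable]: "\<And>j i. (\<lambda>(y, \<sigma>). A y \<sigma> j i) \<in> borel_measurable (lborel \<Otimes>\<^sub>M \<nu>)"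
  shows "(\<lambda>y. \<integral>\<^sup>+\<sigma>. hs_sum (A y \<sigma>) \<partial>\<nu>) \<in> borel_measurable borel"
proof -
  interpret N: sigma_finite_measure \<nu> by (rule sigma_finite_nu)
  have "(\<lambda>(y, \<sigma>). hs_sum (A y \<sigma>)) \<in> borel_measurable (lborel \<Otimes>\<^sub>M \<nu>)"
    using borel_measurable_hs_sum[of "\<lambda>p. A (fst p) (snd p)" "lborel \<Otimes>\<^sub>M \<nu>"] assms
    by (simp add: case_prod_beta')
  from N.borel_measurable_nn_integral[OF this] show ?thesis by simp
qed

lemma hs_sum_section_measurable:
  fixes A :: "'a::euclidean_space \<Rightarrow> 'k urep set \<Rightarrow> nat \<Rightarrow> nat \<Rightarrow> complex"
  assumes "\<And>j i. (\<lambda>(y, \<sigma>). A y \<sigma> j i) \<in> borel_measurable (lborel \<Otimes>\<^sub>M \<nu>)"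
  shows "(\<lambda>\<sigma>. hs_sum (A y \<sigma>)) \<in> borel_measurable \<nu>"
proof (rule borel_measurable_hs_sum)
  fix j i
  have "Pair y \<in> \<nu> \<rightarrow>\<^sub>M lborel \<Otimes>\<^sub>M \<nu>" by measurable
  from measurable_compose[OF this assms[of j i]] show "(\<lambda>\<sigma>. A y \<sigma> j i) \<in> borel_measurable \<nu>" by simp
qed

lemma wnorm_sq_add_le:
  fixes A B :: "'a::euclidean_space \<Rightarrow> 'k urep set \<Rightarrow> nat \<Rightarrow> nat \<Rightarrow> complex"
  assumes A: "\<And>j i. (\<lambda>(y, \<sigma>). A y \<sigma> j i) \<in> borel_measurable (lborel \<Otimes>\<^sub>M \<nu>)"
    and B: "\<And>j i. (\<lambda>(y, \<sigma>). B y \<sigma> j i) \<in> borel_measurable (lborel \<Otimes>\<^sub>M \<nu>)"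
    and [measurable]: "w \<in> borel_measurable borel" and "e > 0"
  shows "wnorm_sq w (\<lambda>y \<sigma> j i. A y \<sigma> j i + B y \<sigma> j i) \<le> ennreal (1 + e) * wnorm_sq w A + ennreal (1 + 1 / e) * wnorm_sq w B"
proof -
  note [measurable] = inner_hs_sum_measurable[OF A] inner_hs_sum_measurable[OF B]
    hs_sum_section_measurable[OF A] hs_sum_section_measurable[OF B]
  have "(\<integral>\<^sup>+\<sigma>. hs_sum (\<lambda>j i. A y \<sigma> j i + B y \<sigma> j i) \<partial>\<nu>) \<le>
     ennreal (1 + e) * (\<integral>\<^sup>+\<sigma>. hs_sum (A y \<sigma>) \<partial>\<nu>) + ennreal (1 + 1 / e) * (\<integral>\<^sup>+\<sigma>. hs_sum (B y \<sigma>) \<partial>\<nu>)" for y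
  proof -
    have "(\<integral>\<^sup>+\<sigma>. hs_sum (\<lambda>j i. A y \<sigma> j i + B y \<sigma> j i) \<partial>\<nu>) \<le>
      (\<integral>\<^sup>+\<sigma>. ennreal (1 + e) * hs_sum (A y \<sigma>) + ennreal (1 + 1 / e) * hs_sum (B y \<sigma>) \<partial>\<nu>)"
      by (intro nn_integral_mono hs_sum_add_le assms)
    also have "\<dots> = ennreal (1 + e) * (\<integral>\<^sup>+\<sigma>. hs_sum (A y \<sigma>) \<partial>\<nu>) + ennreal (1 + 1 / e) * (\<integral>\<^sup>+\<sigma>. hs_sum (B y \<sigma>) \<partial>\<nu>)"
      by (simp add: nn_integral_add nn_integral_cmult)
    finally show ?thesis .
  qed
  then have "wnorm_sq w (\<lambda>y \<sigma> j i. A y \<sigma> j i + B y \<sigma> j i) \<le> (\<integral>\<^sup>+y. w y * (ennreal (1 + e) * (\<integral>\<^sup>+\<sigma>. hs_sum (A y \<sigma>) \<partial>\<nu>) +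
      ennreal (1 + 1 / e) * (\<integral>\<^sup>+\<sigma>. hs_sum (B y \<sigma>) \<partial>\<nu>)) \<partial>lborel)"
    unfolding wnorm_sq_def by (intro nn_integral_mono mult_left_mono) auto
  also have "\<dots> = (\<integral>\<^sup>+y. ennreal (1 + e) * (w y * (\<integral>\<^sup>+\<sigma>. hs_sum (A y \<sigma>) \<partial>\<nu>)) +
      ennreal (1 + 1 / e) * (w y * (\<integral>\<^sup>+\<sigma>. hs_sum (B y \<sigma>) \<partial>\<nu>)) \<partial>lborel)"
    by (simp add: distrib_left mult_ac)
  also have "\<dots> = ennreal (1 + e) * wnorm_sq w A + ennreal (1 + 1 / e) * wnorm_sq w B"
    unfolding wnorm_sq_def by (simp add: nn_integral_add nn_integral_cmult)
  finally show ?thesis .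
qed

lemma norm_sq_shift_diff_eq_wnorm_sq:
  fixes h :: "'a::euclidean_space \<times> 'k \<Rightarrow> complex"
  assumes h: "integrable (lborel \<Otimes>\<^sub>M \<mu>) h" "in_L2 (lborel \<Otimes>\<^sub>M \<mu>) h" and c: "cmod c \<le> 1"
  shows "norm_sq (shift_diff u c h) = wnorm_sq (mult_weight u c) (entryG h)"
proof -
  have hm: "h \<in> borel_measurable (lborel \<Otimes>\<^sub>M \<mu>)" using h by auto
  have "norm_sq (shift_diff u c h) = (\<integral>\<^sup>+y. (\<integral>\<^sup>+\<sigma>. hs_sum (entryG (shift_diff u c h) y \<sigma>) \<partial>\<nu>) \<partial>lborel)"
    unfolding norm_sq_def by (rule plancherel_G[OF shift_diff_integrable[OF h(1)] in_L2_shift_diff[OF h(2) c], symmetric])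
  also have "\<dots> = (\<integral>\<^sup>+y. (\<integral>\<^sup>+\<sigma>. mult_weight u c y * hs_sum (entryG h y \<sigma>) \<partial>\<nu>) \<partial>lborel)"
  proof (intro nn_integral_cong)
    fix y :: 'a and \<sigma> assume "\<sigma> \<in> space \<nu>"
    then have "entryG (shift_diff u c h) y \<sigma> = (\<lambda>j i. (echar (- (u \<bullet> y)) - c) * entryG h y \<sigma> j i)"
      by (intro ext entryG_shift_diff h) simp
    then show "hs_sum (entryG (shift_diff u c h) y \<sigma>) = mult_weight u c y * hs_sum (entryG h y \<sigma>)"
      by (simp only: hs_sum_scale mult_weight_def)
  qed
  also have "\<dots> = wnorm_sq (mult_weight u c) (entryG h)"
    unfolding wnorm_sq_def
    by (intro nn_integral_cong nn_integral_cmult hs_sum_section_measurable entryG_measurable hm)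
  finally show ?thesis .
qed

text \<open>Two one-sided estimates are enough. The first transports a bound from the dual to the
  group, the second limits the total mass of \<open>F\<close> for the interpolation between moments.
  In both, \<open>f\<close> is compared with \<open>fs m\<close> on the group, \<open>F\<close> with
  the transform of \<open>fs m\<close> on the dual, and exact Plancherel is used for
  \<open>fs m\<close> only.\<close>

lemma
  fixes f :: "(real^'n::finite) \<times> 'k \<Rightarrow> complex"
  assumes f: "in_L2 (lborel \<Otimes>\<^sub>M \<mu>) f" and F: "is_L2_fourier \<mu> rep \<nu> f F"
  shows norm_sq_shift_diff_le_wnorm_sq: "cmod c \<le> 1 \<Longrightarrow> norm_sq (shift_diff u c f) \<le> wnorm_sq (mult_weight u c) (op_entry F)"
    and wnorm_sq_le_norm_sq: "wnorm_sq (\<lambda>y. 1) (op_entry F) \<le> norm_sq f"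
proof -
  have Fm: "measurable_op_field rep \<nu> F" using F by (simp add: is_L2_fourier_def)
  obtain fs :: "nat \<Rightarrow> (real^'n) \<times> 'k \<Rightarrow> complex" where
    fs: "\<And>m. integrable (lborel \<Otimes>\<^sub>M \<mu>) (fs m)" "\<And>m. in_L2 (lborel \<Otimes>\<^sub>M \<mu>) (fs m)"
    and lim1: "(\<lambda>m. L2_norm (lborel \<Otimes>\<^sub>M \<mu>) (\<lambda>z. fs m z - f z)) \<longlonglongrightarrow> 0"
    and lim2: "(\<lambda>m. \<integral>\<^sup>+y. (\<integral>\<^sup>+\<sigma>. hs_norm_sq (fst (rep \<sigma>))
               (\<lambda>v i. fourier_G \<mu> (fs m) y (snd (rep \<sigma>)) v i - F y \<sigma> v i) \<partial>\<nu>) \<partial>lborel) \<longlonglongrightarrow> 0"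
    using F unfolding is_L2_fourier_def by blast
  have [measurable]: "f \<in> borel_measurable (lborel \<Otimes>\<^sub>M \<mu>)" "\<And>m. fs m \<in> borel_measurable (lborel \<Otimes>\<^sub>M \<mu>)"
    using f fs by (auto simp: in_L2_def)
  define \<eta> where "\<eta> m = norm_sq (\<lambda>z. fs m z - f z)" for m
  define \<delta> where "\<delta> m = wnorm_sq (\<lambda>y. 1) (\<lambda>y \<sigma> j i. entryG (fs m) y \<sigma> j i - op_entry F y \<sigma> j i)" for m
  have \<delta>: "\<delta> \<longlonglongrightarrow> 0"
  proof -
    have "\<delta> = (\<lambda>m. \<integral>\<^sup>+y. (\<integral>\<^sup>+\<sigma>. hs_norm_sq (fst (rep \<sigma>))
               (\<lambda>v i. fourier_G \<mu> (fs m) y (snd (rep \<sigma>)) v i - F y \<sigma> v i) \<partial>\<nu>) \<partial>lborel)"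
      unfolding \<delta>_def wnorm_sq_def mult_1
      by (intro ext nn_integral_cong hs_norm_sq_diff[OF Fm fs(1), symmetric]) simp
    then show ?thesis using lim2 by (simp only:)
  qed
  have \<eta>: "\<eta> \<longlonglongrightarrow> 0"
  proof -
    \<comment> \<open>\<open>L2_norm\<close> is defined by a Bochner integral, which is 0 for a
      function that is not integrable. Its convergence to 0 is therefore informative only after
      square integrability of the difference has been shown.\<close>
    have eq: "\<eta> m = ennreal ((L2_norm (lborel \<Otimes>\<^sub>M \<mu>) (\<lambda>z. fs m z - f z))\<^sup>2)" for m
    proof -
      have "norm_sq (\<lambda>z. fs m z + - f z) \<le> ennreal (1 + 1) * norm_sq (fs m) + ennreal (1 + 1 / 1) * norm_sq (\<lambda>z. - f z)"
        by (rule norm_sq_add_le) auto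
      also have "\<dots> < \<infinity>"
        using f fs(2)[of m] by (simp add: norm_sq_def in_L2_iff_nn_integral ennreal_mult_less_top)
      finally have "norm_sq (\<lambda>z. fs m z - f z) < \<infinity>" by simp
      moreover have "(\<lambda>z. fs m z - f z) \<in> borel_measurable (lborel \<Otimes>\<^sub>M \<mu>)" by measurable
      ultimately have "in_L2 (lborel \<Otimes>\<^sub>M \<mu>) (\<lambda>z. fs m z - f z)"
        unfolding in_L2_iff_nn_integral norm_sq_def by blast
      then have "integrable (lborel \<Otimes>\<^sub>M \<mu>) (\<lambda>z. (cmod (fs m z - f z))\<^sup>2)"
        unfolding in_L2_def by (rule conjunct2)
      then show ?thesis
        unfolding \<eta>_def norm_sq_def L2_norm_def by (subst nn_integral_eq_integral) auto
    qed
    have "\<eta> = (\<lambda>m. ennreal ((L2_norm (lborel \<Otimes>\<^sub>M \<mu>) (\<lambda>z. fs m z - f z))\<^sup>2))"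
      by (rule ext) (rule eq)
    moreover have "(\<lambda>m. ennreal ((L2_norm (lborel \<Otimes>\<^sub>M \<mu>) (\<lambda>z. fs m z - f z))\<^sup>2)) \<longlonglongrightarrow> ennreal (0\<^sup>2)"
      by (intro tendsto_ennrealI tendsto_power lim1)
    ultimately show ?thesis by simp
  qed
  have fgm: "(\<lambda>(y, \<sigma>). entryG (fs m) y \<sigma> j i) \<in> borel_measurable (lborel \<Otimes>\<^sub>M \<nu>)" for m j i
    by (rule entryG_measurable) measurable
  have Fcm: "(\<lambda>(y, \<sigma>). op_entry F y \<sigma> j i) \<in> borel_measurable (lborel \<Otimes>\<^sub>M \<nu>)" for j i
    by (rule op_entry_measurable[OF Fm])
  have dm: "(\<lambda>(y, \<sigma>). entryG (fs m) y \<sigma> j i - op_entry F y \<sigma> j i) \<in> borel_measurable (lborel \<Otimes>\<^sub>M \<nu>)" for m j i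
    using borel_measurable_diff[OF fgm[of m j i] Fcm[of j i]] by (simp add: case_prod_beta')
  have dm': "(\<lambda>(y, \<sigma>). op_entry F y \<sigma> j i - entryG (fs m) y \<sigma> j i) \<in> borel_measurable (lborel \<Otimes>\<^sub>M \<nu>)" for m j i
    using borel_measurable_diff[OF Fcm[of j i] fgm[of m j i]] by (simp add: case_prod_beta')
  show "norm_sq (shift_diff u c f) \<le> wnorm_sq (mult_weight u c) (op_entry F)" if c: "cmod c \<le> 1"
  \<comment> \<open>The factor 4 absorbs the uniform bounds \<open>norm_sq_shift_diff_le\<close> and
    \<open>mult_weight_le\<close> on the two errors.\<close>
  proof (rule ennreal_le_of_perturbations[OF _ \<delta> \<eta>, where K = "\<lambda>e. (1 + 1 / e) * 4"])
    fix e :: real and m assume e: "e > 0"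
    let ?w = "mult_weight u c"
    have K: "ennreal ((1 + 1 / e) * 4) * z = ennreal (1 + 1 / e) * (4 * z)" for z
    proof -
      have "ennreal ((1 + 1 / e) * 4) = ennreal (1 + 1 / e) * ennreal 4"
        by (rule ennreal_mult) (use e in auto)
      then show ?thesis by (simp only: ennreal_numeral mult.assoc)
    qed
    have "norm_sq (shift_diff u c f) = norm_sq (\<lambda>z. shift_diff u c (fs m) z + shift_diff u c (\<lambda>z. f z - fs m z) z)"
      by (rule arg_cong[where f = norm_sq]) (simp add: fun_eq_iff shift_diff_def algebra_simps)
    also have "\<dots> \<le> ennreal (1 + e) * norm_sq (shift_diff u c (fs m)) + ennreal (1 + 1 / e) * norm_sq (shift_diff u c (\<lambda>z. f z - fs m z))"
      by (rule norm_sq_add_le[OF _ _ e]) measurable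
    also have "norm_sq (shift_diff u c (\<lambda>z. f z - fs m z)) \<le> 4 * norm_sq (\<lambda>z. f z - fs m z)"
      by (rule norm_sq_shift_diff_le[OF _ c]) measurable
    also have "norm_sq (\<lambda>z. f z - fs m z) = \<eta> m"
      unfolding \<eta>_def norm_sq_def by (simp add: norm_minus_commute)
    also have "norm_sq (shift_diff u c (fs m)) = wnorm_sq ?w (entryG (fs m))"
      by (rule norm_sq_shift_diff_eq_wnorm_sq[OF fs(1,2) c])
    also have "wnorm_sq ?w (entryG (fs m)) = wnorm_sq ?w (\<lambda>y \<sigma> j i. op_entry F y \<sigma> j i + (entryG (fs m) y \<sigma> j i - op_entry F y \<sigma> j i))"
      by simp
    also have "\<dots> \<le> ennreal (1 + e) * wnorm_sq ?w (op_entry F) +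
        ennreal (1 + 1 / e) * wnorm_sq ?w (\<lambda>y \<sigma> j i. entryG (fs m) y \<sigma> j i - op_entry F y \<sigma> j i)"
      by (rule wnorm_sq_add_le[OF Fcm dm _ e]) measurable
    also have "wnorm_sq ?w (\<lambda>y \<sigma> j i. entryG (fs m) y \<sigma> j i - op_entry F y \<sigma> j i) \<le> 4 * \<delta> m"
      unfolding wnorm_sq_def \<delta>_def mult_1 using inner_hs_sum_measurable[OF dm]
      by (subst nn_integral_cmult[symmetric]) (auto intro!: nn_integral_mono mult_right_mono mult_weight_le c)
    finally show "norm_sq (shift_diff u c f) \<le> ennreal (1 + e) * (ennreal (1 + e) * wnorm_sq ?w (op_entry F) +
        ennreal ((1 + 1 / e) * 4) * \<delta> m) + ennreal ((1 + 1 / e) * 4) * \<eta> m"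
      unfolding K by (simp add: mult_left_mono add_mono)
  qed
  show "wnorm_sq (\<lambda>y. 1) (op_entry F) \<le> norm_sq f"
  \<comment> \<open>Here \<open>F\<close> is perturbed before \<open>f\<close>, so the two errors
    trade places.\<close>
  proof (rule ennreal_le_of_perturbations[OF _ \<eta> \<delta>, where K = "\<lambda>e. 1 + 1 / e"])
    fix e :: real and m assume e: "e > 0"
    have sh0: "shift_diff 0 0 h = h" for h :: "(real^'n) \<times> 'k \<Rightarrow> complex" by (simp add: shift_diff_def fun_eq_iff)
    have "wnorm_sq (\<lambda>y. 1) (op_entry F) = wnorm_sq (\<lambda>y. 1) (\<lambda>y \<sigma> j i. entryG (fs m) y \<sigma> j i + (op_entry F y \<sigma> j i - entryG (fs m) y \<sigma> j i))"
      by simp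
    also have "\<dots> \<le> ennreal (1 + e) * wnorm_sq (\<lambda>y. 1) (entryG (fs m)) +
        ennreal (1 + 1 / e) * wnorm_sq (\<lambda>y. 1) (\<lambda>y \<sigma> j i. op_entry F y \<sigma> j i - entryG (fs m) y \<sigma> j i)"
      by (rule wnorm_sq_add_le[OF fgm dm' _ e]) measurable
    also have "wnorm_sq (\<lambda>y. 1) (\<lambda>y \<sigma> j i. op_entry F y \<sigma> j i - entryG (fs m) y \<sigma> j i) = \<delta> m"
      unfolding \<delta>_def wnorm_sq_def by (intro nn_integral_cong arg_cong2[where f = times] refl hs_sum_cong_norm norm_minus_commute)
    also have "wnorm_sq (\<lambda>y. 1) (entryG (fs m)) = norm_sq (fs m)"
      unfolding wnorm_sq_def norm_sq_def mult_1 by (rule plancherel_G[OF fs])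
    also have "norm_sq (fs m) = norm_sq (\<lambda>z. f z + (fs m z - f z))" by simp
    also have "\<dots> \<le> ennreal (1 + e) * norm_sq f + ennreal (1 + 1 / e) * \<eta> m"
      unfolding \<eta>_def by (rule norm_sq_add_le[OF _ _ e]) measurable
    finally show "wnorm_sq (\<lambda>y. 1) (op_entry F) \<le> ennreal (1 + e) * (ennreal (1 + e) * norm_sq f +
        ennreal (1 + 1 / e) * \<eta> m) + ennreal (1 + 1 / e) * \<delta> m"
      by (simp add: mult_left_mono)
  qed
qed

end

section \<open>The uncertainty inequality\<close>

text \<open>Bernoulli's inequality for real exponents: the convex function \<open>v powr p\<close>
  lies above its tangent at 1, and the tangent inequality is solved for \<open>v\<close>.\<close>

lemma le_powr_tangent:
  fixes v p :: real
  assumes "v \<ge> 0" "p \<ge> 1"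
  shows "v \<le> v powr p / p + (1 - 1 / p)"
proof (cases "v = 0")
  case False
  with assms have v: "v > 0" by simp
  have "1 - 1 / v \<le> ln v"
    using ln_le_minus_one[of "1 / v"] v by (simp add: ln_div)
  then have "v * (1 + (p - 1) * (1 - 1 / v)) \<le> v * (1 + (p - 1) * ln v)"
    using v assms by (intro mult_left_mono add_left_mono) auto
  also have "\<dots> \<le> v * exp ((p - 1) * ln v)"
    using v by (intro mult_left_mono exp_ge_add_one_self) auto
  also have "\<dots> = v powr p"
  proof -
    have "v * exp ((p - 1) * ln v) = exp (ln v + (p - 1) * ln v)" by (simp only: exp_add exp_ln[OF v])
    also have "\<dots> = v powr p" using v by (simp add: powr_def algebra_simps)
    finally show ?thesis .
  qed
  finally have "v * (1 + (p - 1) * (1 - 1 / v)) \<le> v powr p" .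
  moreover have "v * (1 + (p - 1) * (1 - 1 / v)) = p * v - p + 1"
    using v by (simp add: field_simps)
  ultimately have "p * v - p + 1 \<le> v powr p" by simp
  then have "v \<le> (v powr p + (p - 1)) / p" using assms by (simp add: pos_le_divide_eq mult.commute)
  also have "\<dots> = v powr p / p + (1 - 1 / p)" using assms by (simp add: add_divide_distrib diff_divide_distrib)
  finally show ?thesis .
qed (use assms in simp)

text \<open>Hoelder's inequality against the constant 1 for the measure with density
  \<open>w\<close>, obtained by integrating the tangent inequality for \<open>u x / c\<close>. An
  upper bound \<open>N\<close> on the total mass suffices, and that is what is known on the dual
  side.\<close>

lemma nn_integral_weighted_powr_le:
  fixes u :: "'a \<Rightarrow> real" and w :: "'a \<Rightarrow> ennreal"
  assumes [measurable]: "u \<in> borel_measurable M" "w \<in> borel_measurable M"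
    and u: "\<And>x. u x \<ge> 0" and p: "p \<ge> 1" and A: "A > 0" and N: "N > 0"
    and wN: "(\<integral>\<^sup>+x. w x \<partial>M) \<le> ennreal N"
    and wA: "(\<integral>\<^sup>+x. ennreal (u x powr p) * w x \<partial>M) = ennreal A"
  shows "(\<integral>\<^sup>+x. ennreal (u x) * w x \<partial>M) \<le> ennreal (A powr (1 / p) * N powr (1 - 1 / p))"
proof -
  \<comment> \<open>The scale that minimises the integrated bound; with it the two terms add up to
    \<open>c * N\<close>.\<close>
  define c where "c = (A / N) powr (1 / p)"
  have c: "c > 0" using A N by (simp add: c_def)
  have cp: "c powr p = A / N" using A N p by (simp add: c_def powr_powr)
  have le: "u x \<le> (c / (p * c powr p)) * u x powr p + c * (1 - 1 / p)" for x
  proof -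
    have "u x = c * (u x / c)" using c by simp
    also have "\<dots> \<le> c * ((u x / c) powr p / p + (1 - 1 / p))"
      using c u p by (intro mult_left_mono le_powr_tangent) auto
    also have "\<dots> = (c / (p * c powr p)) * u x powr p + c * (1 - 1 / p)"
      using c u p by (simp add: powr_divide field_simps)
    finally show ?thesis .
  qed
  have nn: "c / (p * c powr p) \<ge> 0" "c * (1 - 1 / p) \<ge> 0" using c p by auto
  have "(\<integral>\<^sup>+x. ennreal (u x) * w x \<partial>M) \<le>
     (\<integral>\<^sup>+x. ennreal (c / (p * c powr p)) * (ennreal (u x powr p) * w x) + ennreal (c * (1 - 1 / p)) * w x \<partial>M)"
  proof (rule nn_integral_mono)
    fix x
    have "ennreal (u x) \<le> ennreal ((c / (p * c powr p)) * u x powr p + c * (1 - 1 / p))"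
      by (rule ennreal_leI[OF le])
    also have "\<dots> = ennreal (c / (p * c powr p)) * ennreal (u x powr p) + ennreal (c * (1 - 1 / p))"
      using nn by (simp only: ennreal_plus ennreal_mult mult_nonneg_nonneg powr_ge_zero)
    finally have "ennreal (u x) * w x \<le> (ennreal (c / (p * c powr p)) * ennreal (u x powr p) + ennreal (c * (1 - 1 / p))) * w x"
      by (rule mult_right_mono) simp
    then show "ennreal (u x) * w x \<le> ennreal (c / (p * c powr p)) * (ennreal (u x powr p) * w x) + ennreal (c * (1 - 1 / p)) * w x"
      by (simp only: distrib_right mult.assoc)
  qed
  also have "\<dots> = ennreal (c / (p * c powr p)) * (\<integral>\<^sup>+x. ennreal (u x powr p) * w x \<partial>M) + ennreal (c * (1 - 1 / p)) * (\<integral>\<^sup>+x. w x \<partial>M)"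
    by (subst nn_integral_add) (simp_all add: nn_integral_cmult)
  also have "\<dots> \<le> ennreal (c / (p * c powr p)) * ennreal A + ennreal (c * (1 - 1 / p)) * ennreal N"
    unfolding wA by (intro add_left_mono mult_left_mono wN) simp
  also have "\<dots> = ennreal ((c / (p * c powr p)) * A + c * (1 - 1 / p) * N)"
    using nn A N by (simp only: ennreal_plus ennreal_mult mult_nonneg_nonneg less_imp_le)
  also have "(c / (p * c powr p)) * A + c * (1 - 1 / p) * N = c * N"
    unfolding cp using A N p by (simp add: field_simps)
  also have "c * N = A powr (1 / p) * N powr (1 - 1 / p)"
    using A N p by (simp add: c_def powr_divide powr_diff)
  finally show ?thesis .
qed

section \<open>The case a = b = 1\<close>

context plancherel_setup
begin

text \<open>The dual side enters only through the quadratic bound \<open>D\<close> on translation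
  differences, so the argument takes place entirely on the group.\<close>

lemma heisenberg_coord:
  fixes f :: "'a::euclidean_space \<times> 'k \<Rightarrow> complex"
  assumes f: "in_L2 (lborel \<Otimes>\<^sub>M \<mu>) f" and b: "b \<in> Basis"
    and X: "integrable (lborel \<Otimes>\<^sub>M \<mu>) (\<lambda>z. (fst z \<bullet> b)\<^sup>2 * (cmod (f z))\<^sup>2)"
    and D: "\<And>t. t > 0 \<Longrightarrow> norm_sq (shift_diff (t *\<^sub>R b) 1 f) \<le> ennreal (4 * pi\<^sup>2 * t\<^sup>2 * Y)"
    and Y: "Y \<ge> 0" and \<beta>: "\<beta> > 0"
  shows "(\<integral>z. (cmod (f z))\<^sup>2 \<partial>(lborel \<Otimes>\<^sub>M \<mu>)) \<le> 2 * pi\<^sup>2 * \<beta> * Y +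
    2 / \<beta> * (\<integral>z. (fst z \<bullet> b)\<^sup>2 * (cmod (f z))\<^sup>2 \<partial>(lborel \<Otimes>\<^sub>M \<mu>))"
proof -
  let ?P = "(lborel :: 'a measure) \<Otimes>\<^sub>M \<mu>"
  let ?x = "\<lambda>z. fst z \<bullet> b" and ?s = "\<lambda>z. (cmod (f z))\<^sup>2"
  have [measurable]: "f \<in> borel_measurable ?P" and S: "integrable ?P ?s"
    using f by (auto simp: in_L2_def)
  have I1: "integrable ?P (\<lambda>z. ?x z * ?s z)"
  proof (rule Bochner_Integration.integrable_bound)
    show "integrable ?P (\<lambda>z. ?s z + ?x z ^ 2 * ?s z)" using S X by simp
    have "\<bar>?x z\<bar> * ?s z \<le> (1 + (?x z)\<^sup>2) * ?s z" for z
    proof (rule mult_right_mono)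
      have "0 \<le> (\<bar>?x z\<bar> - 1)\<^sup>2 + 1" by simp
      then show "\<bar>?x z\<bar> \<le> 1 + (?x z)\<^sup>2"
        using sum_squares_bound[of "\<bar>?x z\<bar>" 1] by (simp add: power2_abs)
    qed simp
    then show "AE z in ?P. norm (?x z * ?s z) \<le> norm (?s z + ?x z ^ 2 * ?s z)"
      by (auto simp: abs_mult algebra_simps)
  qed measurable
  define N where "N = (\<integral>z. ?s z \<partial>?P)"
  define X2 where "X2 = (\<integral>z. (?x z)\<^sup>2 * ?s z \<partial>?P)"
  \<comment> \<open>The first moment need not vanish, but in the estimates it always carries a
    factor \<open>t\<close> and drops out in the limit.\<close>
  define c where "c = (\<integral>z. ?x z * ?s z \<partial>?P)"
  have bb: "b \<bullet> b = 1" using b by simp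
  have main: "N \<le> 2 * pi\<^sup>2 * \<beta> * Y + (1 / \<beta>) * (2 * X2 - 2 * t * c + t\<^sup>2 * N)" if t: "t > 0" for t
  proof -
    let ?T = "\<lambda>z. (fst z + t *\<^sub>R b, snd z)"
    let ?d = "shift_diff (t *\<^sub>R b) 1 f"
    have G1: "integrable ?P (\<lambda>z. (?x z - t) * ?s z)"
      using I1 S by (simp add: left_diff_distrib)
    have G2: "integrable ?P (\<lambda>z. (?x z - t)\<^sup>2 * ?s z)"
    proof -
      have "(?x z - t)\<^sup>2 * ?s z = (?x z)\<^sup>2 * ?s z - 2 * t * (?x z * ?s z) + t\<^sup>2 * ?s z" for z
        by (simp add: power2_diff algebra_simps)
      then show ?thesis using X I1 S by simp
    qed
    \<comment> \<open>Writing \<open>?x z\<close> as \<open>?x (?T z) - t\<close> turns the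
      integrand into a translate. The resulting term \<open>t * N\<close> is the source of the
      left-hand side of the inequality.\<close>
    have s1: "(\<integral>z. ?x z * ?s (?T z) \<partial>?P) = c - t * N" and i1: "integrable ?P (\<lambda>z. ?x z * ?s (?T z))"
    proof -
      have "(\<integral>z. (?x (?T z) - t) * ?s (?T z) \<partial>?P) = (\<integral>z. (?x z - t) * ?s z \<partial>?P)"
        by (rule integral_shift_pair[where G = "\<lambda>z. (?x z - t) * ?s z"]) measurable
      also have "\<dots> = c - t * N" using I1 S by (simp add: left_diff_distrib c_def N_def)
      finally show "(\<integral>z. ?x z * ?s (?T z) \<partial>?P) = c - t * N" by (simp add: inner_add_left bb)
      show "integrable ?P (\<lambda>z. ?x z * ?s (?T z))"
        using integrable_shift_pair[OF G1, of "t *\<^sub>R b"] by (simp add: inner_add_left bb)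
    qed
    have s2: "(\<integral>z. (?x z)\<^sup>2 * ?s (?T z) \<partial>?P) = X2 - 2 * t * c + t\<^sup>2 * N"
      and i2: "integrable ?P (\<lambda>z. (?x z)\<^sup>2 * ?s (?T z))"
    proof -
      have "(\<integral>z. (?x (?T z) - t)\<^sup>2 * ?s (?T z) \<partial>?P) = (\<integral>z. (?x z - t)\<^sup>2 * ?s z \<partial>?P)"
        by (rule integral_shift_pair[where G = "\<lambda>z. (?x z - t)\<^sup>2 * ?s z"]) measurable
      also have "\<dots> = (\<integral>z. (?x z)\<^sup>2 * ?s z - 2 * t * (?x z * ?s z) + t\<^sup>2 * ?s z \<partial>?P)"
        by (intro Bochner_Integration.integral_cong) (simp_all add: power2_diff algebra_simps)
      also have "\<dots> = X2 - 2 * t * c + t\<^sup>2 * N"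
        using X I1 S by (simp add: c_def N_def X2_def)
      finally show "(\<integral>z. (?x z)\<^sup>2 * ?s (?T z) \<partial>?P) = X2 - 2 * t * c + t\<^sup>2 * N" by (simp add: inner_add_left bb)
      show "integrable ?P (\<lambda>z. (?x z)\<^sup>2 * ?s (?T z))"
        using integrable_shift_pair[OF G2, of "t *\<^sub>R b"] by (simp add: inner_add_left bb)
    qed
    have di: "integrable ?P (\<lambda>z. (cmod (?d z))\<^sup>2)"
      using in_L2_shift_diff[OF f, of 1 "t *\<^sub>R b"] by (simp add: in_L2_def)
    have dle: "(\<integral>z. (cmod (?d z))\<^sup>2 \<partial>?P) \<le> 4 * pi\<^sup>2 * t\<^sup>2 * Y"
      using D[OF t] di Y by (simp add: norm_sq_def nn_integral_eq_integral)
    \<comment> \<open>The squared difference is of order \<open>t\<^sup>2\<close> and the moments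
      are of order 1. The AM-GM weight \<open>\<beta> / t\<close> makes both terms of order
      \<open>t\<close>, so that dividing by \<open>t\<close> leaves a finite limit.\<close>
    let ?\<alpha> = "\<beta> / t"
    have \<alpha>: "?\<alpha> > 0" using \<beta> t by simp
    have pw: "?x z * ?s z - ?x z * ?s (?T z) \<le>
        ?\<alpha> / 2 * (cmod (?d z))\<^sup>2 + (1 / ?\<alpha>) * ((?x z)\<^sup>2 * ?s z + (?x z)\<^sup>2 * ?s (?T z))" for z
    proof -
      let ?p = "cmod (f z)" and ?q = "cmod (f (?T z))" and ?e = "cmod (?d z)"
      let ?r = "\<bar>?x z\<bar> * (?p + ?q)" and ?Q = "(?x z)\<^sup>2 * ?s z + (?x z)\<^sup>2 * ?s (?T z)"
      have "?x z * ?s z - ?x z * ?s (?T z) = ?x z * ((?p - ?q) * (?p + ?q))"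
        by (simp add: power2_eq_square algebra_simps)
      also have "\<dots> \<le> \<bar>?x z * ((?p - ?q) * (?p + ?q))\<bar>" by (rule abs_ge_self)
      also have "\<dots> = \<bar>?p - ?q\<bar> * ?r" by (simp add: abs_mult)
      finally have 1: "?x z * ?s z - ?x z * ?s (?T z) \<le> \<bar>?p - ?q\<bar> * ?r" .
      have "\<bar>?p - ?q\<bar> \<le> ?e"
        unfolding shift_diff_def using norm_triangle_ineq3[of "f (?T z)" "f z"] by (simp add: abs_minus_commute)
      then have 2: "\<bar>?p - ?q\<bar> * ?r \<le> ?e * ?r" by (rule mult_right_mono) simp
      have "0 \<le> (?\<alpha> * ?e - ?r)\<^sup>2 / (2 * ?\<alpha>)"
        using \<alpha> by (intro divide_nonneg_pos zero_le_power2) simp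
      also have "\<dots> = ?\<alpha> / 2 * ?e\<^sup>2 + (1 / (2 * ?\<alpha>)) * ?r\<^sup>2 - ?e * ?r"
        using \<beta> t by (simp add: power2_diff field_simps power2_eq_square)
      finally have 3: "?e * ?r \<le> ?\<alpha> / 2 * ?e\<^sup>2 + (1 / (2 * ?\<alpha>)) * ?r\<^sup>2" by simp
      have "(?p + ?q)\<^sup>2 \<le> 2 * (?p\<^sup>2 + ?q\<^sup>2)" using sum_squares_bound[of ?p ?q] by (simp add: power2_sum)
      then have "(?x z)\<^sup>2 * (?p + ?q)\<^sup>2 \<le> (?x z)\<^sup>2 * (2 * (?p\<^sup>2 + ?q\<^sup>2))" by (rule mult_left_mono) simp
      also have "\<dots> = 2 * ?Q" by (simp only: distrib_left mult_ac)
      finally have "?r\<^sup>2 \<le> 2 * ?Q" by (simp only: power_mult_distrib power2_abs)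
      then have "(1 / (2 * ?\<alpha>)) * ?r\<^sup>2 \<le> (1 / (2 * ?\<alpha>)) * (2 * ?Q)"
        using \<beta> t by (intro mult_left_mono) simp_all
      also have "(1 / (2 * ?\<alpha>)) * (2 * Z) = (1 / ?\<alpha>) * Z" for Z by simp
      finally have "(1 / (2 * ?\<alpha>)) * ?r\<^sup>2 \<le> (1 / ?\<alpha>) * ?Q" .
      with 1 2 3 show ?thesis by linarith
    qed
    have "t * N = (\<integral>z. ?x z * ?s z - ?x z * ?s (?T z) \<partial>?P)"
      using I1 i1 by (simp add: s1 c_def)
    also have "\<dots> \<le> (\<integral>z. ?\<alpha> / 2 * (cmod (?d z))\<^sup>2 + (1 / ?\<alpha>) * ((?x z)\<^sup>2 * ?s z + (?x z)\<^sup>2 * ?s (?T z)) \<partial>?P)"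
      by (intro integral_mono pw Bochner_Integration.integrable_diff I1 i1 Bochner_Integration.integrable_add
          integrable_mult_right di X i2)
    also have "\<dots> = ?\<alpha> / 2 * (\<integral>z. (cmod (?d z))\<^sup>2 \<partial>?P) + (1 / ?\<alpha>) * (X2 + (X2 - 2 * t * c + t\<^sup>2 * N))"
      using di X i2 by (simp add: s2 X2_def)
    also have "\<dots> \<le> ?\<alpha> / 2 * (4 * pi\<^sup>2 * t\<^sup>2 * Y) + (1 / ?\<alpha>) * (X2 + (X2 - 2 * t * c + t\<^sup>2 * N))"
      using \<alpha> dle by (intro add_right_mono mult_left_mono) auto
    also have "\<dots> = t * (2 * pi\<^sup>2 * \<beta> * Y + (1 / \<beta>) * (2 * X2 - 2 * t * c + t\<^sup>2 * N))"
      using \<beta> t by (simp add: field_simps power2_eq_square)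
    finally show ?thesis using t by simp
  qed
  define e where "e = (\<lambda>n. inverse (real (Suc n)))"
  have e: "e \<longlonglongrightarrow> 0" unfolding e_def by (rule LIMSEQ_inverse_real_of_nat)
  have "(\<lambda>n. 2 * pi\<^sup>2 * \<beta> * Y + (1 / \<beta>) * (2 * X2 - 2 * e n * c + (e n)\<^sup>2 * N)) \<longlonglongrightarrow>
      2 * pi\<^sup>2 * \<beta> * Y + (1 / \<beta>) * (2 * X2 - 2 * 0 * c + 0\<^sup>2 * N)"
    by (intro tendsto_intros e)
  then have "N \<le> 2 * pi\<^sup>2 * \<beta> * Y + (1 / \<beta>) * (2 * X2 - 2 * 0 * c + 0\<^sup>2 * N)"
  proof (rule LIMSEQ_le_const, intro exI allI impI)
    fix n show "N \<le> 2 * pi\<^sup>2 * \<beta> * Y + (1 / \<beta>) * (2 * X2 - 2 * e n * c + (e n)\<^sup>2 * N)"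
      by (rule main) (simp add: e_def)
  qed
  then show ?thesis by (simp add: N_def X2_def)
qed

text \<open>A chord of the unit circle is no longer than its arc, here of length
  \<open>2 * pi * t * \<bar>y \<bullet> b\<bar>\<close>. Its square is the source of the factor
  \<open>4 * pi\<^sup>2 * t\<^sup>2\<close> in the hypothesis \<open>D\<close> of
  \<open>heisenberg_coord\<close>.\<close>

lemma mult_weight_le_sq:
  assumes "t > 0"
  shows "mult_weight (t *\<^sub>R b) 1 y \<le> ennreal (4 * pi\<^sup>2 * t\<^sup>2) * ennreal ((y \<bullet> b)\<^sup>2)"
proof -
  have "cmod (echar (- (t *\<^sub>R b \<bullet> y)) - 1) \<le> \<bar>2 * pi * t * (y \<bullet> b)\<bar>"
    using iexp_approx1[of "2 * pi * t * (y \<bullet> b)" 0] by (simp add: echar_def inner_commute mult_ac)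
  then have "(cmod (echar (- (t *\<^sub>R b \<bullet> y)) - 1))\<^sup>2 \<le> \<bar>2 * pi * t * (y \<bullet> b)\<bar>\<^sup>2"
    by (rule power_mono) simp
  also have "\<dots> = 4 * pi\<^sup>2 * t\<^sup>2 * (y \<bullet> b)\<^sup>2" by (simp add: power_mult_distrib)
  finally show ?thesis unfolding mult_weight_def by (simp add: ennreal_leI flip: ennreal_mult)
qed

lemma norm_power2_Basis: "(norm x)\<^sup>2 = (\<Sum>b\<in>Basis. (x \<bullet> b)\<^sup>2)" for x :: "'a::euclidean_space"
  unfolding power2_norm_eq_inner by (subst euclidean_inner) (simp add: power2_eq_square)

lemma heisenberg_sum:
  fixes f :: "(real^'n::finite) \<times> 'k \<Rightarrow> complex"
  assumes f: "in_L2 (lborel \<Otimes>\<^sub>M \<mu>) f" and F: "is_L2_fourier \<mu> rep \<nu> f F"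
    and X: "integrable (lborel \<Otimes>\<^sub>M \<mu>) (\<lambda>z. (norm (fst z))\<^sup>2 * (cmod (f z))\<^sup>2)"
    and Y: "wnorm_sq (\<lambda>y. ennreal ((norm y)\<^sup>2)) (op_entry F) = ennreal Y" "Y \<ge> 0" and \<beta>: "\<beta> > 0"
  shows "real CARD('n) * (\<integral>z. (cmod (f z))\<^sup>2 \<partial>(lborel \<Otimes>\<^sub>M \<mu>)) \<le> 2 * pi\<^sup>2 * \<beta> * Y +
    2 / \<beta> * (\<integral>z. (norm (fst z))\<^sup>2 * (cmod (f z))\<^sup>2 \<partial>(lborel \<Otimes>\<^sub>M \<mu>))"
proof -
  let ?P = "(lborel :: (real^'n) measure) \<Otimes>\<^sub>M \<mu>"
  have [measurable]: "f \<in> borel_measurable ?P" using f by (simp add: in_L2_def)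
  have Fm: "measurable_op_field rep \<nu> F" using F by (simp add: is_L2_fourier_def)
  note [measurable] = inner_hs_sum_measurable[OF op_entry_measurable[OF Fm]]
  define Yb where "Yb b = wnorm_sq (\<lambda>y. ennreal ((y \<bullet> b)\<^sup>2)) (op_entry F)" for b
  have sumY: "(\<Sum>b\<in>Basis. Yb b) = ennreal Y"
  proof -
    have "(\<Sum>b\<in>Basis. Yb b) = wnorm_sq (\<lambda>y. ennreal ((norm y)\<^sup>2)) (op_entry F)"
      unfolding Yb_def wnorm_sq_def
      by (subst nn_integral_sum[symmetric]) (auto simp: norm_power2_Basis sum_ennreal simp flip: sum_distrib_right)
    then show ?thesis using Y by simp
  qed
  have fin: "Yb b \<noteq> \<infinity>" if "b \<in> Basis" for b
  proof -
    have "Yb b \<le> (\<Sum>b\<in>Basis. Yb b)" using that by (intro member_le_sum) auto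
    then show ?thesis unfolding sumY by (auto simp: top_unique)
  qed
  define y where "y b = enn2real (Yb b)" for b
  have Yy: "Yb b = ennreal (y b)" if "b \<in> Basis" for b
    using fin[OF that] by (simp add: y_def less_top)
  have y0: "y b \<ge> 0" for b by (simp add: y_def)
  have "ennreal (\<Sum>b\<in>Basis. y b) = ennreal Y"
  proof -
    have "ennreal (\<Sum>b\<in>Basis. y b) = (\<Sum>b\<in>Basis. ennreal (y b))"
      by (rule sum_ennreal[symmetric]) (rule y0)
    also have "\<dots> = (\<Sum>b\<in>Basis. Yb b)" by (rule sum.cong) (simp_all add: Yy)
    finally show ?thesis by (simp only: sumY)
  qed
  then have sumy: "(\<Sum>b\<in>Basis. y b) = Y"
    using Y y0 by (simp add: sum_nonneg)
  have Xb: "integrable ?P (\<lambda>z. (fst z \<bullet> b)\<^sup>2 * (cmod (f z))\<^sup>2)" if "b \<in> Basis" for b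
  proof (rule Bochner_Integration.integrable_bound[OF X])
    have "(fst z \<bullet> b)\<^sup>2 \<le> (norm (fst z))\<^sup>2" for z :: "(real^'n) \<times> 'k"
      unfolding norm_power2_Basis using that by (intro member_le_sum) auto
    then show "AE z in ?P. norm ((fst z \<bullet> b)\<^sup>2 * (cmod (f z))\<^sup>2) \<le> norm ((norm (fst z))\<^sup>2 * (cmod (f z))\<^sup>2)"
      by (auto intro!: mult_right_mono)
  qed measurable
  have "(\<integral>z. (cmod (f z))\<^sup>2 \<partial>?P) \<le> 2 * pi\<^sup>2 * \<beta> * y b + 2 / \<beta> * (\<integral>z. (fst z \<bullet> b)\<^sup>2 * (cmod (f z))\<^sup>2 \<partial>?P)"
    if b: "b \<in> Basis" for b
  proof (rule heisenberg_coord[OF f b Xb[OF b] _ y0 \<beta>])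
    fix t :: real assume t: "t > 0"
    have "norm_sq (shift_diff (t *\<^sub>R b) 1 f) \<le> wnorm_sq (mult_weight (t *\<^sub>R b) 1) (op_entry F)"
      by (rule norm_sq_shift_diff_le_wnorm_sq[OF f F]) simp
    also have "\<dots> \<le> ennreal (4 * pi\<^sup>2 * t\<^sup>2) * Yb b"
      unfolding wnorm_sq_def Yb_def
      by (subst nn_integral_cmult[symmetric])
         (auto intro!: nn_integral_mono mult_right_mono mult_weight_le_sq t simp flip: mult.assoc)
    also have "\<dots> = ennreal (4 * pi\<^sup>2 * t\<^sup>2 * y b)"
      unfolding Yy[OF b] using y0 by (simp add: ennreal_mult)
    finally show "norm_sq (shift_diff (t *\<^sub>R b) 1 f) \<le> ennreal (4 * pi\<^sup>2 * t\<^sup>2 * y b)" .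
  qed
  then have "(\<Sum>b\<in>(Basis :: (real^'n) set). (\<integral>z. (cmod (f z))\<^sup>2 \<partial>?P)) \<le>
      (\<Sum>b\<in>Basis. 2 * pi\<^sup>2 * \<beta> * y b + 2 / \<beta> * (\<integral>z. (fst z \<bullet> b)\<^sup>2 * (cmod (f z))\<^sup>2 \<partial>?P))"
    by (rule sum_mono)
  also have "\<dots> = 2 * pi\<^sup>2 * \<beta> * Y + 2 / \<beta> * (\<Sum>b\<in>Basis. (\<integral>z. (fst z \<bullet> b)\<^sup>2 * (cmod (f z))\<^sup>2 \<partial>?P))"
    by (simp only: sum.distrib sum_distrib_left[symmetric] sumy)
  also have "(\<Sum>b\<in>Basis. (\<integral>z. (fst z \<bullet> b)\<^sup>2 * (cmod (f z))\<^sup>2 \<partial>?P)) = (\<integral>z. (norm (fst z))\<^sup>2 * (cmod (f z))\<^sup>2 \<partial>?P)"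
  proof -
    have "(norm (fst z))\<^sup>2 * (cmod (f z))\<^sup>2 = (\<Sum>b\<in>Basis. (fst z \<bullet> b)\<^sup>2 * (cmod (f z))\<^sup>2)" for z
      by (simp only: norm_power2_Basis[of "fst z"] sum_distrib_right)
    then show ?thesis using Xb by simp
  qed
  finally show ?thesis by simp
qed

end

section \<open>General exponents and degenerate cases\<close>

lemma norm_powr_double: "norm x powr (2 * a) = ((norm x)\<^sup>2) powr a"
  using powr_powr[of "norm x" 2 a] by (simp add: powr_numeral)

text \<open>The power of the norm vanishes only at the origin, a null set. Hence a moment can be 0
  only if the whole density is.\<close>

lemma nn_integral_norm_powr_eq_0:
  fixes w :: "'a::euclidean_space \<Rightarrow> ennreal"
  assumes [measurable]: "w \<in> borel_measurable borel"
    and 0: "(\<integral>\<^sup>+x. ennreal (norm x powr p) * w x \<partial>lborel) = 0"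
  shows "(\<integral>\<^sup>+x. w x \<partial>lborel) = 0"
proof -
  have "AE x in lborel. ennreal (norm x powr p) * w x = 0"
    using 0 by (subst (asm) nn_integral_0_iff_AE) auto
  moreover have "AE x in lborel. x \<noteq> (0 :: 'a)" by (rule AE_lborel_singleton)
  ultimately have "AE x in lborel. w x = 0" by eventually_elim auto
  then show ?thesis by (subst nn_integral_0_iff_AE) auto
qed

lemma le_of_all_weights:
  fixes n X Y :: real
  assumes le: "\<And>\<beta>. \<beta> > 0 \<Longrightarrow> n \<le> 2 * pi\<^sup>2 * \<beta> * Y + 2 / \<beta> * X" and pos: "X > 0" "Y > 0"
  shows "n \<le> 4 * pi * (sqrt X * sqrt Y)"
proof -
  \<comment> \<open>The minimiser: both terms become
    \<open>2 * pi * (sqrt X * sqrt Y)\<close>.\<close>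
  define \<beta> where "\<beta> = sqrt X / (pi * sqrt Y)"
  have "\<beta> > 0" using pos by (simp add: \<beta>_def)
  have "2 * pi\<^sup>2 * \<beta> * Y = 2 * pi * (sqrt X * sqrt Y)"
  proof -
    have "2 * pi\<^sup>2 * \<beta> * (sqrt Y * sqrt Y) = 2 * pi * (sqrt X * sqrt Y)"
      using pos by (simp add: \<beta>_def power2_eq_square field_simps del: real_sqrt_mult_self)
    then show ?thesis using pos by simp
  qed
  moreover have "2 / \<beta> * X = 2 * pi * (sqrt X * sqrt Y)"
  proof -
    have "2 / \<beta> * (sqrt X * sqrt X) = 2 * pi * (sqrt X * sqrt Y)"
      using pos by (simp add: \<beta>_def field_simps del: real_sqrt_mult_self)
    then show ?thesis using pos by simp
  qed
  ultimately show ?thesis using le[OF \<open>\<beta> > 0\<close>] by simp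
qed

text \<open>Bookkeeping of the powers of \<open>N\<close>: under the square roots the two
  interpolation bounds leave N to the power 1 - s with s = (1/a + 1/b) / 2. Against the factor
  \<open>N\<close> on the left this yields N to the power s, which is the norm to the power 1/a +
  1/b.\<close>

lemma uncertainty_exponents:
  fixes n N X Y A B a b :: real
  assumes "n \<ge> 0" "N > 0" "A > 0" "B > 0" "a \<ge> 1" "b \<ge> 1" "X \<ge> 0" "Y \<ge> 0"
    and le: "n * N \<le> 4 * pi * (sqrt X * sqrt Y)"
    and X: "X \<le> A powr (1 / a) * N powr (1 - 1 / a)"
    and Y: "Y \<le> B powr (1 / b) * N powr (1 - 1 / b)"
  shows "n * sqrt N powr (1 / a + 1 / b) / (4 * pi) \<le> A powr (1 / (2 * a)) * B powr (1 / (2 * b))"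
proof -
  have sq: "sqrt (Q powr (1 / r) * N powr (1 - 1 / r)) = Q powr (1 / (2 * r)) * N powr (1 / 2 - 1 / (2 * r))"
    if "Q > 0" "r \<ge> 1" for Q r
    using that \<open>N > 0\<close> by (simp add: powr_half_sqrt[symmetric] powr_mult powr_powr diff_divide_distrib left_diff_distrib mult.commute)
  let ?s = "(1 / a + 1 / b) / 2"
  have "n * N \<le> 4 * pi * (sqrt (A powr (1 / a) * N powr (1 - 1 / a)) * sqrt (B powr (1 / b) * N powr (1 - 1 / b)))"
    using X Y assms by (intro order.trans[OF le] mult_left_mono mult_mono real_sqrt_le_mono) auto
  also have "\<dots> = 4 * pi * (A powr (1 / (2 * a)) * B powr (1 / (2 * b))) *
      (N powr (1 / 2 - 1 / (2 * a)) * N powr (1 / 2 - 1 / (2 * b)))"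
    using assms by (simp add: sq)
  also have "N powr (1 / 2 - 1 / (2 * a)) * N powr (1 / 2 - 1 / (2 * b)) = N powr (1 - ?s)"
  proof -
    have "1 / 2 - 1 / (2 * a) + (1 / 2 - 1 / (2 * b)) = 1 - ?s"
      using assms by (simp add: field_simps)
    then show ?thesis by (simp only: powr_add[symmetric])
  qed
  finally have "n * N * N powr (?s - 1) \<le>
      4 * pi * (A powr (1 / (2 * a)) * B powr (1 / (2 * b))) * N powr (1 - ?s) * N powr (?s - 1)"
    by (rule mult_right_mono) simp
  also have "\<dots> = 4 * pi * (A powr (1 / (2 * a)) * B powr (1 / (2 * b)))"
    using \<open>N > 0\<close> by (simp add: mult.assoc powr_add[symmetric])
  also have "n * N * N powr (?s - 1) = n * N powr ?s"
    using \<open>N > 0\<close> by (simp add: powr_diff)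
  also have "N powr ?s = sqrt N powr (1 / a + 1 / b)"
    using \<open>N > 0\<close> by (simp add: powr_half_sqrt[symmetric] powr_powr)
  finally show ?thesis by (simp add: field_simps)
qed

context plancherel_setup
begin

theorem uncertainty:
  fixes f :: "(real^'n::finite) \<times> 'k \<Rightarrow> complex"
  assumes f: "in_L2 (lborel \<Otimes>\<^sub>M \<mu>) f" and F: "is_L2_fourier \<mu> rep \<nu> f F"
    and ab: "a \<ge> 1" "b \<ge> 1"
  shows "ennreal (real CARD('n) * L2_norm (lborel \<Otimes>\<^sub>M \<mu>) f powr (1 / a + 1 / b) / (4 * pi))
    \<le> ennpowr (\<integral>\<^sup>+x. (\<integral>\<^sup>+k. ennreal (norm x powr (2 * a) * (cmod (f (x, k)))\<^sup>2) \<partial>\<mu>) \<partial>lborel)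
        (1 / (2 * a)) *
      ennpowr (\<integral>\<^sup>+y. (\<integral>\<^sup>+\<sigma>. ennreal (norm y powr (2 * b)) *
          hs_norm_sq (fst (rep \<sigma>)) (F y \<sigma>) \<partial>\<nu>) \<partial>lborel)
        (1 / (2 * b))"
proof -
  let ?P = "(lborel :: (real^'n) measure) \<Otimes>\<^sub>M \<mu>"
  interpret P: pair_sigma_finite "lborel :: (real^'n) measure" \<mu> by (rule pair_mu)
  have Fm: "measurable_op_field rep \<nu> F" using F by (simp add: is_L2_fourier_def)
  have fm [measurable]: "f \<in> borel_measurable ?P" and S: "integrable ?P (\<lambda>z. (cmod (f z))\<^sup>2)"
    using f by (auto simp: in_L2_def)
  define N where "N = (\<integral>z. (cmod (f z))\<^sup>2 \<partial>?P)"
  have NN: "norm_sq f = ennreal N" unfolding norm_sq_def N_def using S by (intro nn_integral_eq_integral) auto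
  have L2: "L2_norm ?P f = sqrt N" by (simp add: L2_norm_def N_def)
  define v where "v x = (\<integral>\<^sup>+k. ennreal ((cmod (f (x, k)))\<^sup>2) \<partial>\<mu>)" for x
  define w where "w y = (\<integral>\<^sup>+\<sigma>. hs_sum (op_entry F y \<sigma>) \<partial>\<nu>)" for y
  have vm [measurable]: "v \<in> borel_measurable borel"
  proof -
    have "(\<lambda>(x, k). ennreal ((cmod (f (x, k)))\<^sup>2)) \<in> borel_measurable ?P" by measurable
    from mu.borel_measurable_nn_integral[OF this] show ?thesis by (simp add: v_def[abs_def])
  qed
  have wm [measurable]: "w \<in> borel_measurable borel"
    unfolding w_def[abs_def] by (rule inner_hs_sum_measurable[OF op_entry_measurable[OF Fm]])
  have vint: "(\<integral>\<^sup>+x. ennreal (u x) * v x \<partial>lborel) = (\<integral>\<^sup>+z. ennreal (u (fst z) * (cmod (f z))\<^sup>2) \<partial>?P)"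
    if [measurable]: "u \<in> borel_measurable borel" and "\<And>x. u x \<ge> 0" for u :: "real^'n \<Rightarrow> real"
  proof -
    have "(\<integral>\<^sup>+z. ennreal (u (fst z) * (cmod (f z))\<^sup>2) \<partial>?P) =
      (\<integral>\<^sup>+x. (\<integral>\<^sup>+k. ennreal (u x * (cmod (f (x, k)))\<^sup>2) \<partial>\<mu>) \<partial>lborel)"
      by (subst mu.nn_integral_fst[symmetric]) simp_all
    also have "\<dots> = (\<integral>\<^sup>+x. ennreal (u x) * v x \<partial>lborel)"
      unfolding v_def using that(2) by (intro nn_integral_cong) (simp add: ennreal_mult nn_integral_cmult)
    finally show ?thesis ..
  qed
  define A where "A = (\<integral>\<^sup>+x. ennreal (norm x powr (2 * a)) * v x \<partial>lborel)"
  define B where "B = (\<integral>\<^sup>+y. ennreal (norm y powr (2 * b)) * w y \<partial>lborel)"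
  have A: "(\<integral>\<^sup>+x. (\<integral>\<^sup>+k. ennreal (norm x powr (2 * a) * (cmod (f (x, k)))\<^sup>2) \<partial>\<mu>) \<partial>lborel) = A"
    unfolding A_def v_def by (intro nn_integral_cong) (simp add: ennreal_mult nn_integral_cmult)
  have B: "(\<integral>\<^sup>+y. (\<integral>\<^sup>+\<sigma>. ennreal (norm y powr (2 * b)) * hs_norm_sq (fst (rep \<sigma>)) (F y \<sigma>) \<partial>\<nu>) \<partial>lborel) = B"
    unfolding B_def w_def
  proof (intro nn_integral_cong)
    fix y :: "real^'n"
    note [measurable] = hs_sum_section_measurable[OF op_entry_measurable[OF Fm]]
    have "(\<integral>\<^sup>+\<sigma>. ennreal (norm y powr (2 * b)) * hs_norm_sq (fst (rep \<sigma>)) (F y \<sigma>) \<partial>\<nu>) =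
      (\<integral>\<^sup>+\<sigma>. ennreal (norm y powr (2 * b)) * hs_sum (op_entry F y \<sigma>) \<partial>\<nu>)"
      by (intro nn_integral_cong) (simp add: hs_norm_sq_F[OF Fm])
    also have "\<dots> = ennreal (norm y powr (2 * b)) * (\<integral>\<^sup>+\<sigma>. hs_sum (op_entry F y \<sigma>) \<partial>\<nu>)"
      by (rule nn_integral_cmult) measurable
    finally show "(\<integral>\<^sup>+\<sigma>. ennreal (norm y powr (2 * b)) * hs_norm_sq (fst (rep \<sigma>)) (F y \<sigma>) \<partial>\<nu>) =
      ennreal (norm y powr (2 * b)) * (\<integral>\<^sup>+\<sigma>. hs_sum (op_entry F y \<sigma>) \<partial>\<nu>)" .
  qed
  have vN: "(\<integral>\<^sup>+x. v x \<partial>lborel) = ennreal N"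
    using vint[of "\<lambda>x. 1"] NN by (simp add: norm_sq_def)
  have wN: "(\<integral>\<^sup>+y. w y \<partial>lborel) \<le> ennreal N"
    using wnorm_sq_le_norm_sq[OF f F] by (simp add: wnorm_sq_def NN w_def)
  \<comment> \<open>At \<open>u = 0\<close>, \<open>c = 0\<close> the weight is constantly 1. The
    crude bound 4 is enough, since the estimate only serves to show that \<open>w\<close> is not
    null when \<open>f\<close> is not.\<close>
  have Nw: "ennreal N \<le> 4 * (\<integral>\<^sup>+y. w y \<partial>lborel)"
  proof -
    have "shift_diff 0 0 f = f" by (simp add: shift_diff_def fun_eq_iff)
    then have "ennreal N \<le> wnorm_sq (mult_weight 0 0) (op_entry F)"
      using norm_sq_shift_diff_le_wnorm_sq[OF f F, of 0 0] NN by simp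
    also have "\<dots> \<le> 4 * (\<integral>\<^sup>+y. w y \<partial>lborel)"
      unfolding wnorm_sq_def w_def[symmetric]
      by (subst nn_integral_cmult[symmetric]) (auto intro!: nn_integral_mono mult_right_mono mult_weight_le)
    finally show ?thesis .
  qed
  show ?thesis
  proof (cases "N = 0")
    case True
    \<comment> \<open>The left-hand side is 0, because \<open>0 powr p\<close> is 0.\<close>
    then show ?thesis by (simp add: L2)
  next
    case False
    moreover have "N \<ge> 0" by (simp add: N_def)
    ultimately have N: "N > 0" by simp
    have A0: "A \<noteq> 0"
      using nn_integral_norm_powr_eq_0[OF vm, of "2 * a"] vN N by (auto simp: A_def)
    have B0: "B \<noteq> 0"
      using nn_integral_norm_powr_eq_0[OF wm, of "2 * b"] Nw N by (auto simp: B_def)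
    \<comment> \<open>In \<open>ennreal\<close> the product of 0 and infinity is 0, so an infinite
      moment settles the claim only because the other factor is nonzero.\<close>
    have nz: "ennpowr Q p \<noteq> 0" if "Q \<noteq> 0" for Q p
      using that by (cases Q rule: ennreal_cases) (auto simp: ennpowr_def)
    show ?thesis
    proof (cases "A = \<infinity> \<or> B = \<infinity>")
      case True
      then have "ennpowr A (1 / (2 * a)) * ennpowr B (1 / (2 * b)) = \<infinity>"
        using nz[OF A0] nz[OF B0] by (auto simp: ennpowr_def ennreal_mult_eq_top_iff ennreal_top_mult ennreal_mult_top)
      then show ?thesis unfolding A B by simp
    next
      case False
      then obtain A' B' where A': "A = ennreal A'" "A' \<ge> 0" and B': "B = ennreal B'" "B' \<ge> 0"
        by (cases A rule: ennreal_cases; cases B rule: ennreal_cases) auto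
      have pos: "A' > 0" "B' > 0" using A' B' A0 B0 by (auto simp: less_le)
      have hX: "(\<integral>\<^sup>+x. ennreal ((norm x)\<^sup>2) * v x \<partial>lborel) \<le> ennreal (A' powr (1 / a) * N powr (1 - 1 / a))"
        by (rule nn_integral_weighted_powr_le[OF _ _ _ ab(1) pos(1) N])
           (use vN A' in \<open>auto simp: A_def norm_powr_double\<close>)
      have hY: "(\<integral>\<^sup>+y. ennreal ((norm y)\<^sup>2) * w y \<partial>lborel) \<le> ennreal (B' powr (1 / b) * N powr (1 - 1 / b))"
        by (rule nn_integral_weighted_powr_le[OF _ _ _ ab(2) pos(2) N wN])
           (use B' in \<open>auto simp: B_def norm_powr_double\<close>)
      have X: "integrable ?P (\<lambda>z. (norm (fst z))\<^sup>2 * (cmod (f z))\<^sup>2)"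
        using hX vint[of "\<lambda>x. (norm x)\<^sup>2"]
        by (intro integrableI_bounded) (auto simp: le_less_trans)
      define X2 where "X2 = (\<integral>z. (norm (fst z))\<^sup>2 * (cmod (f z))\<^sup>2 \<partial>?P)"
      have X2: "(\<integral>\<^sup>+x. ennreal ((norm x)\<^sup>2) * v x \<partial>lborel) = ennreal X2" "X2 \<ge> 0"
        using vint[of "\<lambda>x. (norm x)\<^sup>2"] nn_integral_eq_integral[OF X] by (auto simp: X2_def)
      obtain Y2 where Y2: "(\<integral>\<^sup>+y. ennreal ((norm y)\<^sup>2) * w y \<partial>lborel) = ennreal Y2" "Y2 \<ge> 0"
        using hY by (cases "\<integral>\<^sup>+y. ennreal ((norm y)\<^sup>2) * w y \<partial>lborel" rule: ennreal_cases) (auto simp: top_unique)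
      have "X2 \<noteq> 0"
        using nn_integral_norm_powr_eq_0[OF vm, of 2, simplified] vN N X2 by auto
      then have X2pos: "X2 > 0" using X2 by simp
      have "Y2 \<noteq> 0"
        using nn_integral_norm_powr_eq_0[OF wm, of 2, simplified] Nw N Y2 by auto
      then have Y2pos: "Y2 > 0" using Y2 by simp
      have wY: "wnorm_sq (\<lambda>y. ennreal ((norm y)\<^sup>2)) (op_entry F) = ennreal Y2"
        using Y2 by (simp add: wnorm_sq_def w_def)
      have "real CARD('n) * N \<le> 4 * pi * (sqrt X2 * sqrt Y2)"
        using heisenberg_sum[OF f F X wY Y2(2)] X2pos Y2pos
        unfolding N_def[symmetric] X2_def[symmetric] by (rule le_of_all_weights)
      then have "real CARD('n) * sqrt N powr (1 / a + 1 / b) / (4 * pi) \<le> A' powr (1 / (2 * a)) * B' powr (1 / (2 * b))"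
        using hX hY X2 Y2 by (intro uncertainty_exponents[OF _ N pos ab X2(2) Y2(2)]) auto
      then show ?thesis
        unfolding A B using A' B' by (simp add: L2 ennpowr_def ennreal_leI flip: ennreal_mult)
    qed
  qed
qed

end

theorem theorem2p1:
  fixes \<mu> :: "'k::{topological_group_add, second_countable_topology, t2_space} measure"
    and rep :: "'k urep set \<Rightarrow> 'k urep"
    and \<nu> :: "'k urep set measure"
    and f :: "(real^'n::finite) \<times> 'k \<Rightarrow> complex"
    and F :: "real^'n \<Rightarrow> 'k urep set \<Rightarrow> hop"
    and a b :: real
  assumes "locally_compact_space (euclidean :: 'k topology)"
    and "unimodular_group TYPE('k)"
    and "type_I_group TYPE('k)"
    and "left_haar_measure \<mu>"
    and "measurable_section rep"
    and "plancherel_measure \<mu> rep \<nu>"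
    and "in_L2 (lborel \<Otimes>\<^sub>M \<mu>) f"
    and "is_L2_fourier \<mu> rep \<nu> f F"
    and "a \<ge> 1" and "b \<ge> 1"
  shows "ennreal (real CARD('n) * L2_norm (lborel \<Otimes>\<^sub>M \<mu>) f powr (1 / a + 1 / b) / (4 * pi))
    \<le> ennpowr (\<integral>\<^sup>+x. (\<integral>\<^sup>+k. ennreal (norm x powr (2 * a) * (cmod (f (x, k)))\<^sup>2) \<partial>\<mu>) \<partial>lborel)
        (1 / (2 * a)) *
      ennpowr (\<integral>\<^sup>+y. (\<integral>\<^sup>+\<sigma>. ennreal (norm y powr (2 * b)) *
          hs_norm_sq (fst (rep \<sigma>)) (F y \<sigma>) \<partial>\<nu>) \<partial>lborel)
        (1 / (2 * b))"
proof -
  interpret plancherel_setup \<mu> rep \<nu>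
    by (rule plancherel_setup.intro) (fact assms)+
  show ?thesis by (rule uncertainty) (fact assms)+
qed

end
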